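(* Let $L>0$ and let $\rho,a\in BV(0,L)$ satisfy $0<\rho_0\le\rho(x)\le\rho_1$ and $0<a_0\le a(x)\le a_1$ for a.e. $x\in(0,L)$, for some constants $\rho_0,\rho_1,a_0,a_1$. Let $\beta=\operatorname{ess\,sup}_{x\in[0,L]}\sqrt{\rho(x)/a(x)}$ and let $T>L\beta$. Then there exists $C>0$, depending on $a$, $\rho$ and $T$ but independent of $s$, such that $$\|s(t)\|_{H^{-1}(L\beta,T)}\le C\,\|\psi(0,t)\|_{L^2(0,T)}$$ for every $s\in H^{-1}(0,T)$ with $\operatorname{supp}(s)\subset(L\beta,T)$, where $\psi$ is the corresponding finite energy solution of $$\begin{cases}\rho(x)\psi_{tt}-(a(x)\psi_x)_x=0, & 0<x<L,\ 0<t<T,\\ \psi(x,T)=0,\quad \psi_t(x,T)=0, & 0<x<L,\\ \psi_x(0,t)=0,\quad \psi_x(L,t)=s(t), & 0<t<T.\end{cases}$$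
   Context: The finite energy solution of the adjoint system is its unique weak solution $\psi$, with $(\psi,\psi_t)\in C([0,T];L^2(0,L)\times H^{-1}(0,L))$ and with boundary trace $\psi(0,\cdot)\in L^2(0,T)$. *)

theory Defs
  imports "HOL-Analysis.Analysis" "HOL-Probability.Essential_Supremum"
begin

subsection \<open>Square integrable functions\<close>

definition L2_on :: "real set \<Rightarrow> (real \<Rightarrow> real) \<Rightarrow> bool" where
  "L2_on I f \<longleftrightarrow> f \<in> borel_measurable (lebesgue_on I) \<and> integrable (lebesgue_on I) (\<lambda>x. (f x)\<^sup>2)"

definition L2_norm :: "real set \<Rightarrow> (real \<Rightarrow> real) \<Rightarrow> real" where
  "L2_norm I f = sqrt (\<integral>x. (f x)\<^sup>2 \<partial>lebesgue_on I)"

definition continuous_L2 :: "real \<Rightarrow> real set \<Rightarrow> (real \<Rightarrow> real \<Rightarrow> real) \<Rightarrow> bool" where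
  "continuous_L2 T I u \<longleftrightarrow>
     (\<forall>t\<in>{0..T}. L2_on I (u t)) \<and>
     (\<forall>t\<in>{0..T}. ((\<lambda>\<tau>. L2_norm I (\<lambda>x. u \<tau> x - u t x)) \<longlongrightarrow> 0) (at t within {0..T}))"

subsection \<open>Functions of bounded variation\<close>

text \<open>An element of $BV(I)$ is a class of functions modulo null sets; it is in $BV(I)$ when its
  essential variation is finite, i.e. when some representative has finite pointwise variation.\<close>

definition finite_variation_on :: "real set \<Rightarrow> (real \<Rightarrow> real) \<Rightarrow> bool" where
  "finite_variation_on I f \<longleftrightarrow>
     (\<exists>M. \<forall>n. \<forall>x :: nat \<Rightarrow> real. (\<forall>i\<le>n. x i \<in> I) \<and> (\<forall>i<n. x i \<le> x (Suc i)) \<longrightarrow>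
        (\<Sum>i<n. \<bar>f (x (Suc i)) - f (x i)\<bar>) \<le> M)"

definition BV_on :: "real set \<Rightarrow> (real \<Rightarrow> real) \<Rightarrow> bool" where
  "BV_on I f \<longleftrightarrow> integrable (lebesgue_on I) f \<and>
     (\<exists>g. (AE x in lebesgue_on I. f x = g x) \<and> finite_variation_on I g)"

text \<open>The trace $f(L^-)$ of a $BV$ function at the right end point, independent of the
  representative.\<close>

definition left_limit_trace :: "(real \<Rightarrow> real) \<Rightarrow> real \<Rightarrow> real" where
  "left_limit_trace f L = Lim (at_right 0) (\<lambda>h. (\<integral>x. f x \<partial>lebesgue_on {L - h..L}) / h)"

subsection \<open>Distributions of order $H^{-1}$ on an open interval\<close>

definition test_fun :: "real set \<Rightarrow> (real \<Rightarrow> real) \<Rightarrow> bool" where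
  "test_fun I \<phi> \<longleftrightarrow> (\<forall>n t. (deriv ^^ n) \<phi> differentiable (at t)) \<and>
     compact (closure {t. \<phi> t \<noteq> 0}) \<and> closure {t. \<phi> t \<noteq> 0} \<subseteq> I"

definition H1_norm :: "real set \<Rightarrow> (real \<Rightarrow> real) \<Rightarrow> real" where
  "H1_norm I \<phi> = sqrt ((L2_norm I \<phi>)\<^sup>2 + (L2_norm I (deriv \<phi>))\<^sup>2)"

text \<open>$H^{-1}(I)$ is the dual of $H^1_0(I)$. As $C_c^\infty(I)$ is dense in $H^1_0(I)$, its elements
  are the distributions on $I$ that are bounded for the $H^1$ norm. Only the values on test
  functions matter, and restriction to a smaller open set leaves the functional itself unchanged:
  the norm of the restriction of \<open>s\<close> to \<open>J \<subseteq> I\<close> is \<open>Hm1_norm J s\<close>.\<close>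

definition Hm1 :: "real set \<Rightarrow> ((real \<Rightarrow> real) \<Rightarrow> real) \<Rightarrow> bool" where
  "Hm1 I s \<longleftrightarrow>
     (\<forall>\<phi> \<eta>. test_fun I \<phi> \<and> test_fun I \<eta> \<longrightarrow> s (\<lambda>t. \<phi> t + \<eta> t) = s \<phi> + s \<eta>) \<and>
     (\<forall>c \<phi>. test_fun I \<phi> \<longrightarrow> s (\<lambda>t. c * \<phi> t) = c * s \<phi>) \<and>
     (\<exists>K. \<forall>\<phi>. test_fun I \<phi> \<longrightarrow> \<bar>s \<phi>\<bar> \<le> K * H1_norm I \<phi>)"

definition Hm1_norm :: "real set \<Rightarrow> ((real \<Rightarrow> real) \<Rightarrow> real) \<Rightarrow> real" where
  "Hm1_norm I s = Sup {\<bar>s \<phi>\<bar> | \<phi>. test_fun I \<phi> \<and> H1_norm I \<phi> \<le> 1}"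

definition continuous_Hm1 :: "real \<Rightarrow> real set \<Rightarrow> (real \<Rightarrow> (real \<Rightarrow> real) \<Rightarrow> real) \<Rightarrow> bool" where
  "continuous_Hm1 T I p \<longleftrightarrow>
     (\<forall>t\<in>{0..T}. Hm1 I (p t)) \<and>
     (\<forall>t\<in>{0..T}. ((\<lambda>\<tau>. Hm1_norm I (\<lambda>v. p \<tau> v - p t v)) \<longlongrightarrow> 0) (at t within {0..T}))"

definition dist_supp :: "real set \<Rightarrow> ((real \<Rightarrow> real) \<Rightarrow> real) \<Rightarrow> real set" where
  "dist_supp I s = {t \<in> I. \<forall>U. open U \<and> t \<in> U \<longrightarrow> (\<exists>\<phi>. test_fun (I \<inter> U) \<phi> \<and> s \<phi> \<noteq> 0)}"

subsection \<open>Finite energy solutions\<close>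

text \<open>Functions of time and space are written \<open>u t x\<close>. Test functions for the weak formulation:
  \<open>\<phi>\<close> with \<open>\<phi>tt = \<phi>_tt\<close>, absolutely continuous flux \<open>q = a \<phi>_x\<close>, \<open>r = (a \<phi>_x)_x\<close>,
  homogeneous Neumann conditions at both ends, and \<open>\<phi> = 0\<close> for \<open>t\<close> near \<open>0\<close>. As \<open>a\<close> is only \<open>BV\<close>,
  a smooth \<open>\<phi>\<close> would not do: \<open>(a \<phi>_x)_x\<close> has to be a function in order to be paired with \<open>\<psi>\<close>.
  Nothing is imposed on \<open>\<phi>\<close> at \<open>t = T\<close>.\<close>

definition wave_test ::
  "real \<Rightarrow> real \<Rightarrow> (real \<Rightarrow> real) \<Rightarrow> (real \<Rightarrow> real \<Rightarrow> real) \<Rightarrow> (real \<Rightarrow> real \<Rightarrow> real) \<Rightarrow> (real \<Rightarrow> real \<Rightarrow> real) \<Rightarrow> bool"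
  where
  "wave_test L T a \<phi> \<phi>tt r \<longleftrightarrow>
     (\<exists>\<phi>t. \<forall>t\<in>{0..T}. \<forall>x\<in>{0..L}.
        ((\<lambda>\<tau>. \<phi> \<tau> x) has_real_derivative \<phi>t t x) (at t within {0..T}) \<and>
        ((\<lambda>\<tau>. \<phi>t \<tau> x) has_real_derivative \<phi>tt t x) (at t within {0..T})) \<and>
     continuous_on ({0..T} \<times> {0..L}) (\<lambda>(t, x). \<phi>tt t x) \<and>
     (\<exists>\<epsilon>>0. \<forall>t\<in>{0..T}. \<forall>x\<in>{0..L}. t < \<epsilon> \<longrightarrow> \<phi> t x = 0) \<and>
     continuous_L2 T {0<..<L} r \<and>
     (\<exists>q. \<forall>t\<in>{0..T}.
        (\<forall>x\<in>{0..L}. q t x = (\<integral>y. r t y \<partial>lebesgue_on {0..x})) \<and>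
        (\<forall>x\<in>{0..L}. \<phi> t x = \<phi> t 0 + (\<integral>y. q t y / a y \<partial>lebesgue_on {0..x})) \<and>
        q t L = 0)"

text \<open>Integrating $\rho\psi_{tt}-(a\psi_x)_x=0$ against \<open>\<phi>\<close> by parts, with zero data for \<open>\<psi>\<close> at
  \<open>t = T\<close>, $\psi_x(0,t)=0$ and $\psi_x(L,t)=s(t)$, gives
  $$\int_0^T\!\int_0^L \psi\,(\rho\varphi_{tt}-(a\varphi_x)_x)\,dx\,dt
     = a(L^-)\,\langle s,\varphi(L,\cdot)\rangle .$$
  Since \<open>\<phi>(L,\<cdot>)\<close> need not vanish near \<open>T\<close>, the pairing is the usual extension of a distribution:
  it equals $\langle s,\eta\rangle$ for any test function \<open>\<eta>\<close> on \<open>(0,T)\<close> that coincides with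
  \<open>\<phi>(L,\<cdot>)\<close> on a neighbourhood of the support of \<open>s\<close>. If that support is compact in \<open>(0,T)\<close>, every
  \<open>\<phi>\<close> is admissible.\<close>

definition weak_wave_identity ::
  "real \<Rightarrow> real \<Rightarrow> (real \<Rightarrow> real) \<Rightarrow> (real \<Rightarrow> real) \<Rightarrow> ((real \<Rightarrow> real) \<Rightarrow> real) \<Rightarrow> (real \<Rightarrow> real \<Rightarrow> real) \<Rightarrow> bool"
  where
  "weak_wave_identity L T \<rho> a s \<psi> \<longleftrightarrow>
     (\<forall>\<phi> \<phi>tt r \<eta> U.
        wave_test L T a \<phi> \<phi>tt r \<and> test_fun {0<..<T} \<eta> \<and>
        open U \<and> dist_supp {0<..<T} s \<subseteq> U \<and> (\<forall>t\<in>U \<inter> {0<..<T}. \<eta> t = \<phi> t L) \<longrightarrow>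
        (\<integral>t. (\<integral>x. \<psi> t x * (\<rho> x * \<phi>tt t x - r t x) \<partial>lebesgue_on {0<..<L}) \<partial>lebesgue_on {0<..<T})
          = left_limit_trace a L * s \<eta>)"

text \<open>The velocity is measured in $H^{-1}(0,L)$ through the momentum \<open>p = \<rho> \<psi>_t\<close>, the quantity that
  occurs in the equation: multiplication by a discontinuous \<open>\<rho>\<close> does not act on $H^{-1}$.\<close>

definition momentum ::
  "real \<Rightarrow> real \<Rightarrow> (real \<Rightarrow> real) \<Rightarrow> (real \<Rightarrow> real \<Rightarrow> real) \<Rightarrow> (real \<Rightarrow> (real \<Rightarrow> real) \<Rightarrow> real) \<Rightarrow> bool"
  where
  "momentum L T \<rho> \<psi> p \<longleftrightarrow>
     (\<forall>v. test_fun {0<..<L} v \<longrightarrow>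
        (\<forall>t\<in>{0..T}. ((\<lambda>\<tau>. \<integral>x. \<rho> x * \<psi> \<tau> x * v x \<partial>lebesgue_on {0<..<L})
            has_real_derivative p t v) (at t within {0..T})))"

definition trace_at_0 :: "real \<Rightarrow> (real \<Rightarrow> real \<Rightarrow> real) \<Rightarrow> (real \<Rightarrow> real) \<Rightarrow> bool" where
  "trace_at_0 T \<psi> g \<longleftrightarrow> L2_on {0<..<T} g \<and>
     ((\<lambda>h. L2_norm {0<..<T} (\<lambda>t. (\<integral>x. \<psi> t x \<partial>lebesgue_on {0<..<h}) / h - g t)) \<longlongrightarrow> 0) (at_right 0)"

text \<open>\<open>\<psi>\<close> is the finite energy solution with Neumann datum \<open>s\<close>, and \<open>g\<close> is its trace
  $\psi(0,\cdot)$.\<close>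

definition finite_energy_solution ::
  "real \<Rightarrow> real \<Rightarrow> (real \<Rightarrow> real) \<Rightarrow> (real \<Rightarrow> real) \<Rightarrow> ((real \<Rightarrow> real) \<Rightarrow> real) \<Rightarrow>
    (real \<Rightarrow> real \<Rightarrow> real) \<Rightarrow> (real \<Rightarrow> real) \<Rightarrow> bool"
  where
  "finite_energy_solution L T \<rho> a s \<psi> g \<longleftrightarrow>
     continuous_L2 T {0<..<L} \<psi> \<and>
     (\<exists>p. momentum L T \<rho> \<psi> p \<and> continuous_Hm1 T {0<..<L} p \<and>
          (\<forall>v. test_fun {0<..<L} v \<longrightarrow> p T v = 0)) \<and>
     (AE x in lebesgue_on {0<..<L}. \<psi> T x = 0) \<and>
     weak_wave_identity L T \<rho> a s \<psi> \<and>
     trace_at_0 T \<psi> g"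

end

theory Submission
  imports Defs
begin

text \<open>The proof is by duality, with the roles of \<open>x\<close> and \<open>t\<close> exchanged. For a test function \<open>\<eta>\<close> on
  \<open>(L\<beta>, T)\<close> one solves the wave equation in the direction of decreasing \<open>x\<close>, as the system
  $\varphi_x = w_t / a$, $w_x = \rho \varphi_t$ with Cauchy data \<open>\<phi> = \<eta>\<close>, \<open>w = 0\<close> at \<open>x = L\<close>, so that \<open>w\<^sub>t\<close>
  is the flux $a \varphi_x$. Signals travel with slowness at most \<open>\<beta>\<close>, so \<open>\<phi>\<close> vanishes for \<open>t\<close> near \<open>0\<close>;
  and since \<open>\<rho>\<close> and \<open>a\<close> are \<open>BV\<close>, the energy $\int (Z \varphi_t^2 + w_t^2 / Z)\,dt$ with impedance
  $Z = \sqrt{\rho a}$ stays bounded, which controls the flux at \<open>x = 0\<close> by the norm of \<open>\<eta>'\<close>. Testing the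
  equation for \<open>\<psi>\<close> with \<open>\<phi>\<close> then gives
  $a(L^-) \langle s, \eta\rangle = - \int \psi(0,t)\, (a \varphi_x)(0,t)\,dt$.

  No solution with \<open>BV\<close> coefficients is constructed. It is enough to have approximate solutions with the
  same uniform flux bound and an \<open>L\<^sup>2\<close> residual that tends to \<open>0\<close>. They are the exact d'Alembert solutions for
  coefficients sampled on \<open>N + 1\<close> layers of width \<open>h\<close>. In the layer next to \<open>x = 0\<close> the flux is
  interpolated linearly to \<open>0\<close>, as the Neumann condition demands; there its derivative is \<open>1 / h\<close> times the
  flux, which turns the integral of \<open>\<psi>\<close> over the layer into the average that defines the trace.\<close>

subsection \<open>Square integrable functions on an interval\<close>

text \<open>Two kinds of estimates are kept apart. The datum \<eta> is fixed while the layer width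
  tends to 0, so the residual may be bounded crudely, by sup norms of derivatives of \<eta>; it
  contributes nothing in the limit. Only the energy enters the final constant. No convergence of the
  fluxes is used: the layer averages of \<psi> converge strongly to the trace, so a uniform norm
  bound on the fluxes and Cauchy-Schwarz suffice. The obstacle is that bounded variation gives no
  uniform closeness of a coefficient to its samples. Closeness holds on average: the oscillation of
  a bounded monotone function over windows of width \<open>2 h\<close> has an integral of order
  \<open>h\<close>, and this makes the residual of order \<open>sqrt h\<close> in
  \<open>L\<^sup>2\<close>. Sampling only at points where the bound \<beta> holds pointwise
  preserves the exact propagation speed; the compact support of \<eta> in an open interval then
  leaves a positive gap at \<open>t = 0\<close>.\<close>

lemma L2_norm_nonneg [simp]: "0 \<le> L2_norm I f"
  unfolding L2_norm_def by simp

lemma L2_norm_squared: "(L2_norm I f)\<^sup>2 = (\<integral>x. (f x)\<^sup>2 \<partial>lebesgue_on I)"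
  unfolding L2_norm_def by simp

lemma L2_on_mult_integrable:
  assumes "L2_on I f" "L2_on I g"
  shows "integrable (lebesgue_on I) (\<lambda>x. f x * g x)"
proof (rule Bochner_Integration.integrable_bound[where f="\<lambda>x. (f x)\<^sup>2 + (g x)\<^sup>2"])
  show "AE x in lebesgue_on I. norm (f x * g x) \<le> norm ((f x)\<^sup>2 + (g x)\<^sup>2)"
  proof (intro AE_I2)
    fix x
    have "2 * \<bar>f x * g x\<bar> \<le> (f x)\<^sup>2 + (g x)\<^sup>2"
      using sum_squares_bound[of "\<bar>f x\<bar>" "\<bar>g x\<bar>"] by (simp add: abs_mult)
    then show "norm (f x * g x) \<le> norm ((f x)\<^sup>2 + (g x)\<^sup>2)" by simp
  qed
qed (use assms in \<open>auto simp: L2_on_def\<close>)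

lemma L2_on_cmult: "L2_on I f \<Longrightarrow> L2_on I (\<lambda>x. c * f x)"
  unfolding L2_on_def by (auto simp: power_mult_distrib)

lemma L2_on_add:
  assumes "L2_on I f" "L2_on I g"
  shows "L2_on I (\<lambda>x. f x + g x)"
  using assms L2_on_mult_integrable[OF assms]
  unfolding L2_on_def by (auto simp: power2_sum mult.assoc)

lemma L2_on_diff:
  assumes "L2_on I f" "L2_on I g"
  shows "L2_on I (\<lambda>x. f x - g x)"
  using L2_on_add[OF assms(1) L2_on_cmult[OF assms(2), of "-1"]] by simp

text \<open>The inequality \<open>2 c d \<bar>f g\<bar> \<le> c\<^sup>2 f\<^sup>2 + d\<^sup>2
  g\<^sup>2\<close> is integrated for arbitrary weights; taking each weight to be the norm of the
  other function gives the claim after division.\<close>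

lemma L2_Cauchy_Schwarz:
  assumes f: "L2_on I f" and g: "L2_on I g"
  shows "(\<integral>x. \<bar>f x * g x\<bar> \<partial>lebesgue_on I) \<le> L2_norm I f * L2_norm I g"
proof -
  let ?A = "L2_norm I f" and ?B = "L2_norm I g" and ?P = "\<integral>x. \<bar>f x * g x\<bar> \<partial>lebesgue_on I"
  have fg: "integrable (lebesgue_on I) (\<lambda>x. \<bar>f x * g x\<bar>)"
    using L2_on_mult_integrable[OF f g] by simp
  have int: "integrable (lebesgue_on I) (\<lambda>x. (f x)\<^sup>2)" "integrable (lebesgue_on I) (\<lambda>x. (g x)\<^sup>2)"
    using f g unfolding L2_on_def by auto
  have quad: "2 * c * d * ?P \<le> c\<^sup>2 * ?A\<^sup>2 + d\<^sup>2 * ?B\<^sup>2" if "0 \<le> c" "0 \<le> d" for c d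
  proof -
    have "2 * c * d * ?P = (\<integral>x. 2 * c * d * \<bar>f x * g x\<bar> \<partial>lebesgue_on I)" by simp
    also have "\<dots> \<le> (\<integral>x. c\<^sup>2 * (f x)\<^sup>2 + d\<^sup>2 * (g x)\<^sup>2 \<partial>lebesgue_on I)"
    proof (rule integral_mono)
      show "2 * c * d * \<bar>f x * g x\<bar> \<le> c\<^sup>2 * (f x)\<^sup>2 + d\<^sup>2 * (g x)\<^sup>2" for x
        using sum_squares_bound[of "c * \<bar>f x\<bar>" "d * \<bar>g x\<bar>"]
        by (simp add: power_mult_distrib abs_mult mult_ac)
    qed (use int fg in auto)
    also have "\<dots> = c\<^sup>2 * ?A\<^sup>2 + d\<^sup>2 * ?B\<^sup>2" using int by (simp add: L2_norm_squared)
    finally show ?thesis .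
  qed
  show ?thesis
  proof (cases "?A = 0 \<or> ?B = 0")
    case False
    then have pos: "?A > 0" "?B > 0" using L2_norm_nonneg less_eq_real_def by metis+
    have "2 * ?B * ?A * ?P \<le> 2 * (?B * ?A) * (?A * ?B)"
      using quad[of ?B ?A] by (simp add: power2_eq_square mult_ac)
    then show ?thesis using pos by (simp add: mult_ac)
  next
    case True
    have nn: "?P \<ge> 0" by simp
    have "?P \<le> 0"
    proof (rule ccontr)
      assume "\<not> ?P \<le> 0"
      then have P: "?P > 0" by simp
      from True show False
      proof
        assume A: "?A = 0"
        \<comment> \<open>If one norm vanishes, its weight is free. This choice turns
          \<open>quad\<close> into \<open>?B\<^sup>2 + 1 \<le> ?B\<^sup>2\<close>; the other case is
          symmetric.\<close>
        show False using quad[of "(?B\<^sup>2 + 1) / (2 * ?P)" 1] P by (simp add: A)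
      next
        assume B: "?B = 0"
        show False using quad[of 1 "(?A\<^sup>2 + 1) / (2 * ?P)"] P by (simp add: B)
      qed
    qed
    then show ?thesis by (simp add: order_trans)
  qed
qed

lemma L2_pairing_le:
  assumes "L2_on I f" "L2_on I g"
  shows "\<bar>\<integral>x. f x * g x \<partial>lebesgue_on I\<bar> \<le> L2_norm I f * L2_norm I g"
  using integral_abs_bound[of "lebesgue_on I" "\<lambda>x. f x * g x"] L2_Cauchy_Schwarz[OF assms]
  by linarith

lemma L2_norm_triangle:
  assumes f: "L2_on I f" and g: "L2_on I g"
  shows "L2_norm I (\<lambda>x. f x + g x) \<le> L2_norm I f + L2_norm I g"
proof (rule power2_le_imp_le)
  have int: "integrable (lebesgue_on I) (\<lambda>x. (f x)\<^sup>2)" "integrable (lebesgue_on I) (\<lambda>x. (g x)\<^sup>2)"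
    using f g unfolding L2_on_def by auto
  have "(L2_norm I (\<lambda>x. f x + g x))\<^sup>2 = (\<integral>x. (f x)\<^sup>2 + (g x)\<^sup>2 + 2 * (f x * g x) \<partial>lebesgue_on I)"
    by (simp add: L2_norm_squared power2_sum mult.assoc)
  also have "\<dots> = (L2_norm I f)\<^sup>2 + (L2_norm I g)\<^sup>2 + 2 * (\<integral>x. f x * g x \<partial>lebesgue_on I)"
    using int L2_on_mult_integrable[OF f g] by (simp add: L2_norm_squared)
  also have "\<dots> \<le> (L2_norm I f + L2_norm I g)\<^sup>2"
    using L2_pairing_le[OF f g] by (simp add: power2_sum)
  finally show "(L2_norm I (\<lambda>x. f x + g x))\<^sup>2 \<le> (L2_norm I f + L2_norm I g)\<^sup>2" .
qed simp

lemma L2_norm_le_diff: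
  assumes "L2_on I f" "L2_on I g"
  shows "L2_norm I f \<le> L2_norm I (\<lambda>x. f x - g x) + L2_norm I g"
  using L2_norm_triangle[OF L2_on_diff[OF assms] assms(2)] by simp

text \<open>By the reverse triangle inequality the norm is continuous in time, and the time interval
  is compact.\<close>

lemma continuous_L2_bounded:
  assumes "continuous_L2 T I u"
  obtains M where "M \<ge> 0" "\<And>t. t \<in> {0..T} \<Longrightarrow> L2_norm I (u t) \<le> M"
proof -
  have "continuous_on {0..T} (\<lambda>t. L2_norm I (u t))"
    unfolding continuous_on_def
  proof
    fix t assume t: "t \<in> {0..T}"
    have "((\<lambda>\<tau>. L2_norm I (u \<tau>) - L2_norm I (u t)) \<longlongrightarrow> 0) (at t within {0..T})"
    proof (rule Lim_null_comparison)
      show "((\<lambda>\<tau>. L2_norm I (\<lambda>x. u \<tau> x - u t x)) \<longlongrightarrow> 0) (at t within {0..T})"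
        using assms t unfolding continuous_L2_def by blast
      have "norm (L2_norm I (u \<tau>) - L2_norm I (u t)) \<le> L2_norm I (\<lambda>x. u \<tau> x - u t x)"
        if "\<tau> \<in> {0..T}" for \<tau>
      proof -
        have *: "L2_on I (u \<tau>)" "L2_on I (u t)" using assms that t unfolding continuous_L2_def by auto
        have "L2_norm I (\<lambda>x. u t x - u \<tau> x) = L2_norm I (\<lambda>x. u \<tau> x - u t x)"
          unfolding L2_norm_def by (simp add: power2_commute)
        then show ?thesis using L2_norm_le_diff[OF *] L2_norm_le_diff[OF *(2,1)] by simp
      qed
      then show "\<forall>\<^sub>F \<tau> in at t within {0..T}. norm (L2_norm I (u \<tau>) - L2_norm I (u t))
          \<le> L2_norm I (\<lambda>x. u \<tau> x - u t x)"
        by (auto simp: eventually_at_filter)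
    qed
    then show "((\<lambda>\<tau>. L2_norm I (u \<tau>)) \<longlongrightarrow> L2_norm I (u t)) (at t within {0..T})"
      using Lim_null by blast
  qed
  then have "bounded ((\<lambda>t. L2_norm I (u t)) ` {0..T})"
    by (intro compact_imp_bounded compact_continuous_image) auto
  then obtain M where "M > 0" "\<And>t. t \<in> {0..T} \<Longrightarrow> \<bar>L2_norm I (u t)\<bar> \<le> M"
    unfolding bounded_pos by auto
  then show thesis using that[of M] by auto
qed

text \<open>Needed with \<open>f\<close> the indicator of the layer at \<open>x = 0\<close>: the
  layer averages of \<psi> are then continuous in time, hence measurable and square
  integrable.\<close>

lemma continuous_L2_pairing:
  assumes u: "continuous_L2 T I u" and f: "L2_on I f"
  shows "continuous_on {0..T} (\<lambda>t. \<integral>x. u t x * f x \<partial>lebesgue_on I)"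
  unfolding continuous_on_def
proof
  fix t assume t: "t \<in> {0..T}"
  have "((\<lambda>\<tau>. (\<integral>x. u \<tau> x * f x \<partial>lebesgue_on I) - (\<integral>x. u t x * f x \<partial>lebesgue_on I)) \<longlongrightarrow> 0)
      (at t within {0..T})"
  proof (rule Lim_null_comparison)
    have "((\<lambda>\<tau>. L2_norm I (\<lambda>x. u \<tau> x - u t x)) \<longlongrightarrow> 0) (at t within {0..T})"
      using u t unfolding continuous_L2_def by blast
    then show "((\<lambda>\<tau>. L2_norm I (\<lambda>x. u \<tau> x - u t x) * L2_norm I f) \<longlongrightarrow> 0) (at t within {0..T})"
      by (rule tendsto_mult_left_zero)
    have "norm ((\<integral>x. u \<tau> x * f x \<partial>lebesgue_on I) - (\<integral>x. u t x * f x \<partial>lebesgue_on I))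
        \<le> L2_norm I (\<lambda>x. u \<tau> x - u t x) * L2_norm I f" if "\<tau> \<in> {0..T}" for \<tau>
    proof -
      have *: "L2_on I (u \<tau>)" "L2_on I (u t)" using u that t unfolding continuous_L2_def by auto
      have "(\<integral>x. u \<tau> x * f x \<partial>lebesgue_on I) - (\<integral>x. u t x * f x \<partial>lebesgue_on I)
          = (\<integral>x. (u \<tau> x - u t x) * f x \<partial>lebesgue_on I)"
        using L2_on_mult_integrable[OF *(1) f] L2_on_mult_integrable[OF *(2) f]
        by (simp add: left_diff_distrib)
      then show ?thesis using L2_pairing_le[OF L2_on_diff[OF *] f] by simp
    qed
    then show "\<forall>\<^sub>F \<tau> in at t within {0..T}. norm ((\<integral>x. u \<tau> x * f x \<partial>lebesgue_on I)
        - (\<integral>x. u t x * f x \<partial>lebesgue_on I)) \<le> L2_norm I (\<lambda>x. u \<tau> x - u t x) * L2_norm I f"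
      by (auto simp: eventually_at_filter)
  qed
  then show "((\<lambda>\<tau>. \<integral>x. u \<tau> x * f x \<partial>lebesgue_on I) \<longlongrightarrow> (\<integral>x. u t x * f x \<partial>lebesgue_on I))
      (at t within {0..T})"
    using Lim_null by blast
qed

subsection \<open>Functions of bounded variation\<close>

text \<open>The function \<open>v\<close> is the variation of \<open>f\<close> up to
  \<open>x\<close>, the supremum of the variation sums over chains of points of \<open>I\<close>
  that do not exceed \<open>x\<close>.\<close>

lemma finite_variation_on_dominated:
  fixes f :: "real \<Rightarrow> real"
  assumes "finite_variation_on I f"
  obtains v M where "\<And>x. x \<in> I \<Longrightarrow> 0 \<le> v x \<and> v x \<le> M"
    and "\<And>x y. x \<in> I \<Longrightarrow> y \<in> I \<Longrightarrow> x \<le> y \<Longrightarrow> \<bar>f y - f x\<bar> \<le> v y - v x"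
proof -
  obtain M where M: "\<And>n (c :: nat \<Rightarrow> real). (\<forall>i\<le>n. c i \<in> I) \<Longrightarrow> (\<forall>i<n. c i \<le> c (Suc i)) \<Longrightarrow>
      (\<Sum>i<n. \<bar>f (c (Suc i)) - f (c i)\<bar>) \<le> M"
    using assms unfolding finite_variation_on_def by blast
  define chain where "chain x n c \<longleftrightarrow> (\<forall>i\<le>n. c i \<in> I \<and> c i \<le> x) \<and> (\<forall>i<n. c i \<le> c (Suc i))"
    for x n and c :: "nat \<Rightarrow> real"
  define S where "S x = {\<Sum>i<n. \<bar>f (c (Suc i)) - f (c i)\<bar> | n c. chain x n c}" for x
  define v where "v x = Sup (S x)" for x
  have S_le: "s \<le> M" if "s \<in> S x" for s x
    using that M unfolding S_def chain_def by blast
  have bdd: "bdd_above (S x)" for x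
    using S_le by (meson bdd_aboveI)
  have zero: "0 \<in> S x" if "x \<in> I" for x
    unfolding S_def chain_def using that by (intro CollectI exI[of _ 0] exI[of _ "\<lambda>_. x"]) auto
  have "0 \<le> v x \<and> v x \<le> M" if "x \<in> I" for x
    unfolding v_def using cSup_upper[OF zero[OF that] bdd] zero[OF that] S_le
    by (auto intro!: cSup_least)
  moreover have "\<bar>f y - f x\<bar> \<le> v y - v x" if x: "x \<in> I" and y: "y \<in> I" and xy: "x \<le> y" for x y
  proof -
    have "s \<le> v y - \<bar>f y - f x\<bar>" if s: "s \<in> S x" for s
    proof -
      obtain n c where c: "chain x n c" and s_eq: "s = (\<Sum>i<n. \<bar>f (c (Suc i)) - f (c i)\<bar>)"
        using s unfolding S_def by blast
      \<comment> \<open>A chain below \<open>x\<close> is prolonged by \<open>x\<close> and then by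
        \<open>y\<close>: the last increment is the one wanted, and the increment leading to
        \<open>x\<close> is nonnegative and is dropped.\<close>
      define d where "d i = (if i \<le> n then c i else if i = Suc n then x else y)" for i
      have "chain y (Suc (Suc n)) d"
        unfolding chain_def
      proof (intro conjI allI impI)
        fix i assume "i < Suc (Suc n)"
        then consider "i < n" | "i = n" | "i = Suc n" by linarith
        then show "d i \<le> d (Suc i)"
          by cases (use c xy in \<open>auto simp: d_def chain_def\<close>)
      next
        fix i
        show "d i \<in> I" using c x y by (simp add: d_def chain_def)
        have "c i \<le> y" if "i \<le> n" using c that xy unfolding chain_def by (meson order_trans)
        then show "d i \<le> y" using xy by (simp add: d_def)
      qed
      then have mem: "(\<Sum>i<Suc (Suc n). \<bar>f (d (Suc i)) - f (d i)\<bar>) \<in> S y"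
        unfolding S_def by blast
      have "s + \<bar>f y - f x\<bar> \<le> (\<Sum>i<Suc (Suc n). \<bar>f (d (Suc i)) - f (d i)\<bar>)"
        by (simp add: d_def s_eq)
      also have "\<dots> \<le> v y"
        unfolding v_def by (rule cSup_upper[OF mem bdd])
      finally show ?thesis by simp
    qed
    then have "v x \<le> v y - \<bar>f y - f x\<bar>"
      unfolding v_def[of x] using zero[OF x] by (intro cSup_least) auto
    then show ?thesis by simp
  qed
  ultimately show thesis using that by blast
qed

lemma mono_bounded_left_limit:
  fixes v :: "real \<Rightarrow> real"
  assumes "L > 0"
    and mono: "\<And>x y. 0 < x \<Longrightarrow> x \<le> y \<Longrightarrow> y < L \<Longrightarrow> v x \<le> v y"
    and bd: "\<And>x. 0 < x \<Longrightarrow> x < L \<Longrightarrow> v x \<le> M"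
  shows "(v \<longlongrightarrow> Sup (v ` {0<..<L})) (at_left L)"
proof (rule order_tendstoI)
  have bdd: "bdd_above (v ` {0<..<L})" using bd by (auto intro!: bdd_aboveI)
  have near: "\<forall>\<^sub>F x in at_left L. c < x \<and> x < L" if "c < L" for c
    using that by (auto intro: eventually_at_leftI[of c])
  fix y
  { assume "y < Sup (v ` {0<..<L})"
    then obtain c where c: "0 < c" "c < L" "y < v c"
      using less_cSup_iff[OF _ bdd] assms(1) by auto
    show "\<forall>\<^sub>F x in at_left L. y < v x"
      using near[OF c(2)] by eventually_elim (use c mono in \<open>meson less_imp_le less_le_trans\<close>) }
  { assume "Sup (v ` {0<..<L}) < y"
    show "\<forall>\<^sub>F x in at_left L. v x < y"
      using near[OF assms(1)]
    proof eventually_elim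
      case (elim x)
      then have "v x \<le> Sup (v ` {0<..<L})" using bdd by (intro cSup_upper) auto
      then show ?case using \<open>Sup (v ` {0<..<L}) < y\<close> by simp
    qed }
qed

section \<open>Almost everywhere statements on open and closed intervals\<close>

lemma lmeasurable_Ioo_sets: "{a<..<b::real} \<in> sets lebesgue" and lmeasurable_Icc_sets: "{a..b::real} \<in> sets lebesgue"
  by auto

lemma AE_lebesgue_on_iff:
  "S \<in> sets lebesgue \<Longrightarrow> (AE x in lebesgue_on S. P x) \<longleftrightarrow> (AE x in lebesgue. x \<in> S \<longrightarrow> P x)"
  by (simp add: AE_restrict_space_iff)

lemma AE_lebesgue_on_Ioo_Icc:
  fixes a b :: real
  shows "(AE x in lebesgue_on {a<..<b}. P x) \<longleftrightarrow> (AE x in lebesgue_on {a..b}. P x)"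
proof -
  have "AE x in lebesgue. x \<noteq> c" for c :: real
    using AE_lborel_singleton[of c] by (rule AE_completion)
  from this[of a] this[of b]
  have "AE x in lebesgue. (x \<in> {a<..<b} \<longrightarrow> P x) = (x \<in> {a..b} \<longrightarrow> P x)"
    by eventually_elim auto
  then have "(AE x in lebesgue. x \<in> {a<..<b} \<longrightarrow> P x) = (AE x in lebesgue. x \<in> {a..b} \<longrightarrow> P x)"
    by (rule eventually_subst)
  then show ?thesis by (simp add: AE_restrict_space_iff)
qed

lemma AE_lebesgue_on_subset:
  assumes "AE x in lebesgue_on A. P x" "B \<subseteq> A" "A \<in> sets lebesgue" "B \<in> sets lebesgue"
  shows "AE x in lebesgue_on B. P x"
proof -
  have "AE x in lebesgue. x \<in> A \<longrightarrow> P x"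
    using assms(1,3) by (simp add: AE_restrict_space_iff)
  then have "AE x in lebesgue. x \<in> B \<longrightarrow> P x"
    by eventually_elim (use assms(2) in auto)
  then show ?thesis using assms(4) by (simp add: AE_restrict_space_iff)
qed

lemma borel_measurable_lebesgue_on_Icc:
  fixes f :: "real \<Rightarrow> real"
  assumes "f \<in> borel_measurable (lebesgue_on {a<..<b})"
  shows "f \<in> borel_measurable (lebesgue_on {a..b})"
proof -
  have *: "(\<lambda>x. if x \<in> {a<..<b} then f x else 0) \<in> borel_measurable lebesgue"
    using assms by (simp only: borel_measurable_if lmeasurable_Ioo_sets)
  have "AE x in lebesgue_on {a..b}. x \<in> {a<..<b}"
    unfolding AE_lebesgue_on_Ioo_Icc[symmetric] by (intro AE_I2) (simp add: space_restrict_space)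
  then have "AE x in lebesgue. x \<in> {a..b} \<longrightarrow> x \<in> {a<..<b}"
    by (simp only: AE_lebesgue_on_iff lmeasurable_Icc_sets)
  then have "AE x in lebesgue. (if x \<in> {a<..<b} then f x else 0) = (if x \<in> {a..b} then f x else 0)"
    by eventually_elim auto
  then have "(\<lambda>x. if x \<in> {a..b} then f x else 0) \<in> borel_measurable lebesgue"
    using * by (rule borel_measurable_AE[rotated])
  then show ?thesis by (simp only: borel_measurable_if lmeasurable_Icc_sets)
qed

lemma integrable_lebesgue_on_bounded:
  fixes f :: "real \<Rightarrow> real"
  assumes "f \<in> borel_measurable (lebesgue_on {a..b})" "AE x in lebesgue_on {a..b}. \<bar>f x\<bar> \<le> K"
  shows "integrable (lebesgue_on {a..b}) f"
proof -
  interpret finite_measure "lebesgue_on {a..b}" by (rule finite_measure_lebesgue_on) auto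
  show ?thesis using assms by (intro integrable_const_bound[where B=K]) auto
qed

text \<open>The trace is a \<open>Lim\<close>, which says nothing until a limit is known to exist. A
  representative of finite variation has a left limit at \<open>L\<close>, and the averages of
  \<open>a\<close> over shrinking windows converge to it; each average is at least
  \<open>a0\<close>.\<close>

lemma left_limit_trace_ge:
  assumes "L > 0" "BV_on {0<..<L} a" "AE x in lebesgue_on {0<..<L}. a0 \<le> a x \<and> a x \<le> a1"
  shows "a0 \<le> left_limit_trace a L"
proof -
  obtain f where f: "AE x in lebesgue_on {0<..<L}. a x = f x" "finite_variation_on {0<..<L} f"
    using assms(2) unfolding BV_on_def by blast
  obtain v M where v: "\<And>x. x \<in> {0<..<L} \<Longrightarrow> 0 \<le> v x \<and> v x \<le> M"
    and fv: "\<And>x y. x \<in> {0<..<L} \<Longrightarrow> y \<in> {0<..<L} \<Longrightarrow> x \<le> y \<Longrightarrow> \<bar>f y - f x\<bar> \<le> v y - v x"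
    using finite_variation_on_dominated[OF f(2)] by blast
  have l1: "(v \<longlongrightarrow> Sup (v ` {0<..<L})) (at_left L)"
  proof (rule mono_bounded_left_limit[OF \<open>L > 0\<close>, where M=M])
    show "v x \<le> v y" if "0 < x" "x \<le> y" "y < L" for x y
      using fv[of x y] that by auto
    show "v x \<le> M" if "0 < x" "x < L" for x
      using v[of x] that by auto
  qed
  \<comment> \<open>Jordan decomposition: \<open>v\<close> and \<open>v - f\<close> both increase,
    so \<open>f\<close>, their difference, has a left limit. Comparison with the midpoint
    \<open>L/2\<close> gives \<open>- f x \<le> M + \<bar>f (L/2)\<bar>\<close>, whence the
    bound.\<close>
  have l2: "((\<lambda>x. v x - f x) \<longlongrightarrow> Sup ((\<lambda>x. v x - f x) ` {0<..<L})) (at_left L)"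
  proof (rule mono_bounded_left_limit[OF \<open>L > 0\<close>, where M="M + (M + \<bar>f (L/2)\<bar>)"])
    show "v x - f x \<le> v y - f y" if "0 < x" "x \<le> y" "y < L" for x y
      using fv[of x y] that by auto
    show "v x - f x \<le> M + (M + \<bar>f (L/2)\<bar>)" if "0 < x" "x < L" for x
      using fv[of x "L/2"] fv[of "L/2" x] v[of x] v[of "L/2"] that \<open>L > 0\<close>
      by (cases "x \<le> L/2") auto
  qed
  from tendsto_diff[OF l1 l2] obtain l where l: "(f \<longlongrightarrow> l) (at_left L)" by auto
  have meas: "a \<in> borel_measurable (lebesgue_on {0..L})"
    using assms(2) unfolding BV_on_def
    by (intro borel_measurable_lebesgue_on_Icc) auto
  have AE: "AE x in lebesgue_on {L - h..L}. a x = f x \<and> a0 \<le> a x \<and> a x \<le> a1"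
    if "0 < h" "h < L" for h
  proof -
    have "AE x in lebesgue_on {0..L}. a x = f x \<and> a0 \<le> a x \<and> a x \<le> a1"
      using f(1) assms(3) unfolding AE_lebesgue_on_Ioo_Icc by eventually_elim auto
    then show ?thesis by (rule AE_lebesgue_on_subset) (use that in auto)
  qed
  have int: "integrable (lebesgue_on {L - h..L}) a" if "0 < h" "h < L" for h
  proof (rule integrable_lebesgue_on_bounded)
    show "a \<in> borel_measurable (lebesgue_on {L - h..L})"
      using meas by (rule measurable_restrict_mono) (use that in auto)
    show "AE x in lebesgue_on {L - h..L}. \<bar>a x\<bar> \<le> \<bar>a0\<bar> + \<bar>a1\<bar>"
      using AE[OF that] by eventually_elim auto
  qed
  have avg: "c \<le> (\<integral>x. a x \<partial>lebesgue_on {L - h..L}) / h \<and> (\<integral>x. a x \<partial>lebesgue_on {L - h..L}) / h \<le> d"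
    if h: "0 < h" "h < L" and cd: "AE x in lebesgue_on {L - h..L}. c \<le> a x \<and> a x \<le> d" for h c d
  proof -
    interpret finite_measure "lebesgue_on {L - h..L}" by (rule finite_measure_lebesgue_on) auto
    have m: "measure (lebesgue_on {L - h..L}) (space (lebesgue_on {L - h..L})) = h"
      using h by (simp add: measure_restrict_space)
    have "(\<integral>x. c \<partial>lebesgue_on {L - h..L}) \<le> (\<integral>x. a x \<partial>lebesgue_on {L - h..L})"
      using cd h by (intro integral_mono_AE int) (auto elim: eventually_mono)
    moreover have "(\<integral>x. a x \<partial>lebesgue_on {L - h..L}) \<le> (\<integral>x. d \<partial>lebesgue_on {L - h..L})"
      using cd h by (intro integral_mono_AE int) (auto elim: eventually_mono)
    ultimately show ?thesis using h m by (simp add: field_simps)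
  qed
  have "((\<lambda>h. (\<integral>x. a x \<partial>lebesgue_on {L - h..L}) / h) \<longlongrightarrow> l) (at_right 0)"
  proof (rule tendstoI)
    fix e :: real assume e: "e > 0"
    then have "\<forall>\<^sub>F x in at_left L. dist (f x) l < e/2"
      by (intro tendstoD[OF l]) simp
    then obtain b where b: "b < L" "\<And>x. b < x \<Longrightarrow> x < L \<Longrightarrow> dist (f x) l < e/2"
      unfolding eventually_at_left_field by auto
    have "\<forall>\<^sub>F h in at_right 0. 0 < h \<and> h < min L (L - b)"
      using b(1) \<open>L > 0\<close> by (intro eventually_at_rightI[of _ "min L (L - b)"]) auto
    then show "\<forall>\<^sub>F h in at_right 0. dist ((\<integral>x. a x \<partial>lebesgue_on {L - h..L}) / h) l < e"
    proof eventually_elim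
      case (elim h)
      have "AE x in lebesgue_on {L - h<..<L}. dist (f x) l < e/2"
        using b(2) elim by (intro AE_I2) (auto simp: space_restrict_space)
      then have "AE x in lebesgue_on {L - h..L}. dist (f x) l < e/2"
        by (simp only: AE_lebesgue_on_Ioo_Icc)
      moreover have "AE x in lebesgue_on {L - h..L}. a x = f x \<and> a0 \<le> a x \<and> a x \<le> a1"
        using AE elim by simp
      ultimately have "AE x in lebesgue_on {L - h..L}. l - e/2 \<le> a x \<and> a x \<le> l + e/2"
      proof eventually_elim
        case (elim x)
        from elim(1) have "\<bar>f x - l\<bar> < e/2" by (simp only: dist_real_def)
        then have "f x - l < e/2" "- (f x - l) < e/2" by (simp_all only: abs_less_iff)
        then show ?case using elim(2) by auto
      qed
      from avg[OF _ _ this] elim e show ?case by (auto simp: dist_real_def)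
    qed
  qed
  moreover from this have "left_limit_trace a L = l"
    unfolding left_limit_trace_def by (rule tendsto_Lim[rotated]) simp
  ultimately have lim: "((\<lambda>h. (\<integral>x. a x \<partial>lebesgue_on {L - h..L}) / h) \<longlongrightarrow> left_limit_trace a L) (at_right 0)"
    by simp
  have "\<forall>\<^sub>F h in at_right 0. 0 < h \<and> h < L"
    using \<open>L > 0\<close> by (intro eventually_at_rightI[of _ L]) auto
  then have "\<forall>\<^sub>F h in at_right 0. a0 \<le> (\<integral>x. a x \<partial>lebesgue_on {L - h..L}) / h"
  proof eventually_elim
    case (elim h)
    then have "AE x in lebesgue_on {L - h..L}. a0 \<le> a x \<and> a x \<le> a1"
      using AE[of h] by (auto elim: eventually_mono)
    then show ?case using avg[of h a0 a1] elim by blast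
  qed
  then show ?thesis by (rule tendsto_lowerbound[OF lim]) simp
qed

subsection \<open>Propagation through a layered medium\<close>

text \<open>D'Alembert's formula: the state at travel time \<open>d\<close> to the left of a point with state \<open>(p, w)\<close>, in a
  homogeneous medium of impedance \<open>z\<close>.\<close>

definition step_p :: "real \<Rightarrow> real \<Rightarrow> (real \<Rightarrow> real) \<Rightarrow> (real \<Rightarrow> real) \<Rightarrow> real \<Rightarrow> real" where
  "step_p z d p w t = (p (t - d) + p (t + d)) / 2 + (w (t - d) - w (t + d)) / (2 * z)"

definition step_w :: "real \<Rightarrow> real \<Rightarrow> (real \<Rightarrow> real) \<Rightarrow> (real \<Rightarrow> real) \<Rightarrow> real \<Rightarrow> real" where
  "step_w z d p w t = z * (p (t - d) - p (t + d)) / 2 + (w (t - d) + w (t + d)) / 2"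

text \<open>In the energy estimate \<open>p\<close> and \<open>w\<close> are the fields of the datum
  \<eta>', that is, the time derivative of the displacement and the flux.\<close>

definition energy :: "real \<Rightarrow> (real \<Rightarrow> real) \<Rightarrow> (real \<Rightarrow> real) \<Rightarrow> real \<Rightarrow> real" where
  "energy z p w t = z * (p t)\<^sup>2 + (w t)\<^sup>2 / z"

section \<open>A single homogeneous layer\<close>

lemma step_zero [simp]: "z \<noteq> 0 \<Longrightarrow> step_p z 0 p w = p" "z \<noteq> 0 \<Longrightarrow> step_w z 0 p w = w"
  by (auto simp: step_p_def step_w_def fun_eq_iff)

lemma step_time_derivative:
  assumes "\<And>t. (p has_real_derivative p' t) (at t)" "\<And>t. (w has_real_derivative w' t) (at t)"
    and "z \<noteq> 0"
  shows "(step_p z d p w has_real_derivative step_p z d p' w' t) (at t)"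
    and "(step_w z d p w has_real_derivative step_w z d p' w' t) (at t)"
proof -
  note [derivative_intros] = DERIV_chain2[OF assms(1)] DERIV_chain2[OF assms(2)]
  show "(step_p z d p w has_real_derivative step_p z d p' w' t) (at t)"
    unfolding step_p_def by (auto intro!: derivative_eq_intros simp: \<open>z \<noteq> 0\<close> field_simps)
  show "(step_w z d p w has_real_derivative step_w z d p' w' t) (at t)"
    unfolding step_w_def by (auto intro!: derivative_eq_intros simp: field_simps)
qed

text \<open>This is the first order system inside one layer, with \<open>b / z = 1 / a\<close> and
  \<open>b z = \<rho>\<close>. The signs are reversed because \<open>y\<close> is the distance from
  the right end.\<close>

lemma step_space_derivative:
  assumes "\<And>t. (p has_real_derivative p' t) (at t)" "\<And>t. (w has_real_derivative w' t) (at t)"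
    and "z \<noteq> 0"
  shows "((\<lambda>y. step_p z (b * (y - c)) p w t) has_real_derivative
            - (b / z * step_w z (b * (y - c)) p' w' t)) (at y)"
    and "((\<lambda>y. step_w z (b * (y - c)) p w t) has_real_derivative
            - (b * z * step_p z (b * (y - c)) p' w' t)) (at y)"
proof -
  note [derivative_intros] = DERIV_chain2[OF assms(1)] DERIV_chain2[OF assms(2)]
  show "((\<lambda>y. step_p z (b * (y - c)) p w t) has_real_derivative
            - (b / z * step_w z (b * (y - c)) p' w' t)) (at y)"
    unfolding step_p_def step_w_def
    by (auto intro!: derivative_eq_intros simp: \<open>z \<noteq> 0\<close> field_simps)
  show "((\<lambda>y. step_w z (b * (y - c)) p w t) has_real_derivative
            - (b * z * step_p z (b * (y - c)) p' w' t)) (at y)"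
    unfolding step_p_def step_w_def
    by (auto intro!: derivative_eq_intros simp: \<open>z \<noteq> 0\<close> field_simps)
qed

text \<open>The quantity \<open>\<bar>p\<bar> + \<bar>w\<bar> / z\<close> is the larger modulus of
  the two Riemann invariants \<open>p + w / z\<close> and \<open>p - w / z\<close>. The new
  invariants are the old ones at the times \<open>t - d\<close> and \<open>t + d\<close>, namely
  \<open>A + B\<close> and \<open>C - D\<close>.\<close>

lemma step_sup_bound:
  assumes "\<And>t. \<bar>p t\<bar> + \<bar>w t\<bar> / z \<le> M" "z > 0"
  shows "\<bar>step_p z d p w t\<bar> + \<bar>step_w z d p w t\<bar> / z \<le> M"
proof -
  define A B C D where "A = p (t - d)" "B = w (t - d) / z" "C = p (t + d)" "D = w (t + d) / z"
  have "step_p z d p w t = (A + C) / 2 + (B - D) / 2"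
    by (simp add: step_p_def A_B_C_D_def diff_divide_distrib)
  moreover have "step_w z d p w t = z * ((A - C) / 2 + (B + D) / 2)"
    using \<open>z > 0\<close> by (simp add: step_w_def A_B_C_D_def field_simps)
  then have "\<bar>step_w z d p w t\<bar> / z = \<bar>(A - C) / 2 + (B + D) / 2\<bar>"
    using \<open>z > 0\<close> by (simp add: abs_mult)
  moreover have "\<bar>A\<bar> + \<bar>B\<bar> \<le> M" "\<bar>C\<bar> + \<bar>D\<bar> \<le> M"
    using assms(1)[of "t - d"] assms(1)[of "t + d"] \<open>z > 0\<close> by (auto simp: A_B_C_D_def)
  ultimately show ?thesis by argo
qed

lemma integral_shift_lborel:
  fixes f :: "real \<Rightarrow> real"
  assumes "integrable lborel f"
  shows "integrable lborel (\<lambda>t. f (t + c))" "(\<integral>t. f (t + c) \<partial>lborel) = (\<integral>t. f t \<partial>lborel)"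
  using lborel_integrable_real_affine[OF assms, of 1 c] lborel_integral_real_affine[of 1 f c]
  by (simp_all add: add.commute)

lemma energy_nonneg: "z > 0 \<Longrightarrow> 0 \<le> energy z p w t"
  by (simp add: energy_def)

lemma borel_measurable_step:
  fixes p w :: "real \<Rightarrow> real"
  assumes [measurable]: "p \<in> borel_measurable borel" "w \<in> borel_measurable borel"
  shows "step_p z d p w \<in> borel_measurable borel" "step_w z d p w \<in> borel_measurable borel"
  unfolding step_p_def step_w_def by measurable

lemma borel_measurable_energy:
  fixes p w :: "real \<Rightarrow> real"
  assumes [measurable]: "p \<in> borel_measurable borel" "w \<in> borel_measurable borel"
  shows "energy z p w \<in> borel_measurable borel"
  unfolding energy_def by measurable

text \<open>The two halves are the squares of the Riemann invariants \<open>p \<plusminus> w / z\<close>, each of which is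
  merely translated in time.\<close>

lemma step_energy:
  assumes pw: "p \<in> borel_measurable borel" "w \<in> borel_measurable borel"
    and int: "integrable lborel (energy z p w)" and "z > 0"
  shows "integrable lborel (energy z (step_p z d p w) (step_w z d p w))"
    and "(\<integral>t. energy z (step_p z d p w) (step_w z d p w) t \<partial>lborel) = (\<integral>t. energy z p w t \<partial>lborel)"
proof -
  note [measurable] = pw
  define e where "e s t = z / 2 * (p t + s * w t / z)\<^sup>2" for s t
  have sum: "energy z p w t = e 1 t + e (-1) t" for t
    using \<open>z > 0\<close> unfolding energy_def e_def by (simp add: field_simps power2_eq_square)
  have e_nonneg: "0 \<le> e s t" for s t using \<open>z > 0\<close> by (simp add: e_def)
  have e_int: "integrable lborel (e s)" if "s = 1 \<or> s = -1" for s
  proof (rule Bochner_Integration.integrable_bound[OF int])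
    show "AE t in lborel. norm (e s t) \<le> norm (energy z p w t)"
      using that e_nonneg sum by (auto intro!: AE_I2)
    show "e s \<in> borel_measurable lborel" unfolding e_def by measurable
  qed
  have eq: "energy z (step_p z d p w) (step_w z d p w) t = e 1 (t + (- d)) + e (-1) (t + d)" for t
    using \<open>z > 0\<close> unfolding energy_def e_def step_p_def step_w_def
    by (simp add: field_simps power2_eq_square)
  have ints: "integrable lborel (e 1)" "integrable lborel (e (-1))" using e_int by auto
  note shifts = integral_shift_lborel[OF ints(1), of "- d"] integral_shift_lborel[OF ints(2), of d]
  show "integrable lborel (energy z (step_p z d p w) (step_w z d p w))"
    using Bochner_Integration.integrable_add[OF shifts(1,3)] by (simp add: eq[abs_def])
  show "(\<integral>t. energy z (step_p z d p w) (step_w z d p w) t \<partial>lborel) = (\<integral>t. energy z p w t \<partial>lborel)"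
    unfolding eq sum using Bochner_Integration.integral_add[OF shifts(1,3)]
      Bochner_Integration.integral_add[OF ints] shifts(2,4) by simp
qed

text \<open>Layer \<open>k\<close> occupies the distances \<open>kh \<le> y \<le> (k + 1)h\<close> from the end \<open>x = L\<close>; there \<open>z\<close> is
  $\sqrt{\rho a}$ and \<open>b\<close> the slowness $\sqrt{\rho / a}$, so that \<open>b z = \<rho>\<close> and \<open>b / z = 1 / a\<close>. The sequence \<open>m\<close>
  majorizes the variation of \<open>ln z\<close>. The fields depend linearly on the datum \<open>f\<close> and commute with
  time translation, so their time derivatives are the fields of \<open>f'\<close>.\<close>

locale layered =
  fixes z b m :: "nat \<Rightarrow> real" and h :: real
  assumes h_pos: "h > 0" and z_pos: "\<And>k. z k > 0" and b_nonneg: "\<And>k. b k \<ge> 0"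
    and variation: "\<And>k. \<bar>ln (z (Suc k)) - ln (z k)\<bar> \<le> m (Suc k) - m k"
begin

text \<open>The state at distance \<open>k h\<close> from the right end. Both components are
  continuous across an interface, so the state leaving one layer enters the next unchanged; only the
  impedance switches.\<close>

primrec iface :: "nat \<Rightarrow> (real \<Rightarrow> real) \<Rightarrow> (real \<Rightarrow> real) \<times> (real \<Rightarrow> real)" where
  "iface 0 f = (f, \<lambda>_. 0)"
| "iface (Suc k) f = (step_p (z k) (b k * h) (fst (iface k f)) (snd (iface k f)),
     step_w (z k) (b k * h) (fst (iface k f)) (snd (iface k f)))"

abbreviation "ip k f \<equiv> fst (iface k f)"
abbreviation "iw k f \<equiv> snd (iface k f)"

definition layer :: "real \<Rightarrow> nat" where
  "layer y = nat \<lfloor>y / h\<rfloor>"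

definition fp :: "real \<Rightarrow> (real \<Rightarrow> real) \<Rightarrow> real \<Rightarrow> real" where
  "fp y f = (let k = layer y in step_p (z k) (b k * (y - k * h)) (ip k f) (iw k f))"

definition fw :: "real \<Rightarrow> (real \<Rightarrow> real) \<Rightarrow> real \<Rightarrow> real" where
  "fw y f = (let k = layer y in step_w (z k) (b k * (y - k * h)) (ip k f) (iw k f))"

lemma z_nonzero [simp]: "z k \<noteq> 0"
  using z_pos[of k] by simp

lemma layer_eq:
  assumes "k * h \<le> y" "y < (real k + 1) * h"
  shows "layer y = k"
proof -
  have "real k \<le> y / h" "y / h < real k + 1" using assms h_pos by (simp_all add: field_simps)
  then have "\<lfloor>y / h\<rfloor> = int k" by (simp add: floor_eq_iff)
  then show ?thesis by (simp add: layer_def)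
qed

lemma layer_bounds:
  assumes "0 \<le> y"
  shows "layer y * h \<le> y" "y < (real (layer y) + 1) * h"
proof -
  have "real (layer y) = of_int \<lfloor>y / h\<rfloor>" using assms h_pos by (simp add: layer_def)
  then have "real (layer y) \<le> y / h" "y / h < real (layer y) + 1" by linarith+
  then show "layer y * h \<le> y" "y < (real (layer y) + 1) * h" using h_pos by (simp_all add: field_simps)
qed

text \<open>\<open>layer\<close> assigns the far end of a layer to the next one. There the next
  layer is entered with travel time 0, where a step is the identity, so the formula of either layer
  is valid on its closed interval.\<close>

lemma field_on_layer:
  assumes "k * h \<le> y" "y \<le> (real k + 1) * h"
  shows "fp y f = step_p (z k) (b k * (y - k * h)) (ip k f) (iw k f)"
    and "fw y f = step_w (z k) (b k * (y - k * h)) (ip k f) (iw k f)"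
proof (atomize (full), cases "y = (real k + 1) * h")
  case True
  have "layer y = Suc k" by (rule layer_eq) (use True h_pos in \<open>auto simp: algebra_simps\<close>)
  then show "fp y f = step_p (z k) (b k * (y - k * h)) (ip k f) (iw k f) \<and>
    fw y f = step_w (z k) (b k * (y - k * h)) (ip k f) (iw k f)"
    unfolding fp_def fw_def using True by (simp add: algebra_simps)
next
  case False
  then have "y < (real k + 1) * h" using assms(2) by linarith
  with assms(1) have "layer y = k" by (rule layer_eq)
  then show "fp y f = step_p (z k) (b k * (y - k * h)) (ip k f) (iw k f) \<and>
    fw y f = step_w (z k) (b k * (y - k * h)) (ip k f) (iw k f)"
    by (simp add: fp_def fw_def)
qed

lemma field_at_interface: "fp (k * h) f = ip k f" "fw (k * h) f = iw k f"
  using field_on_layer[of k "k * h" f] h_pos by (auto simp: algebra_simps)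

lemma field_at_0: "fp 0 f = f" "fw 0 f = (\<lambda>_. 0)"
  using field_at_interface[of 0 f] by auto

lemma iface_time_derivative:
  assumes "\<And>t. (f has_real_derivative f' t) (at t)"
  shows "(ip k f has_real_derivative ip k f' t) (at t) \<and> (iw k f has_real_derivative iw k f' t) (at t)"
  by (induction k arbitrary: t) (use assms in \<open>auto intro!: step_time_derivative\<close>)

lemma field_time_derivative:
  assumes "\<And>t. (f has_real_derivative f' t) (at t)"
  shows "(fp y f has_real_derivative fp y f' t) (at t)" "(fw y f has_real_derivative fw y f' t) (at t)"
  using iface_time_derivative[OF assms]
  by (auto simp: fp_def fw_def Let_def intro!: step_time_derivative)

lemma field_space_derivative:
  assumes f: "\<And>t. (f has_real_derivative f' t) (at t)" and y: "0 < y" "y \<noteq> layer y * h"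
  shows "((\<lambda>y. fp y f t) has_real_derivative - (b (layer y) / z (layer y) * fw y f' t)) (at y)"
    and "((\<lambda>y. fw y f t) has_real_derivative - (b (layer y) * z (layer y) * fp y f' t)) (at y)"
proof -
  define k where "k = layer y"
  have y_in: "y \<in> {k * h<..<(real k + 1) * h}"
    using layer_bounds[of y] y by (auto simp: k_def)
  note eq = field_on_layer[of k]
  have "((\<lambda>y. fp y f t) has_real_derivative - (b k / z k * fw y f' t)) (at y)"
  proof (rule has_field_derivative_transform_within_open[OF _ open_greaterThanLessThan y_in])
    show "((\<lambda>y. step_p (z k) (b k * (y - k * h)) (ip k f) (iw k f) t) has_real_derivative
        - (b k / z k * fw y f' t)) (at y)"
      using step_space_derivative(1)[of "ip k f" "ip k f'" "iw k f" "iw k f'" "z k" "b k" "k * h" t y]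
        iface_time_derivative[OF f] y_in eq[of y f'] by simp
  qed (use eq in auto)
  moreover have "((\<lambda>y. fw y f t) has_real_derivative - (b k * z k * fp y f' t)) (at y)"
  proof (rule has_field_derivative_transform_within_open[OF _ open_greaterThanLessThan y_in])
    show "((\<lambda>y. step_w (z k) (b k * (y - k * h)) (ip k f) (iw k f) t) has_real_derivative
        - (b k * z k * fp y f' t)) (at y)"
      using step_space_derivative(2)[of "ip k f" "ip k f'" "iw k f" "iw k f'" "z k" "b k" "k * h" t y]
        iface_time_derivative[OF f] y_in eq[of y f'] by simp
  qed (use eq in auto)
  ultimately show "((\<lambda>y. fp y f t) has_real_derivative - (b (layer y) / z (layer y) * fw y f' t)) (at y)"
    and "((\<lambda>y. fw y f t) has_real_derivative - (b (layer y) * z (layer y) * fp y f' t)) (at y)"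
    by (simp_all add: k_def)
qed

text \<open>The closed layers are glued at their common end points. Continuity across the
  interfaces, where the space derivatives jump, lets the fundamental theorem of calculus be applied
  over several layers at once.\<close>

lemma field_space_continuous:
  assumes f: "\<And>t. (f has_real_derivative f' t) (at t)"
  shows "continuous_on {0..} (\<lambda>y. fp y f t)" "continuous_on {0..} (\<lambda>y. fw y f t)"
proof -
  have layer_cont: "continuous_on {real k * h..(real k + 1) * h} (\<lambda>y. fp y f t) \<and>
      continuous_on {real k * h..(real k + 1) * h} (\<lambda>y. fw y f t)" for k
  proof -
    let ?I = "{real k * h..(real k + 1) * h}"
    note d = step_space_derivative[of "ip k f" "ip k f'" "iw k f" "iw k f'" "z k" "b k" "k * h" t,
        OF conjunct1[OF iface_time_derivative[OF f]] conjunct2[OF iface_time_derivative[OF f]] z_nonzero]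
    have "continuous_on ?I (\<lambda>y. step_p (z k) (b k * (y - k * h)) (ip k f) (iw k f) t)"
      "continuous_on ?I (\<lambda>y. step_w (z k) (b k * (y - k * h)) (ip k f) (iw k f) t)"
      by (rule continuous_at_imp_continuous_on, rule ballI, rule DERIV_isCont, rule d)+
    then show ?thesis
      using continuous_on_cong[OF refl, of ?I "\<lambda>y. fp y f t"]
        continuous_on_cong[OF refl, of ?I "\<lambda>y. fw y f t"] field_on_layer[of k _ f]
      by simp
  qed
  have upto: "continuous_on {0..real k * h} (\<lambda>y. fp y f t) \<and> continuous_on {0..real k * h} (\<lambda>y. fw y f t)"
    for k
  proof (induction k)
    case (Suc k)
    have "0 \<le> real k * h" "real k * h \<le> (real k + 1) * h" using h_pos by (simp_all add: algebra_simps)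
    then have "{0..real (Suc k) * h} = {0..real k * h} \<union> {real k * h..(real k + 1) * h}"
      by (simp add: ivl_disj_un_two_touch add.commute)
    then show ?case using Suc layer_cont[of k] by (simp add: continuous_on_closed_Un)
  qed auto
  have "continuous (at y within {0..}) (\<lambda>y. fp y f t) \<and> continuous (at y within {0..}) (\<lambda>y. fw y f t)"
    if "0 \<le> y" for y
  proof -
    obtain k :: nat where k: "y < real k * h" using reals_Archimedean3[OF h_pos] by blast
    have "at y within {0..} = at y within {0..real k * h}"
      using k by (intro at_within_nhd[of _ "{..<real k * h}"]) auto
    then show ?thesis
      using upto[of k] that k by (simp add: continuous_on_eq_continuous_within)
  qed
  then show "continuous_on {0..} (\<lambda>y. fp y f t)" "continuous_on {0..} (\<lambda>y. fw y f t)"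
    by (simp_all add: continuous_on_eq_continuous_within)
qed

lemma impedance_ratio: "z k / z (Suc k) \<le> exp (m (Suc k) - m k)" "z (Suc k) / z k \<le> exp (m (Suc k) - m k)"
proof -
  have "z k / z (Suc k) = exp (ln (z k) - ln (z (Suc k)))" "z (Suc k) / z k = exp (ln (z (Suc k)) - ln (z k))"
    using z_pos by (simp_all add: exp_diff)
  then show "z k / z (Suc k) \<le> exp (m (Suc k) - m k)" "z (Suc k) / z k \<le> exp (m (Suc k) - m k)"
    using variation[of k] by (auto simp: abs_le_iff)
qed

lemma m_mono: "m k \<le> m (Suc k)"
  using variation[of k] by linarith

text \<open>Within a layer the bound is preserved by \<open>step_sup_bound\<close>. Passing from
  \<open>z k\<close> to \<open>z (Suc k)\<close> multiplies it by at most
  \<open>exp (m (Suc k) - m k)\<close>, and these factors telescope.\<close>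

lemma iface_sup_bound:
  assumes "\<And>t. \<bar>f t\<bar> \<le> S"
  shows "\<bar>ip k f t\<bar> + \<bar>iw k f t\<bar> / z k \<le> exp (m k - m 0) * S"
proof (induction k arbitrary: t)
  case 0
  show ?case using assms by simp
next
  case (Suc k)
  let ?M = "exp (m k - m 0) * S" and ?c = "exp (m (Suc k) - m k)"
  have S: "0 \<le> S" using assms[of 0] by linarith
  let ?P = "\<bar>ip (Suc k) f t\<bar>" and ?W = "\<bar>iw (Suc k) f t\<bar>"
  have step: "?P + ?W / z k \<le> ?M"
    using step_sup_bound[OF Suc.IH z_pos] by simp
  have "?P \<le> ?c * ?P"
    using m_mono[of k] by (simp add: mult_le_cancel_right1)
  moreover have "?W / z (Suc k) = (z k / z (Suc k)) * (?W / z k)"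
    by simp
  moreover have "\<dots> \<le> ?c * (?W / z k)"
    using impedance_ratio(1)[of k] z_pos[of k] by (intro mult_right_mono) auto
  ultimately have "?P + ?W / z (Suc k) \<le> ?c * (?P + ?W / z k)"
    by (simp only: distrib_left)
  also have "\<dots> \<le> ?c * ?M" using step by (intro mult_left_mono) auto
  also have "\<dots> = exp (m (Suc k) - m 0) * S" by (simp add: mult.assoc[symmetric] exp_add[symmetric])
  finally show ?case .
qed

lemma field_sup_bound:
  assumes "\<And>t. \<bar>f t\<bar> \<le> S"
  shows "\<bar>fp y f t\<bar> + \<bar>fw y f t\<bar> / z (layer y) \<le> exp (m (layer y) - m 0) * S"
  unfolding fp_def fw_def Let_def by (intro step_sup_bound iface_sup_bound assms z_pos)

text \<open>Energy is conserved inside a layer and changes only when the impedance switches. As it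
  contains both \<open>z\<close> and \<open>1 / z\<close>, both impedance ratios are used; the
  resulting factors telescope. At the right end \<open>w\<close> is 0, which leaves
  \<open>z 0\<close> times the integral of the squared datum.\<close>

lemma iface_energy:
  assumes f: "f \<in> borel_measurable borel" "integrable lborel (\<lambda>t. (f t)\<^sup>2)"
  shows "ip k f \<in> borel_measurable borel \<and> iw k f \<in> borel_measurable borel \<and>
    integrable lborel (energy (z k) (ip k f) (iw k f)) \<and>
    (\<integral>t. energy (z k) (ip k f) (iw k f) t \<partial>lborel) \<le> exp (m k - m 0) * (z 0 * (\<integral>t. (f t)\<^sup>2 \<partial>lborel))"
proof (induction k)
  case 0
  have "energy (z 0) f (\<lambda>_. 0) = (\<lambda>t. z 0 * (f t)\<^sup>2)" by (simp add: energy_def fun_eq_iff)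
  then show ?case using f by simp
next
  case (Suc k)
  let ?c = "exp (m (Suc k) - m k)" and ?p = "ip (Suc k) f" and ?w = "iw (Suc k) f"
  have meas: "?p \<in> borel_measurable borel" "?w \<in> borel_measurable borel"
    using Suc borel_measurable_step by auto
  have int: "integrable lborel (energy (z k) ?p ?w)"
    and eq: "(\<integral>t. energy (z k) ?p ?w t \<partial>lborel) = (\<integral>t. energy (z k) (ip k f) (iw k f) t \<partial>lborel)"
    using step_energy[of "ip k f" "iw k f" "z k" "b k * h"] Suc z_pos by auto
  have le: "energy (z (Suc k)) ?p ?w t \<le> ?c * energy (z k) ?p ?w t" for t
  proof -
    have "z (Suc k) \<le> ?c * z k" using impedance_ratio(2)[of k] z_pos[of k] by (simp add: field_simps)
    moreover have "1 / z (Suc k) \<le> ?c * (1 / z k)"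
      using impedance_ratio(1)[of k] z_pos[of k] z_pos[of "Suc k"] by (simp add: field_simps)
    ultimately have "z (Suc k) * (?p t)\<^sup>2 \<le> ?c * z k * (?p t)\<^sup>2"
      "1 / z (Suc k) * (?w t)\<^sup>2 \<le> ?c * (1 / z k) * (?w t)\<^sup>2"
      by (intro mult_right_mono; simp)+
    then show ?thesis unfolding energy_def by (simp add: algebra_simps)
  qed
  have int': "integrable lborel (energy (z (Suc k)) ?p ?w)"
  proof (rule Bochner_Integration.integrable_bound)
    show "integrable lborel (\<lambda>t. ?c * energy (z k) ?p ?w t)" using int by simp
    show "AE t in lborel. norm (energy (z (Suc k)) ?p ?w t) \<le> norm (?c * energy (z k) ?p ?w t)"
      using le energy_nonneg z_pos by (intro AE_I2) (simp add: abs_mult)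
  qed (use borel_measurable_energy meas in auto)
  have "(\<integral>t. energy (z (Suc k)) ?p ?w t \<partial>lborel) \<le> (\<integral>t. ?c * energy (z k) ?p ?w t \<partial>lborel)"
    using int int' le by (intro integral_mono) auto
  also have "\<dots> \<le> ?c * (exp (m k - m 0) * (z 0 * (\<integral>t. (f t)\<^sup>2 \<partial>lborel)))"
    using eq Suc by simp
  also have "\<dots> = exp (m (Suc k) - m 0) * (z 0 * (\<integral>t. (f t)\<^sup>2 \<partial>lborel))"
    by (simp add: mult.assoc[symmetric] exp_add[symmetric])
  finally show ?case using meas int' by blast
qed

text \<open>One layer shifts time by at most \<open>B h\<close> in either direction, so both values
  that a step reads still lie before the support of the preceding state.\<close>

lemma iface_support:
  assumes "\<And>t. t < t0 \<Longrightarrow> f t = 0" "\<And>k. b k \<le> B"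
  shows "t < t0 - B * (k * h) \<Longrightarrow> ip k f t = 0 \<and> iw k f t = 0"
proof (induction k arbitrary: t)
  case (Suc k)
  have "b k * h \<le> B * h" using assms(2) h_pos by simp
  moreover have "0 \<le> b k * h" using b_nonneg h_pos by simp
  ultimately have "t - b k * h < t0 - B * (k * h)" "t + b k * h < t0 - B * (k * h)"
    using Suc.prems by (simp_all add: algebra_simps)
  then show ?case using Suc.IH by (simp add: step_p_def step_w_def)
qed (use assms in auto)

lemma field_support:
  assumes "\<And>t. t < t0 \<Longrightarrow> f t = 0" "\<And>k. b k \<le> B" "0 \<le> y" "t < t0 - B * y"
  shows "fp y f t = 0" "fw y f t = 0"
proof -
  define k d where "k = layer y" "d = b k * (y - k * h)"
  have "0 \<le> y - k * h" using layer_bounds[OF assms(3)] by (simp add: k_d_def)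
  then have "0 \<le> d" "d \<le> B * (y - k * h)"
    using b_nonneg assms(2) by (auto simp: k_d_def intro!: mult_right_mono)
  then have "t - d < t0 - B * (k * h)" "t + d < t0 - B * (k * h)"
    using assms(4) by (simp_all add: algebra_simps)
  then show "fp y f t = 0" "fw y f t = 0"
    using iface_support[OF assms(1,2)] unfolding fp_def fw_def Let_def
    by (simp_all add: step_p_def step_w_def k_d_def)
qed

end

subsection \<open>Test functions from a layered medium\<close>

lemma lebesgue_integral_cong_AE:
  fixes f g :: "real \<Rightarrow> real"
  assumes ae: "AE x in lebesgue. f x = g x"
  shows "integrable lebesgue f \<longleftrightarrow> integrable lebesgue g"
    and "(\<integral>x. f x \<partial>lebesgue) = (\<integral>x. g x \<partial>lebesgue)"
proof -
  \<comment> \<open>Completeness of Lebesgue measure carries measurability over to an almost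
    everywhere equal function. If neither function is integrable, both integrals have the default
    value 0.\<close>
  have imp: "integrable lebesgue v \<and> (\<integral>x. v x \<partial>lebesgue) = (\<integral>x. u x \<partial>lebesgue)"
    if u: "integrable lebesgue u" and uv: "AE x in lebesgue. u x = v x" for u v :: "real \<Rightarrow> real"
  proof
    have um: "u \<in> borel_measurable lebesgue" using u by (rule borel_measurable_integrable)
    have vm: "v \<in> borel_measurable lebesgue" by (rule borel_measurable_AE[OF um uv])
    show "integrable lebesgue v" by (rule integrable_cong_AE_imp[OF u vm uv])
    show "(\<integral>x. v x \<partial>lebesgue) = (\<integral>x. u x \<partial>lebesgue)"
      by (rule integral_cong_AE[OF um vm uv, symmetric])
  qed
  have ae': "AE x in lebesgue. g x = f x" using ae by eventually_elim simp
  show iff: "integrable lebesgue f \<longleftrightarrow> integrable lebesgue g"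
    using imp[OF _ ae] imp[OF _ ae'] by blast
  show "(\<integral>x. f x \<partial>lebesgue) = (\<integral>x. g x \<partial>lebesgue)"
  proof (cases "integrable lebesgue f")
    case True
    then show ?thesis using imp[OF _ ae] by simp
  next
    case False
    then have "\<not> integrable lebesgue g" using iff by simp
    then show ?thesis using False by (simp add: not_integrable_integral_eq)
  qed
qed

lemma lebesgue_on_Ioo_Icc:
  fixes f :: "real \<Rightarrow> real"
  shows integrable_Ioo_iff_Icc: "integrable (lebesgue_on {c<..<d}) f \<longleftrightarrow> integrable (lebesgue_on {c..d}) f"
    and integral_Ioo_eq_Icc: "(\<integral>x. f x \<partial>lebesgue_on {c<..<d}) = (\<integral>x. f x \<partial>lebesgue_on {c..d})"
proof -
  have sets: "{c<..<d} \<inter> space lebesgue \<in> sets lebesgue" "{c..d} \<inter> space lebesgue \<in> sets lebesgue" by auto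
  have "AE x in lebesgue_on {c..d}. x \<in> {c<..<d}"
    unfolding AE_lebesgue_on_Ioo_Icc[symmetric] by (intro AE_I2) (simp add: space_restrict_space)
  then have "AE x in lebesgue. x \<in> {c..d} \<longrightarrow> x \<in> {c<..<d}"
    by (simp only: AE_lebesgue_on_iff lmeasurable_Icc_sets)
  then have ae: "AE x in lebesgue. indicator {c<..<d} x *\<^sub>R f x = indicator {c..d} x *\<^sub>R f x"
    by eventually_elim (auto simp: indicator_def)
  show "integrable (lebesgue_on {c<..<d}) f \<longleftrightarrow> integrable (lebesgue_on {c..d}) f"
    by (simp only: integrable_restrict_space[OF sets(1)] integrable_restrict_space[OF sets(2)]
        lebesgue_integral_cong_AE(1)[OF ae])
  show "(\<integral>x. f x \<partial>lebesgue_on {c<..<d}) = (\<integral>x. f x \<partial>lebesgue_on {c..d})"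
    by (simp only: integral_restrict_space[OF sets(1)] integral_restrict_space[OF sets(2)]
        lebesgue_integral_cong_AE(2)[OF ae])
qed

lemma integral_lebesgue_on_bound:
  fixes f :: "real \<Rightarrow> real"
  assumes "f \<in> borel_measurable (lebesgue_on {c..d})" "AE x in lebesgue_on {c..d}. \<bar>f x\<bar> \<le> K" "c \<le> d"
  shows "\<bar>\<integral>x. f x \<partial>lebesgue_on {c..d}\<bar> \<le> K * (d - c)"
proof -
  interpret finite_measure "lebesgue_on {c..d}" by (rule finite_measure_lebesgue_on) auto
  have "\<bar>\<integral>x. f x \<partial>lebesgue_on {c..d}\<bar> \<le> (\<integral>x. \<bar>f x\<bar> \<partial>lebesgue_on {c..d})"
    by (rule integral_abs_bound)
  also have "\<dots> \<le> (\<integral>x. K \<partial>lebesgue_on {c..d})"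
    using integrable_lebesgue_on_bounded[OF assms(1,2)] assms(2) by (intro integral_mono_AE) auto
  also have "\<dots> = K * (d - c)"
    using \<open>c \<le> d\<close> by (simp add: measure_restrict_space)
  finally show ?thesis .
qed

lemma integral_lebesgue_on_combine:
  fixes f :: "real \<Rightarrow> real"
  assumes "integrable (lebesgue_on {c..d}) f" "c \<le> x" "x \<le> d"
  shows "(\<integral>y. f y \<partial>lebesgue_on {c..x}) + (\<integral>y. f y \<partial>lebesgue_on {x..d}) = (\<integral>y. f y \<partial>lebesgue_on {c..d})"
proof -
  have sub: "integrable (lebesgue_on {c..x}) f" "integrable (lebesgue_on {x..d}) f"
    by (rule integrable_subinterval[OF assms(1)]; use assms(2,3) in auto)+
  have "f integrable_on {c..d}" using assms(1) by (rule integrable_on_lebesgue_on) auto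
  then show ?thesis
    using sub assms Henstock_Kurzweil_Integration.integral_combine[of c x d f]
    by (simp add: lebesgue_integral_eq_integral)
qed

lemma borel_measurable_lebesgue_on_subinterval:
  fixes f :: "real \<Rightarrow> real"
  assumes "f \<in> borel_measurable (lebesgue_on {c..d})" "c \<le> c'" "d' \<le> d"
  shows "f \<in> borel_measurable (lebesgue_on {c'..d'})"
  using assms(1) by (rule measurable_restrict_mono) (use assms(2,3) in auto)

lemma continuous_imp_borel_measurable_lebesgue_on:
  fixes f :: "real \<Rightarrow> real"
  assumes "continuous_on {c..d} f"
  shows "f \<in> borel_measurable (lebesgue_on {c..d})"
  using assms by (rule continuous_imp_measurable_on_sets_lebesgue) auto

lemma lipschitz_of_bounded_derivative:
  fixes f :: "real \<Rightarrow> real"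
  assumes "\<And>t. (f has_real_derivative f' t) (at t)" "\<And>t. \<bar>f' t\<bar> \<le> K"
  shows "\<bar>f \<tau> - f t\<bar> \<le> K * \<bar>\<tau> - t\<bar>"
  using field_differentiable_bound[of UNIV f f' K \<tau> t] assms
  by (auto simp: has_field_derivative_at_within)

text \<open>Prepares differentiation under the integral sign: a Taylor remainder bounded uniformly
  in \<open>x\<close> can be integrated over \<open>x\<close>, and a quadratic bound on the
  integrated remainder identifies the derivative
  (\<open>has_real_derivative_of_quadratic_bound\<close>).\<close>

lemma taylor_quadratic_bound:
  fixes f :: "real \<Rightarrow> real"
  assumes f: "\<And>t. (f has_real_derivative f' t) (at t)" and f': "\<And>t. (f' has_real_derivative f'' t) (at t)"
    and K: "\<And>t. \<bar>f'' t\<bar> \<le> K"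
  shows "\<bar>f \<tau> - f t - (\<tau> - t) * f' t\<bar> \<le> K * (\<tau> - t)\<^sup>2"
proof -
  have d: "((\<lambda>s. f s - s * f' t) has_real_derivative (f' s - f' t)) (at s within S)" for s S
    using f by (auto intro!: derivative_eq_intros DERIV_subset[OF f])
  have "\<bar>(f \<tau> - \<tau> * f' t) - (f t - t * f' t)\<bar> \<le> (K * \<bar>\<tau> - t\<bar>) * \<bar>\<tau> - t\<bar>"
  proof -
    have "\<bar>f' s - f' t\<bar> \<le> K * \<bar>\<tau> - t\<bar>" if "s \<in> closed_segment t \<tau>" for s
    proof -
      have "\<bar>s - t\<bar> \<le> \<bar>\<tau> - t\<bar>" using that by (auto simp: closed_segment_eq_real_ivl split: if_splits)
      moreover have "0 \<le> K" using K[of 0] by linarith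
      ultimately show ?thesis
        using lipschitz_of_bounded_derivative[OF f' K, of s t] mult_left_mono by (meson order_trans)
    qed
    then show ?thesis
      using field_differentiable_bound[of "closed_segment t \<tau>" "\<lambda>s. f s - s * f' t" "\<lambda>s. f' s - f' t" "K * \<bar>\<tau> - t\<bar>" \<tau> t] d
      by auto
  qed
  moreover have "K * \<bar>\<tau> - t\<bar> * \<bar>\<tau> - t\<bar> = K * (\<tau> - t)\<^sup>2"
    by (simp add: power2_eq_square mult.assoc)
  moreover have "(f \<tau> - \<tau> * f' t) - (f t - t * f' t) = f \<tau> - f t - (\<tau> - t) * f' t"
    by (simp add: algebra_simps)
  ultimately show ?thesis by simp
qed

lemma has_real_derivative_of_quadratic_bound:
  fixes f :: "real \<Rightarrow> real"
  assumes "\<And>\<tau>. \<bar>f \<tau> - f t - (\<tau> - t) * D\<bar> \<le> K * (\<tau> - t)\<^sup>2"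
  shows "(f has_real_derivative D) (at t)"
proof -
  have "((\<lambda>\<tau>. (f \<tau> - f t) / (\<tau> - t) - D) \<longlongrightarrow> 0) (at t)"
  proof (rule Lim_null_comparison)
    have "norm ((f \<tau> - f t) / (\<tau> - t) - D) \<le> K * \<bar>\<tau> - t\<bar>" if "\<tau> \<noteq> t" for \<tau>
    proof -
      have "\<bar>(f \<tau> - f t) / (\<tau> - t) - D\<bar> * \<bar>\<tau> - t\<bar> = \<bar>f \<tau> - f t - (\<tau> - t) * D\<bar>"
      proof -
        have "((f \<tau> - f t) / (\<tau> - t) - D) * (\<tau> - t) = f \<tau> - f t - (\<tau> - t) * D"
          using that by (subst left_diff_distrib) (simp add: mult.commute)
        then show ?thesis by (simp only: abs_mult[symmetric])
      qed
      also have "\<dots> \<le> (K * \<bar>\<tau> - t\<bar>) * \<bar>\<tau> - t\<bar>"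
        using assms[of \<tau>] by (simp add: power2_eq_square mult.assoc)
      finally show ?thesis using that by simp
    qed
    then show "\<forall>\<^sub>F \<tau> in at t. norm ((f \<tau> - f t) / (\<tau> - t) - D) \<le> K * \<bar>\<tau> - t\<bar>"
      by (auto simp: eventually_at_filter)
    have "((\<lambda>\<tau>. K * \<bar>\<tau> - t\<bar>) \<longlongrightarrow> K * \<bar>t - t\<bar>) (at t)" by (intro tendsto_intros)
    then show "((\<lambda>\<tau>. K * \<bar>\<tau> - t\<bar>) \<longlongrightarrow> 0) (at t)" by simp
  qed
  then show ?thesis unfolding has_field_derivative_iff using Lim_null by blast
qed

lemma L2_on_bounded:
  fixes f :: "real \<Rightarrow> real"
  assumes "f \<in> borel_measurable (lebesgue_on {c<..<d})" "\<And>x. \<bar>f x\<bar> \<le> K"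
  shows "L2_on {c<..<d} f"
proof -
  interpret finite_measure "lebesgue_on {c<..<d}" by (rule finite_measure_lebesgue_on) auto
  have "(f x)\<^sup>2 \<le> K\<^sup>2" for x using assms(2)[of x] by (metis abs_ge_zero power2_abs power_mono)
  then show ?thesis unfolding L2_on_def
    using assms(1) by (auto intro!: integrable_const_bound[where B="K\<^sup>2"])
qed

lemma L2_norm_le_bound:
  fixes f :: "real \<Rightarrow> real"
  assumes "f \<in> borel_measurable (lebesgue_on {0<..<d})" "\<And>x. \<bar>f x\<bar> \<le> K" "0 \<le> d"
  shows "L2_norm {0<..<d} f \<le> K * sqrt d"
proof (rule power2_le_imp_le)
  interpret finite_measure "lebesgue_on {0<..<d}" by (rule finite_measure_lebesgue_on) auto
  have "(f x)\<^sup>2 \<le> K\<^sup>2" for x using assms(2)[of x] by (metis abs_ge_zero power2_abs power_mono)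
  then have "(\<integral>x. (f x)\<^sup>2 \<partial>lebesgue_on {0<..<d}) \<le> (\<integral>x. K\<^sup>2 \<partial>lebesgue_on {0<..<d})"
    using L2_on_bounded[OF assms(1,2)] unfolding L2_on_def by (intro integral_mono) auto
  also have "\<dots> = (K * sqrt d)\<^sup>2" using assms(3) by (simp add: measure_restrict_space power_mult_distrib)
  finally show "(L2_norm {0<..<d} f)\<^sup>2 \<le> (K * sqrt d)\<^sup>2" by (simp add: L2_norm_squared)
  have "0 \<le> K" using assms(2)[of 0] by linarith
  then show "0 \<le> K * sqrt d" using assms(3) by simp
qed

text \<open>The layers fill the interval exactly, so interface \<open>N\<close> is the point
  \<open>x = h\<close>. The parameters \<open>zm\<close>, \<open>V\<close> and \<open>B\<close>
  bound the impedance, the growth of \<open>m\<close> and the slowness; the estimates are expressed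
  through them so that they can be made uniform in \<open>N\<close>.\<close>

locale layered_test = layered +
  fixes N :: nat and L a0 zm V B :: real and a :: "real \<Rightarrow> real"
  assumes L_eq: "L = (real N + 1) * h" and a0_pos: "a0 > 0"
    and a_meas: "a \<in> borel_measurable (lebesgue_on {0..L})"
    and a_ge: "AE x in lebesgue_on {0..L}. a0 \<le> a x"
    and z_le: "\<And>k. z k \<le> zm" and m_le: "\<And>k. m k - m 0 \<le> V" and b_le: "\<And>k. b k \<le> B"
begin

text \<open>As the flux is the time derivative of \<open>w\<close>, it is the \<open>w\<close> field
  of the differentiated datum: \<open>flux (e 1)\<close> belongs to the test function with boundary
  value \<open>e 0\<close>. The two branches agree at \<open>x = h\<close>, which is interface
  \<open>N\<close>.\<close>

definition flux :: "(real \<Rightarrow> real) \<Rightarrow> real \<Rightarrow> real \<Rightarrow> real" where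
  "flux f t x = (if x < h then x / h * fw (N * h) f t else fw (L - x) f t)"

definition flux_deriv :: "(real \<Rightarrow> real) \<Rightarrow> (real \<Rightarrow> real) \<Rightarrow> real \<Rightarrow> real \<Rightarrow> real" where
  "flux_deriv f f' t x = (if x < h then fw (N * h) f t / h
     else b (layer (L - x)) * z (layer (L - x)) * fp (L - x) f' t)"

text \<open>The flux is computed with the layered coefficients, but the displacement is recovered from it with
  the true \<open>a\<close>, because \<open>wave_test\<close> ties the two together through \<open>a\<close>.\<close>

definition disp :: "(real \<Rightarrow> real) \<Rightarrow> (real \<Rightarrow> real) \<Rightarrow> real \<Rightarrow> real \<Rightarrow> real" where
  "disp f f' t x = f t - (\<integral>y. flux f' t y / a y \<partial>lebesgue_on {x..L})"

section \<open>Bounds and regularity of flux and displacement\<close>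

lemma h_le_L: "h \<le> L"
  using h_pos by (simp add: L_eq algebra_simps)

lemma L_minus_h: "L - h = real N * h"
  by (simp add: L_eq algebra_simps)

lemma L_pos: "L > 0"
  using h_pos h_le_L by simp

lemma zm_pos: "zm > 0" using z_le[of 0] z_pos[of 0] by linarith

lemma B_nonneg: "B \<ge> 0" using b_le[of 0] b_nonneg[of 0] by linarith

lemma field_bounds:
  assumes "\<And>t. \<bar>f t\<bar> \<le> S"
  shows "\<bar>fp y f t\<bar> \<le> exp V * S" "\<bar>fw y f t\<bar> \<le> zm * exp V * S"
proof -
  let ?k = "layer y"
  have S: "0 \<le> S" using assms[of 0] by linarith
  have "\<bar>fp y f t\<bar> + \<bar>fw y f t\<bar> / z ?k \<le> exp (m ?k - m 0) * S"
    by (rule field_sup_bound[OF assms])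
  also have "\<dots> \<le> exp V * S" using m_le S by (intro mult_right_mono) auto
  finally have *: "\<bar>fp y f t\<bar> + \<bar>fw y f t\<bar> / z ?k \<le> exp V * S" .
  moreover have "0 \<le> \<bar>fw y f t\<bar> / z ?k" using z_pos[of ?k] by simp
  ultimately show "\<bar>fp y f t\<bar> \<le> exp V * S" by linarith
  have "\<bar>fw y f t\<bar> / z ?k \<le> exp V * S" using * by linarith
  then have "\<bar>fw y f t\<bar> \<le> z ?k * (exp V * S)" using z_pos[of ?k] by (simp add: field_simps)
  also have "\<dots> \<le> zm * (exp V * S)" using z_le S by (intro mult_right_mono) auto
  finally show "\<bar>fw y f t\<bar> \<le> zm * exp V * S" by (simp add: mult.assoc)
qed

lemma flux_bound:
  assumes "\<And>t. \<bar>f t\<bar> \<le> S" "0 \<le> x"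
  shows "\<bar>flux f t x\<bar> \<le> zm * exp V * S"
proof (cases "x < h")
  case True
  have "\<bar>flux f t x\<bar> = x / h * \<bar>fw (N * h) f t\<bar>"
    using True assms h_pos by (simp add: flux_def abs_mult)
  also have "\<dots> \<le> 1 * \<bar>fw (N * h) f t\<bar>"
    using True h_pos by (intro mult_right_mono) auto
  finally show ?thesis using field_bounds(2)[of f S "N * h" t] assms by simp
qed (use field_bounds(2) assms in \<open>simp add: flux_def\<close>)

lemma flux_time_derivative:
  assumes "\<And>t. (f has_real_derivative f' t) (at t)"
  shows "((\<lambda>t. flux f t x) has_real_derivative flux f' t x) (at t)"
proof (cases "x < h")
  case True
  have "((\<lambda>t. x / h * fw (N * h) f t) has_real_derivative x / h * fw (N * h) f' t) (at t)"
    by (rule DERIV_cmult) (rule field_time_derivative[OF assms])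
  then show ?thesis using True by (simp add: flux_def)
qed (simp add: flux_def field_time_derivative[OF assms])

lemma field_continuous_reflected:
  assumes "\<And>t. (f has_real_derivative f' t) (at t)"
  shows "continuous_on {c..L} (\<lambda>x. fp (L - x) f t)" "continuous_on {c..L} (\<lambda>x. fw (L - x) f t)"
proof -
  have cont: "continuous_on {c..L} (\<lambda>x. L - x)" "(\<lambda>x. L - x) ` {c..L} \<subseteq> {0..}"
    by (auto intro!: continuous_intros)
  show "continuous_on {c..L} (\<lambda>x. fp (L - x) f t)"
    by (rule continuous_on_compose2[OF field_space_continuous(1)[OF assms] cont])
  show "continuous_on {c..L} (\<lambda>x. fw (L - x) f t)"
    by (rule continuous_on_compose2[OF field_space_continuous(2)[OF assms] cont])
qed

lemma flux_continuous:
  assumes "\<And>t. (f has_real_derivative f' t) (at t)"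
  shows "continuous_on {0..L} (flux f t)"
proof -
  have "continuous_on {0..h} (flux f t)"
  proof (rule continuous_on_eq)
    show "continuous_on {0..h} (\<lambda>x. x / h * fw (N * h) f t)"
      using h_pos by (intro continuous_intros) auto
    show "x / h * fw (N * h) f t = flux f t x" if "x \<in> {0..h}" for x
      using that h_pos by (cases "x = h") (auto simp: flux_def L_minus_h)
  qed
  moreover have "continuous_on {h..L} (flux f t)"
    by (rule continuous_on_eq[OF field_continuous_reflected(2)[OF assms]]) (simp add: flux_def)
  ultimately have "continuous_on ({0..h} \<union> {h..L}) (flux f t)"
    by (intro continuous_on_closed_Un) auto
  then show ?thesis using h_le_L h_pos by (simp add: ivl_disj_un_two_touch)
qed

lemma layer_reflected:
  assumes "x < L" "x \<notin> (\<lambda>k. L - real k * h) ` {..Suc N}" "0 < x"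
  shows "0 < L - x" "L - x \<noteq> real (layer (L - x)) * h"
proof -
  show "0 < L - x" using assms by simp
  show "L - x \<noteq> real (layer (L - x)) * h"
  proof
    assume eq: "L - x = real (layer (L - x)) * h"
    then have "real (layer (L - x)) * h \<le> (real N + 1) * h" using assms(3) L_eq by simp
    then have "layer (L - x) \<in> {..Suc N}" using h_pos by simp
    moreover have "x = L - real (layer (L - x)) * h" using eq by simp
    ultimately have "x \<in> (\<lambda>k. L - real k * h) ` {..Suc N}" by (rule rev_image_eqI)
    then show False using assms(2) by blast
  qed
qed

lemma flux_has_integral:
  assumes f: "\<And>t. (f has_real_derivative f' t) (at t)" and "0 \<le> c" "c \<le> d" "d \<le> L"
  shows "(flux_deriv f f' t has_integral flux f t d - flux f t c) {c..d}"
proof (rule fundamental_theorem_of_calculus_interior_strong)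
  let ?S = "(\<lambda>k. L - real k * h) ` {..Suc N}"
  show "finite ?S" by simp
  show "continuous_on {c..d} (flux f t)"
    using flux_continuous[OF f] by (rule continuous_on_subset) (use assms in auto)
  fix x assume x: "x \<in> {c<..<d} - ?S"
  have "(flux f t has_real_derivative flux_deriv f f' t x) (at x)"
  proof (cases "x < h")
    case True
    have "((\<lambda>x. x / h * fw (N * h) f t) has_real_derivative flux_deriv f f' t x) (at x)"
      using True h_pos by (auto intro!: derivative_eq_intros simp: flux_deriv_def)
    then show ?thesis
      by (rule has_field_derivative_transform_within_open[OF _ open_lessThan[of h]])
        (use True in \<open>auto simp: flux_def\<close>)
  next
    case False
    \<comment> \<open>The kink made by the interpolation sits at \<open>L - N h = h\<close>, one of
      the excluded interface points.\<close>
    have "h \<noteq> x" using x L_minus_h by (auto simp: image_iff algebra_simps)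
    have y: "0 < L - x" "L - x \<noteq> real (layer (L - x)) * h"
      using layer_reflected[of x] x assms by auto
    have "((\<lambda>x. L - x) has_real_derivative - 1) (at x)"
      by (auto intro!: derivative_eq_intros)
    from DERIV_chain2[OF field_space_derivative(2)[OF f y] this]
    have "((\<lambda>x. fw (L - x) f t) has_real_derivative flux_deriv f f' t x) (at x)"
      using False by (simp add: flux_deriv_def)
    then show ?thesis
      by (rule has_field_derivative_transform_within_open[OF _ open_greaterThan[of h]])
        (use False \<open>h \<noteq> x\<close> in \<open>auto simp: flux_def\<close>)
  qed
  then show "(flux f t has_vector_derivative flux_deriv f f' t x) (at x)"
    by (simp add: has_real_derivative_iff_has_vector_derivative)
qed (use assms in auto)

text \<open>This represents \<open>fp\<close> by the layered value \<open>b / z\<close> of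
  \<open>1 / a\<close>, just as \<open>disp\<close> is defined with the true \<open>1 / a\<close>;
  the two formulas are compared in \<open>disp_near_field\<close>.\<close>

lemma field_has_integral:
  assumes f: "\<And>t. (f has_real_derivative f' t) (at t)" and "0 \<le> x" "x \<le> L"
  shows "((\<lambda>y. b (layer (L - y)) / z (layer (L - y)) * fw (L - y) f' t) has_integral f t - fp (L - x) f t) {x..L}"
proof -
  let ?S = "(\<lambda>k. L - real k * h) ` {..Suc N}"
  have "((\<lambda>y. b (layer (L - y)) / z (layer (L - y)) * fw (L - y) f' t) has_integral
      fp (L - L) f t - fp (L - x) f t) {x..L}"
  proof (rule fundamental_theorem_of_calculus_interior_strong)
    show "finite ?S" by simp
    show "continuous_on {x..L} (\<lambda>y. fp (L - y) f t)" by (rule field_continuous_reflected[OF f])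
    fix y assume y: "y \<in> {x<..<L} - ?S"
    have *: "0 < L - y" "L - y \<noteq> real (layer (L - y)) * h"
      using layer_reflected[of y] y assms by auto
    have "((\<lambda>x. L - x) has_real_derivative - 1) (at y)"
      by (auto intro!: derivative_eq_intros)
    from DERIV_chain2[OF field_space_derivative(1)[OF f *] this]
    show "((\<lambda>y. fp (L - y) f t) has_vector_derivative
        b (layer (L - y)) / z (layer (L - y)) * fw (L - y) f' t) (at y)"
      by (simp add: has_real_derivative_iff_has_vector_derivative)
  qed (use assms in auto)
  then show ?thesis by (simp add: field_at_0)
qed

lemma flux_deriv_measurable:
  assumes "\<And>t. (f has_real_derivative f' t) (at t)"
  shows "flux_deriv f f' t \<in> borel_measurable (lebesgue_on {0..L})"
  using flux_has_integral[OF assms, of 0 L] L_pos by (auto intro!: integrable_imp_measurable)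

lemma flux_deriv_bound:
  assumes "\<And>t. \<bar>f t\<bar> \<le> S" "\<And>t. \<bar>f' t\<bar> \<le> S"
  shows "\<bar>flux_deriv f f' t x\<bar> \<le> (1 / h + B) * (zm * exp V * S)"
proof -
  have S: "0 \<le> S" using assms(1)[of 0] by linarith
  have E: "0 \<le> zm * exp V * S" using S zm_pos by simp
  show ?thesis
  proof (cases "x < h")
    case True
    have "\<bar>flux_deriv f f' t x\<bar> = 1 / h * \<bar>fw (N * h) f t\<bar>" using True h_pos by (simp add: flux_deriv_def)
    also have "\<dots> \<le> 1 / h * (zm * exp V * S)"
      using field_bounds(2)[OF assms(1)] h_pos by (intro mult_left_mono) auto
    also have "\<dots> \<le> (1 / h + B) * (zm * exp V * S)"
      using B_nonneg E by (intro mult_right_mono) auto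
    finally show ?thesis .
  next
    case False
    let ?k = "layer (L - x)"
    have "\<bar>flux_deriv f f' t x\<bar> = b ?k * z ?k * \<bar>fp (L - x) f' t\<bar>"
      using False b_nonneg[of ?k] z_pos[of ?k] by (simp add: flux_deriv_def abs_mult)
    also have "\<dots> \<le> B * zm * (exp V * S)"
      using field_bounds(1)[OF assms(2)] b_nonneg[of ?k] z_pos[of ?k] b_le z_le B_nonneg zm_pos S
      by (intro mult_mono) auto
    also have "\<dots> = B * (zm * exp V * S)" by simp
    also have "\<dots> \<le> (1 / h + B) * (zm * exp V * S)"
      using h_pos E by (intro mult_right_mono) auto
    finally show ?thesis .
  qed
qed

lemma integral_div_a:
  assumes g: "g \<in> borel_measurable (lebesgue_on {c..d})" "\<And>x. x \<in> {c..d} \<Longrightarrow> \<bar>g x\<bar> \<le> K"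
    and cd: "0 \<le> c" "c \<le> d" "d \<le> L"
  shows "integrable (lebesgue_on {c..d}) (\<lambda>y. g y / a y)"
    and "\<bar>\<integral>y. g y / a y \<partial>lebesgue_on {c..d}\<bar> \<le> K / a0 * (d - c)"
proof -
  have [measurable]: "a \<in> borel_measurable (lebesgue_on {c..d})"
    by (rule borel_measurable_lebesgue_on_subinterval[OF a_meas]) (use cd in auto)
  note [measurable] = g(1)
  have meas: "(\<lambda>y. g y / a y) \<in> borel_measurable (lebesgue_on {c..d})" by measurable
  have "AE y in lebesgue_on {c..d}. a0 \<le> a y"
    by (rule AE_lebesgue_on_subset[OF a_ge]) (use cd in auto)
  moreover have "AE y in lebesgue_on {c..d}. \<bar>g y\<bar> \<le> K"
    using g(2) by (intro AE_I2) (simp add: space_restrict_space)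
  ultimately have bd: "AE y in lebesgue_on {c..d}. \<bar>g y / a y\<bar> \<le> K / a0"
  proof eventually_elim
    case (elim y)
    then have "\<bar>g y\<bar> / a y \<le> K / a0" using a0_pos by (intro frac_le) auto
    then show ?case using elim a0_pos by simp
  qed
  show "integrable (lebesgue_on {c..d}) (\<lambda>y. g y / a y)"
    by (rule integrable_lebesgue_on_bounded[OF meas bd])
  show "\<bar>\<integral>y. g y / a y \<partial>lebesgue_on {c..d}\<bar> \<le> K / a0 * (d - c)"
    by (rule integral_lebesgue_on_bound[OF meas bd cd(2)])
qed

lemma flux_measurable:
  assumes "\<And>t. (f has_real_derivative f' t) (at t)" "0 \<le> c" "d \<le> L"
  shows "flux f t \<in> borel_measurable (lebesgue_on {c..d})"
  by (rule borel_measurable_lebesgue_on_subinterval[OF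
        continuous_imp_borel_measurable_lebesgue_on[OF flux_continuous[OF assms(1)]] assms(2,3)])

lemma flux_div_a:
  assumes "\<And>t. (f has_real_derivative f' t) (at t)" "\<And>t. \<bar>f t\<bar> \<le> S" "0 \<le> c" "c \<le> d" "d \<le> L"
  shows "integrable (lebesgue_on {c..d}) (\<lambda>y. flux f t y / a y)"
    and "\<bar>\<integral>y. flux f t y / a y \<partial>lebesgue_on {c..d}\<bar> \<le> zm * exp V * S / a0 * (d - c)"
  using integral_div_a[OF flux_measurable[OF assms(1,3,5)] flux_bound[OF assms(2)] assms(3-5)] assms(3)
  by simp_all

lemma flux_eq_integral:
  assumes "\<And>t. (f has_real_derivative f' t) (at t)" "\<And>t. \<bar>f t\<bar> \<le> S" "\<And>t. \<bar>f' t\<bar> \<le> S" "0 \<le> x" "x \<le> L"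
  shows "flux f t x = (\<integral>y. flux_deriv f f' t y \<partial>lebesgue_on {0..x})"
proof -
  have "integrable (lebesgue_on {0..x}) (flux_deriv f f' t)"
    by (rule integrable_lebesgue_on_bounded[OF borel_measurable_lebesgue_on_subinterval[OF
          flux_deriv_measurable[OF assms(1)]] AE_I2[OF flux_deriv_bound[OF assms(2,3)]]])
      (use assms in auto)
  then have "(\<integral>y. flux_deriv f f' t y \<partial>lebesgue_on {0..x}) = integral {0..x} (flux_deriv f f' t)"
    by (simp add: lebesgue_integral_eq_integral)
  also have "\<dots> = flux f t x - flux f t 0"
    by (rule integral_unique[OF flux_has_integral[OF assms(1)]]) (use assms in auto)
  finally show ?thesis using h_pos by (simp add: flux_def)
qed

lemma flux_at_L: "flux f t L = 0"
  using h_le_L by (simp add: flux_def field_at_0)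

lemma disp_at_L: "disp f f' t L = f t"
proof -
  have "(\<integral>y. flux f' t y / a y \<partial>lebesgue_on {L..L}) = (\<integral>y. 0 \<partial>lebesgue_on {L..L})"
    by (rule Bochner_Integration.integral_cong) (auto simp: space_restrict_space flux_at_L)
  then show ?thesis by (simp add: disp_def)
qed

lemma disp_bound:
  assumes "\<And>t. (f' has_real_derivative f'' t) (at t)"
    and "\<And>t. \<bar>f t\<bar> \<le> S" "\<And>t. \<bar>f' t\<bar> \<le> S" "0 \<le> x" "x \<le> L"
  shows "\<bar>disp f f' t x\<bar> \<le> (1 + zm * exp V / a0 * L) * S"
proof -
  have S: "0 \<le> S" using assms(2)[of 0] by linarith
  have "\<bar>\<integral>y. flux f' t y / a y \<partial>lebesgue_on {x..L}\<bar> \<le> zm * exp V * S / a0 * (L - x)"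
    by (rule flux_div_a[OF assms(1,3,4,5)]) simp
  also have "\<dots> \<le> zm * exp V * S / a0 * L"
    using assms(4) zm_pos a0_pos S by (intro mult_left_mono) auto
  finally show ?thesis using assms(2)[of t] unfolding disp_def by (simp add: algebra_simps)
qed

text \<open>Differentiation under the integral: the Taylor remainder of the flux in time is
  quadratic uniformly in \<open>y\<close>, by the bound on \<open>f3\<close>, and remains so after
  division by \<open>a \<ge> a0\<close> and integration.\<close>

lemma disp_time_derivative:
  assumes d: "\<And>t. (f has_real_derivative f1 t) (at t)" "\<And>t. (f1 has_real_derivative f2 t) (at t)"
      "\<And>t. (f2 has_real_derivative f3 t) (at t)" "\<And>t. (f3 has_real_derivative f4 t) (at t)"
    and bd: "\<And>t. \<bar>f1 t\<bar> \<le> S" "\<And>t. \<bar>f2 t\<bar> \<le> S" "\<And>t. \<bar>f3 t\<bar> \<le> S" and x: "0 \<le> x" "x \<le> L"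
  shows "((\<lambda>t. disp f f1 t x) has_real_derivative disp f1 f2 t x) (at t)"
proof -
  let ?K = "zm * exp V * S"
  let ?I = "\<lambda>g t. \<integral>y. flux g t y / a y \<partial>lebesgue_on {x..L}"
  have "((\<lambda>t. ?I f1 t) has_real_derivative ?I f2 t) (at t)"
  proof (rule has_real_derivative_of_quadratic_bound)
    fix \<tau>
    let ?e = "\<lambda>y. flux f1 \<tau> y - flux f1 t y - (\<tau> - t) * flux f2 t y"
    have int: "integrable (lebesgue_on {x..L}) (\<lambda>y. flux f1 s y / a y)"
      "integrable (lebesgue_on {x..L}) (\<lambda>y. flux f2 s y / a y)" for s
      by (rule flux_div_a[OF d(2) bd(1) x] flux_div_a[OF d(3) bd(2) x]; simp)+
    have "?I f1 \<tau> - ?I f1 t - (\<tau> - t) * ?I f2 t = (\<integral>y. ?e y / a y \<partial>lebesgue_on {x..L})"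
      using int by (simp add: diff_divide_distrib flip: times_divide_eq_right)
    also have "\<bar>\<dots>\<bar> \<le> ?K * (\<tau> - t)\<^sup>2 / a0 * (L - x)"
    proof (rule integral_div_a)
      show "?e \<in> borel_measurable (lebesgue_on {x..L})"
        using flux_measurable[OF d(2) x(1), of L] flux_measurable[OF d(3) x(1), of L] by simp
      show "\<bar>?e y\<bar> \<le> ?K * (\<tau> - t)\<^sup>2" if "y \<in> {x..L}" for y
        by (rule taylor_quadratic_bound[where f'' = "\<lambda>t. flux f3 t y"])
          (use that x in \<open>auto intro!: flux_time_derivative d flux_bound bd\<close>)
    qed (use x in auto)
    finally show "\<bar>?I f1 \<tau> - ?I f1 t - (\<tau> - t) * ?I f2 t\<bar> \<le> ?K / a0 * (L - x) * (\<tau> - t)\<^sup>2"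
      by (simp add: mult_ac)
  qed
  from DERIV_diff[OF d(1) this] show ?thesis unfolding disp_def .
qed

lemma disp_eq_integral:
  assumes "\<And>t. (f' has_real_derivative f'' t) (at t)" "\<And>t. \<bar>f' t\<bar> \<le> S" "0 \<le> x" "x \<le> x'" "x' \<le> L"
  shows "disp f f' t x' = disp f f' t x + (\<integral>y. flux f' t y / a y \<partial>lebesgue_on {x..x'})"
proof -
  have "integrable (lebesgue_on {x..L}) (\<lambda>y. flux f' t y / a y)"
    by (rule flux_div_a[OF assms(1,2)]) (use assms in auto)
  from integral_lebesgue_on_combine[OF this assms(4,5)] show ?thesis unfolding disp_def by simp
qed

lemma disp_lipschitz_space:
  assumes "\<And>t. (f' has_real_derivative f'' t) (at t)" "\<And>t. \<bar>f' t\<bar> \<le> S" "x \<in> {0..L}" "x' \<in> {0..L}"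
  shows "\<bar>disp f f' t x' - disp f f' t x\<bar> \<le> zm * exp V * S / a0 * \<bar>x' - x\<bar>"
proof -
  have le: "\<bar>disp f f' t y - disp f f' t x\<bar> \<le> zm * exp V * S / a0 * \<bar>y - x\<bar>"
    if "0 \<le> x" "x \<le> y" "y \<le> L" for x y
    using disp_eq_integral[OF assms(1,2) that, of f t] flux_div_a(2)[OF assms(1,2) that, of t] that by simp
  show ?thesis
    using le[of x x'] le[of x' x] assms(3,4) by (cases "x \<le> x'") (auto simp: abs_minus_commute)
qed

lemma disp_support:
  assumes "\<And>t. t < t0 \<Longrightarrow> f t = 0" "\<And>t. t < t0 \<Longrightarrow> f' t = 0" "t < t0 - B * L" "0 \<le> x"
  shows "disp f f' t x = 0"
proof -
  have le: "t < t0 - B * y" if "y \<le> L" for y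
    using assms(3) mult_left_mono[OF that B_nonneg] by linarith
  have "flux f' t y = 0" if "y \<in> {x..L}" for y
  proof -
    have "real N * h \<le> L" using L_minus_h h_pos by linarith
    then have "t < t0 - B * (real N * h)" by (rule le)
    then have "fw (real N * h) f' t = 0"
      using h_pos by (intro field_support(2)[OF assms(2) b_le]) auto
    moreover have "t < t0 - B * (L - y)"
      by (rule le) (use that assms(4) in auto)
    then have "fw (L - y) f' t = 0"
      using that by (intro field_support(2)[OF assms(2) b_le]) auto
    ultimately show ?thesis by (simp add: flux_def)
  qed
  then have "(\<integral>y. flux f' t y / a y \<partial>lebesgue_on {x..L}) = (\<integral>y. 0 \<partial>lebesgue_on {x..L})"
    by (intro Bochner_Integration.integral_cong) (auto simp: space_restrict_space)
  moreover have "f t = 0" using assms(1) le[of 0] L_pos by simp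
  ultimately show ?thesis by (simp add: disp_def)
qed

text \<open>Here \<open>e n\<close> is the \<open>n\<close>-th derivative of the boundary datum. The
  order 5 comes from the continuity of the second time derivative: it is Lipschitz in time because a
  third one, \<open>disp (e 3) (e 4)\<close>, exists and is bounded, and differentiating
  \<open>disp (e 2) (e 3)\<close> under the integral uses a bound on \<open>e 5\<close>.\<close>

lemma wave_test_disp:
  assumes e: "\<And>n t. (e n has_real_derivative e (Suc n) t) (at t)"
    and bd: "\<And>n t. n \<le> 5 \<Longrightarrow> \<bar>e n t\<bar> \<le> S"
    and supp: "\<And>n t. t < t0 \<Longrightarrow> e n t = 0" and t0: "B * L < t0"
  shows "wave_test L T a (disp (e 0) (e 1)) (disp (e 2) (e 3)) (flux_deriv (e 1) (e 2))"
proof -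
  have d0: "\<And>t. (e 0 has_real_derivative e 1 t) (at t)" and d1: "\<And>t. (e 1 has_real_derivative e 2 t) (at t)"
    and d2: "\<And>t. (e 2 has_real_derivative e 3 t) (at t)" and d3: "\<And>t. (e 3 has_real_derivative e 4 t) (at t)"
    and d4: "\<And>t. (e 4 has_real_derivative e 5 t) (at t)" and d5: "\<And>t. (e 5 has_real_derivative e 6 t) (at t)"
    using e[of 0] e[of 1] e[of 2] e[of 3] e[of 4] e[of 5]
    by (simp_all add: numeral_eq_Suc)
  have b: "\<And>t. \<bar>e 0 t\<bar> \<le> S" "\<And>t. \<bar>e 1 t\<bar> \<le> S" "\<And>t. \<bar>e 2 t\<bar> \<le> S" "\<And>t. \<bar>e 3 t\<bar> \<le> S"
    "\<And>t. \<bar>e 4 t\<bar> \<le> S" "\<And>t. \<bar>e 5 t\<bar> \<le> S"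
    by (rule bd; simp)+
  have S: "0 \<le> S" using b(1)[of 0] by linarith
  let ?D = "(1 + zm * exp V / a0 * L) * S" and ?X = "zm * exp V * S / a0"
  have D: "0 \<le> ?D" "0 \<le> ?X" using zm_pos a0_pos L_pos S by simp_all
  have time: "\<exists>\<phi>t. \<forall>t\<in>{0..T}. \<forall>x\<in>{0..L}.
      ((\<lambda>\<tau>. disp (e 0) (e 1) \<tau> x) has_real_derivative \<phi>t t x) (at t within {0..T}) \<and>
      ((\<lambda>\<tau>. \<phi>t \<tau> x) has_real_derivative disp (e 2) (e 3) t x) (at t within {0..T})"
  proof (intro exI[of _ "disp (e 1) (e 2)"] ballI conjI)
    fix t x assume x: "x \<in> {0..L}"
    have "((\<lambda>\<tau>. disp (e 0) (e 1) \<tau> x) has_real_derivative disp (e 1) (e 2) t x) (at t)"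
      by (rule disp_time_derivative[OF d0 d1 d2 d3 b(2) b(3) b(4)]) (use x in auto)
    then show "((\<lambda>\<tau>. disp (e 0) (e 1) \<tau> x) has_real_derivative disp (e 1) (e 2) t x) (at t within {0..T})"
      by (rule has_field_derivative_at_within)
    have "((\<lambda>\<tau>. disp (e 1) (e 2) \<tau> x) has_real_derivative disp (e 2) (e 3) t x) (at t)"
      by (rule disp_time_derivative[OF d1 d2 d3 d4 b(3) b(4) b(5)]) (use x in auto)
    then show "((\<lambda>\<tau>. disp (e 1) (e 2) \<tau> x) has_real_derivative disp (e 2) (e 3) t x) (at t within {0..T})"
      by (rule has_field_derivative_at_within)
  qed
  have cont: "continuous_on ({0..T} \<times> {0..L}) (\<lambda>(t, x). disp (e 2) (e 3) t x)"
  proof (rule lipschitz_on_continuous_on[OF lipschitz_onI])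
    fix p q assume "p \<in> {0..T} \<times> {0..L}" "q \<in> {0..T} \<times> {0..L}"
    then obtain t x t' x' where pq: "p = (t, x)" "q = (t', x')" "x \<in> {0..L}" "x' \<in> {0..L}" by auto
    have "\<bar>disp (e 2) (e 3) t x - disp (e 2) (e 3) t' x\<bar> \<le> ?D * \<bar>t - t'\<bar>"
    proof (rule lipschitz_of_bounded_derivative[where f = "\<lambda>t. disp (e 2) (e 3) t x"
          and f' = "\<lambda>t. disp (e 3) (e 4) t x"])
      show "((\<lambda>t. disp (e 2) (e 3) t x) has_real_derivative disp (e 3) (e 4) t x) (at t)" for t
        by (rule disp_time_derivative[OF d2 d3 d4 d5 b(4) b(5) b(6)]) (use pq in auto)
      show "\<bar>disp (e 3) (e 4) t x\<bar> \<le> ?D" for t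
        by (rule disp_bound[OF d4 b(4) b(5)]) (use pq in auto)
    qed
    also have "\<dots> \<le> ?D * dist p q"
      using D dist_fst_le[of p q] pq by (intro mult_left_mono) (auto simp: dist_real_def)
    finally have 1: "\<bar>disp (e 2) (e 3) t x - disp (e 2) (e 3) t' x\<bar> \<le> ?D * dist p q" .
    have "\<bar>disp (e 2) (e 3) t' x - disp (e 2) (e 3) t' x'\<bar> \<le> ?X * \<bar>x - x'\<bar>"
      by (rule disp_lipschitz_space[OF d3 b(4)]) (use pq in auto)
    also have "\<dots> \<le> ?X * dist p q"
      using D dist_snd_le[of p q] pq by (intro mult_left_mono) (auto simp: dist_real_def)
    finally have "\<bar>disp (e 2) (e 3) t x - disp (e 2) (e 3) t' x'\<bar> \<le> (?D + ?X) * dist p q"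
      using 1 by (simp only: distrib_right)
    then show "dist (case p of (t, x) \<Rightarrow> disp (e 2) (e 3) t x) (case q of (t, x) \<Rightarrow> disp (e 2) (e 3) t x)
        \<le> (?D + ?X) * dist p q"
      by (simp add: pq(1,2) dist_real_def)
  qed (use D in auto)
  \<comment> \<open>Signals from \<open>x = L\<close> advance by at most \<open>B L\<close> in time,
    so the strict inequality \<open>B * L < t0\<close> leaves an interval of quiet.\<close>
  have vanish: "\<exists>\<epsilon>>0. \<forall>t\<in>{0..T}. \<forall>x\<in>{0..L}. t < \<epsilon> \<longrightarrow> disp (e 0) (e 1) t x = 0"
  proof (intro exI[of _ "t0 - B * L"] conjI ballI impI)
    fix t x assume "x \<in> {0..L}" "t < t0 - B * L"
    then show "disp (e 0) (e 1) t x = 0" by (intro disp_support[OF supp supp]) auto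
  qed (use t0 in simp)
  have contL2: "continuous_L2 T {0<..<L} (flux_deriv (e 1) (e 2))"
  proof -
    let ?R = "(1 / h + B) * (zm * exp V * S)"
    have meas: "flux_deriv (e 1) (e 2) t \<in> borel_measurable (lebesgue_on {0<..<L})" for t
      by (rule measurable_restrict_mono[OF flux_deriv_measurable[OF d1]]) auto
    have "L2_norm {0<..<L} (\<lambda>x. flux_deriv (e 1) (e 2) \<tau> x - flux_deriv (e 1) (e 2) t x)
        \<le> (?R * \<bar>\<tau> - t\<bar>) * sqrt L" for \<tau> t
    proof (rule L2_norm_le_bound)
      show "(\<lambda>x. flux_deriv (e 1) (e 2) \<tau> x - flux_deriv (e 1) (e 2) t x) \<in> borel_measurable (lebesgue_on {0<..<L})"
        using meas by measurable
      fix x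
      have "((\<lambda>t. flux_deriv (e 1) (e 2) t x) has_real_derivative flux_deriv (e 2) (e 3) t x) (at t)" for t
        using field_time_derivative(1)[OF d2] field_time_derivative(2)[OF d1] h_pos
        by (cases "x < h") (auto simp: flux_deriv_def intro!: derivative_eq_intros)
      then show "\<bar>flux_deriv (e 1) (e 2) \<tau> x - flux_deriv (e 1) (e 2) t x\<bar> \<le> ?R * \<bar>\<tau> - t\<bar>"
        using flux_deriv_bound[OF b(3) b(4)] by (rule lipschitz_of_bounded_derivative)
    qed (use L_pos in simp)
    note le = this
    have "((\<lambda>\<tau>. L2_norm {0<..<L} (\<lambda>x. flux_deriv (e 1) (e 2) \<tau> x - flux_deriv (e 1) (e 2) t x)) \<longlongrightarrow> 0)
        (at t within {0..T})" for t
    proof (rule Lim_null_comparison)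
      show "\<forall>\<^sub>F \<tau> in at t within {0..T}. norm (L2_norm {0<..<L}
          (\<lambda>x. flux_deriv (e 1) (e 2) \<tau> x - flux_deriv (e 1) (e 2) t x)) \<le> ?R * \<bar>\<tau> - t\<bar> * sqrt L"
        using le by (intro always_eventually allI) simp
      have "((\<lambda>\<tau>. ?R * \<bar>\<tau> - t\<bar> * sqrt L) \<longlongrightarrow> ?R * \<bar>t - t\<bar> * sqrt L) (at t within {0..T})"
        by (intro tendsto_intros)
      then show "((\<lambda>\<tau>. ?R * \<bar>\<tau> - t\<bar> * sqrt L) \<longlongrightarrow> 0) (at t within {0..T})" by simp
    qed
    moreover have "L2_on {0<..<L} (flux_deriv (e 1) (e 2) t)" for t
      using meas flux_deriv_bound[OF b(2) b(3)] by (rule L2_on_bounded)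
    ultimately show ?thesis unfolding continuous_L2_def by blast
  qed
  have "\<exists>q. \<forall>t\<in>{0..T}.
      (\<forall>x\<in>{0..L}. q t x = (\<integral>y. flux_deriv (e 1) (e 2) t y \<partial>lebesgue_on {0..x})) \<and>
      (\<forall>x\<in>{0..L}. disp (e 0) (e 1) t x = disp (e 0) (e 1) t 0 + (\<integral>y. q t y / a y \<partial>lebesgue_on {0..x})) \<and>
      q t L = 0"
  proof (intro exI[of _ "flux (e 1)"] ballI conjI)
    fix t x assume x: "x \<in> {0..L}"
    show "flux (e 1) t x = (\<integral>y. flux_deriv (e 1) (e 2) t y \<partial>lebesgue_on {0..x})"
      by (rule flux_eq_integral[OF d1 b(2) b(3)]) (use x in auto)
    show "disp (e 0) (e 1) t x = disp (e 0) (e 1) t 0 + (\<integral>y. flux (e 1) t y / a y \<partial>lebesgue_on {0..x})"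
      by (rule disp_eq_integral[OF d1 b(2)]) (use x in auto)
  qed (rule flux_at_L)
  with time cont vanish contL2 show ?thesis unfolding wave_test_def by (intro conjI)
qed

section \<open>Energy and consistency estimates\<close>

lemma flux_energy:
  assumes f: "f \<in> borel_measurable borel" "integrable lborel (\<lambda>t. (f t)\<^sup>2)"
  shows "fw (N * h) f \<in> borel_measurable borel"
    and "integrable lborel (\<lambda>t. (fw (N * h) f t)\<^sup>2)"
    and "(\<integral>t. (fw (N * h) f t)\<^sup>2 \<partial>lborel) \<le> zm\<^sup>2 * exp V * (\<integral>t. (f t)\<^sup>2 \<partial>lborel)"
proof -
  note en = iface_energy[OF f, of N]
  let ?E = "energy (z N) (ip N f) (iw N f)" and ?I = "\<integral>t. (f t)\<^sup>2 \<partial>lborel"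
  show meas [measurable]: "fw (N * h) f \<in> borel_measurable borel"
    using en by (simp add: field_at_interface)
  have le: "(fw (N * h) f t)\<^sup>2 \<le> z N * ?E t" for t
    unfolding field_at_interface energy_def using z_pos[of N] by (simp add: algebra_simps)
  show int: "integrable lborel (\<lambda>t. (fw (N * h) f t)\<^sup>2)"
  proof (rule Bochner_Integration.integrable_bound)
    show "integrable lborel (\<lambda>t. z N * ?E t)" using en by simp
    show "AE t in lborel. norm ((fw (N * h) f t)\<^sup>2) \<le> norm (z N * ?E t)"
      using order_trans[OF le abs_ge_self] by (intro AE_I2) simp
  qed measurable
  have "(\<integral>t. (fw (N * h) f t)\<^sup>2 \<partial>lborel) \<le> (\<integral>t. z N * ?E t \<partial>lborel)"
    using int en le by (intro integral_mono) auto
  also have "\<dots> = z N * (\<integral>t. ?E t \<partial>lborel)" by simp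
  \<comment> \<open>One factor \<open>zm\<close> comes from recovering \<open>w\<^sup>2\<close> from
    the energy, the other from the initial energy \<open>z 0\<close> times the squared norm of the
    datum.\<close>
  also have "\<dots> \<le> zm * (exp V * (zm * ?I))"
  proof (intro mult_mono)
    have "(\<integral>t. ?E t \<partial>lborel) \<le> exp (m N - m 0) * (z 0 * ?I)" using en by blast
    also have "\<dots> \<le> exp V * (zm * ?I)"
      using m_le z_le zm_pos z_pos[of 0] by (intro mult_mono) auto
    finally show "(\<integral>t. ?E t \<partial>lborel) \<le> exp V * (zm * ?I)" .
  qed (use z_le zm_pos energy_nonneg z_pos in auto)
  finally show "(\<integral>t. (fw (N * h) f t)\<^sup>2 \<partial>lborel) \<le> zm\<^sup>2 * exp V * ?I"
    by (simp add: power2_eq_square mult_ac)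
qed

text \<open>For \<open>x \<ge> h\<close> the flux is not interpolated, so \<open>disp\<close> and
  \<open>fp\<close> integrate the same flux, once with the true \<open>1 / a\<close> and once with
  its layered value. Their difference is at most the sup norm of the flux times the integral of
  \<open>c * \<omega>\<close>, where \<omega> majorizes the local oscillation of the
  coefficients.\<close>

lemma disp_near_field:
  assumes d: "\<And>t. (f has_real_derivative f1 t) (at t)" "\<And>t. (f1 has_real_derivative f2 t) (at t)"
    and bd: "\<And>t. \<bar>f1 t\<bar> \<le> S"
    and \<omega>: "integrable (lebesgue_on {0..L}) \<omega>" "\<And>x. 0 \<le> \<omega> x" "\<And>x. \<omega> x \<le> W"
    and near: "AE x in lebesgue_on {0..L}. \<bar>b (layer (L - x)) / z (layer (L - x)) - 1 / a x\<bar> \<le> c * \<omega> x"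
    and x: "h \<le> x" "x \<le> L" and c: "0 \<le> c"
  shows "\<bar>disp f f1 t x - fp (L - x) f t\<bar> \<le> zm * exp V * S * c * (\<integral>x. \<omega> x \<partial>lebesgue_on {0..L})"
proof -
  let ?M = "lebesgue_on {x..L}" and ?q = "\<lambda>y. b (layer (L - y)) / z (layer (L - y))"
    and ?F = "\<lambda>y. fw (L - y) f1 t" and ?K = "zm * exp V * S"
  have x0: "0 \<le> x" using x h_pos by simp
  have K: "0 \<le> ?K" using zm_pos order_trans[OF abs_ge_zero bd[of 0]] by simp
  have sub: "AE y in ?M. P y" if "AE y in lebesgue_on {0..L}. P y" for P
    by (rule AE_lebesgue_on_subset[OF that]) (use x0 in auto)
  have near': "AE y in ?M. \<bar>?q y - 1 / a y\<bar> \<le> c * \<omega> y" and age: "AE y in ?M. a0 \<le> a y"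
    using sub[OF near] sub[OF a_ge] by auto
  have F: "\<bar>?F y\<bar> \<le> ?K" for y by (rule field_bounds(2)[OF bd])
  have hi: "((\<lambda>y. ?q y * ?F y) has_integral f t - fp (L - x) f t) {x..L}"
    by (rule field_has_integral[OF d(1) x0 x(2)])
  have qF: "integrable ?M (\<lambda>y. ?q y * ?F y)"
  proof (rule integrable_lebesgue_on_bounded)
    show "(\<lambda>y. ?q y * ?F y) \<in> borel_measurable ?M"
      by (rule integrable_imp_measurable[OF has_integral_integrable[OF hi]])
    \<comment> \<open>The layered value is bounded because it is within \<open>c * W\<close> of
      \<open>1 / a\<close>, which is at most \<open>1 / a0\<close>.\<close>
    show "AE y in ?M. \<bar>?q y * ?F y\<bar> \<le> (1 / a0 + c * W) * ?K"
      using near' age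
    proof eventually_elim
      case (elim y)
      have "1 / a y \<le> 1 / a0" using elim a0_pos by (intro divide_left_mono) auto
      moreover have "0 \<le> 1 / a y" using elim a0_pos by simp
      moreover have "c * \<omega> y \<le> c * W" using \<omega>(3) c by (rule mult_left_mono)
      ultimately have q: "\<bar>?q y\<bar> \<le> 1 / a0 + c * W" using elim by linarith
      show ?case
        unfolding abs_mult by (rule mult_mono[OF q F order_trans[OF abs_ge_zero q] abs_ge_zero])
    qed
  qed
  have Fa: "integrable ?M (\<lambda>y. flux f1 t y / a y)"
    by (rule flux_div_a(1)[OF d(2) bd x0 x(2) order_refl])
  have flux: "flux f1 t y = ?F y" if "y \<in> {x..L}" for y using that x by (simp add: flux_def)
  let ?G = "\<lambda>y. ?q y * ?F y - flux f1 t y / a y"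
  have "disp f f1 t x - fp (L - x) f t
      = (\<integral>y. ?q y * ?F y \<partial>?M) - (\<integral>y. flux f1 t y / a y \<partial>?M)"
    using integral_unique[OF hi] lebesgue_integral_eq_integral[OF qF] unfolding disp_def by simp
  also have "\<dots> = (\<integral>y. ?G y \<partial>?M)"
    using qF Fa by simp
  finally have "\<bar>disp f f1 t x - fp (L - x) f t\<bar> \<le> (\<integral>y. \<bar>?G y\<bar> \<partial>?M)"
    using integral_abs_bound[of ?M ?G] by simp
  also have "\<dots> \<le> (\<integral>y. ?K * c * \<omega> y \<partial>?M)"
  proof (rule integral_mono_AE)
    show "integrable ?M (\<lambda>y. \<bar>?q y * ?F y - flux f1 t y / a y\<bar>)"
      by (rule integrable_abs[OF Bochner_Integration.integrable_diff[OF qF Fa]])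
    have "integrable ?M \<omega>" by (rule integrable_subinterval[OF \<omega>(1)]) (use x0 in auto)
    then show "integrable ?M (\<lambda>y. ?K * c * \<omega> y)" by simp
    have "AE y in ?M. y \<in> {x..L}" by (intro AE_I2) (simp add: space_restrict_space)
    with near' show "AE y in ?M. \<bar>?q y * ?F y - flux f1 t y / a y\<bar> \<le> ?K * c * \<omega> y"
    proof eventually_elim
      case (elim y)
      have "?q y * ?F y - flux f1 t y / a y = ?F y * (?q y - 1 / a y)"
        unfolding flux[OF elim(2)] by (simp add: algebra_simps)
      then have "\<bar>?q y * ?F y - flux f1 t y / a y\<bar> = \<bar>?F y\<bar> * \<bar>?q y - 1 / a y\<bar>"
        by (simp only: abs_mult)
      also have "\<dots> \<le> ?K * (c * \<omega> y)" using F[of y] elim(1) K by (intro mult_mono) auto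
      finally show ?case by (simp only: mult.assoc)
    qed
  qed
  also have "\<dots> = ?K * c * (\<integral>y. \<omega> y \<partial>?M)" by simp
  also have "\<dots> \<le> ?K * c * (\<integral>y. \<omega> y \<partial>lebesgue_on {0..L})"
  proof (rule mult_left_mono)
    have "0 \<le> (\<integral>y. \<omega> y \<partial>lebesgue_on {0..x})" using \<omega>(2) by simp
    then show "(\<integral>y. \<omega> y \<partial>?M) \<le> (\<integral>y. \<omega> y \<partial>lebesgue_on {0..L})"
      using integral_lebesgue_on_combine[OF \<omega>(1) x0 x(2)] by linarith
  qed (use K c in auto)
  finally show ?thesis .
qed

lemma disp_continuous_space:
  assumes "\<And>t. (f' has_real_derivative f'' t) (at t)" "\<And>t. \<bar>f' t\<bar> \<le> S"
  shows "continuous_on {0..L} (disp f f' t)"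
proof (rule lipschitz_on_continuous_on[OF lipschitz_onI])
  show "0 \<le> zm * exp V * S / a0" using zm_pos a0_pos order_trans[OF abs_ge_zero assms(2)[of 0]] by simp
qed (use disp_lipschitz_space[OF assms] in \<open>simp add: dist_real_def\<close>)

text \<open>The defect in the wave equation, without the flux derivative in the layer next to
  \<open>x = 0\<close>. That term carries the factor \<open>1 / h\<close> and is not small; it is
  set aside to produce the trace.\<close>

definition residual :: "(real \<Rightarrow> real) \<Rightarrow> (nat \<Rightarrow> real \<Rightarrow> real) \<Rightarrow> real \<Rightarrow> real \<Rightarrow> real" where
  "residual \<rho> e t x = \<rho> x * disp (e 2) (e 3) t x - (if x < h then 0 else flux_deriv (e 1) (e 2) t x)"

text \<open>Three errors are added. Near \<open>x = 0\<close> the defect is bounded on a set of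
  measure \<open>h\<close>. The mismatch of \<rho> is at most \<open>D * \<omega>\<close>, and
  \<open>\<omega>\<^sup>2 \<le> W * \<omega>\<close> has an integral of order \<open>h\<close>.
  Replacing the layered field by the displacement costs \<open>M * h\<close> pointwise. Each squared
  norm is of order \<open>h\<close>.\<close>

lemma residual_L2:
  assumes e: "\<And>n t. (e n has_real_derivative e (Suc n) t) (at t)"
    and bd: "\<And>n t. n \<le> 5 \<Longrightarrow> \<bar>e n t\<bar> \<le> S"
    and \<rho>: "\<rho> \<in> borel_measurable (lebesgue_on {0..L})" "AE x in lebesgue_on {0..L}. \<bar>\<rho> x\<bar> \<le> \<rho>1"
    and \<omega>: "integrable (lebesgue_on {0..L}) \<omega>" "\<And>x. 0 \<le> \<omega> x" "\<And>x. \<omega> x \<le> W"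
      "(\<integral>x. \<omega> x \<partial>lebesgue_on {0..L}) \<le> 2 * h * W"
    and near_a: "AE x in lebesgue_on {0..L}. \<bar>b (layer (L - x)) / z (layer (L - x)) - 1 / a x\<bar> \<le> c * \<omega> x"
    and near_\<rho>: "AE x in lebesgue_on {0..L}. \<bar>b (layer (L - x)) * z (layer (L - x)) - \<rho> x\<bar> \<le> \<omega> x"
    and c: "0 \<le> c"
    and D: "D = (1 + zm * exp V / a0 * L) * S" and M: "M = B * zm * (zm * exp V * S * c * (2 * W))"
  shows "L2_on {0<..<L} (residual \<rho> e t)"
    and "L2_norm {0<..<L} (residual \<rho> e t) \<le> sqrt (3 * ((\<rho>1 * D)\<^sup>2 + D\<^sup>2 * (2 * W\<^sup>2) + (M * L)\<^sup>2)) * sqrt h"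
proof -
  have d1: "\<And>t. (e 1 has_real_derivative e 2 t) (at t)" and d2: "\<And>t. (e 2 has_real_derivative e 3 t) (at t)"
    and d3: "\<And>t. (e 3 has_real_derivative e 4 t) (at t)"
    using e[of 1] e[of 2] e[of 3] by (simp_all add: numeral_eq_Suc)
  have bs: "\<And>t. \<bar>e 2 t\<bar> \<le> S" "\<And>t. \<bar>e 3 t\<bar> \<le> S" by (rule bd; simp)+
  have S: "0 \<le> S" using order_trans[OF abs_ge_zero bs(1)[of 0]] .
  have W: "0 \<le> W" using \<omega>(2,3)[of 0] by linarith
  have D0: "0 \<le> D" unfolding D using S zm_pos a0_pos L_pos by simp
  have M0: "0 \<le> M" unfolding M using S zm_pos W c B_nonneg by simp
  let ?N = "lebesgue_on {0..L}" and ?R = "residual \<rho> e t"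
  let ?g = "\<lambda>x. 3 * ((\<rho>1 * D)\<^sup>2 * indicator {0..h} x + D\<^sup>2 * W * \<omega> x + (M * h)\<^sup>2)"
  have dispD: "\<bar>disp (e 2) (e 3) t x\<bar> \<le> D" if "x \<in> {0..L}" for x
    unfolding D by (rule disp_bound[OF d3 bs]) (use that in auto)
  have bound: "\<bar>?R x\<bar> \<le> \<rho>1 * D * indicator {0..h} x + D * \<omega> x + M * h"
    if x: "x \<in> {0..L}" and r: "\<bar>\<rho> x\<bar> \<le> \<rho>1"
      and nr: "\<bar>b (layer (L - x)) * z (layer (L - x)) - \<rho> x\<bar> \<le> \<omega> x" for x
  proof (cases "x < h")
    case True
    then have "\<bar>?R x\<bar> = \<bar>\<rho> x\<bar> * \<bar>disp (e 2) (e 3) t x\<bar>" by (simp add: residual_def abs_mult)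
    also have "\<dots> \<le> \<rho>1 * D" using r dispD[OF x] by (intro mult_mono) auto
    finally show ?thesis using True x \<omega>(2)[of x] D0 M0 h_pos by (simp add: add_increasing2)
  next
    case False
    let ?k = "layer (L - x)"
    let ?d = "disp (e 2) (e 3) t x" and ?p = "fp (L - x) (e 2) t"
    \<comment> \<open>The layered fields solve the layered equation exactly, so the flux derivative
      is \<open>b z\<close> times \<open>?p\<close>. The defect splits into the error of \<rho> and
      the error of the displacement.\<close>
    have eq: "?R x = - ((b ?k * z ?k - \<rho> x) * ?d) + b ?k * z ?k * (?d - ?p)"
      using False by (simp add: residual_def flux_deriv_def algebra_simps)
    have "\<bar>?R x\<bar> \<le> \<bar>b ?k * z ?k - \<rho> x\<bar> * \<bar>?d\<bar> + \<bar>b ?k * z ?k\<bar> * \<bar>?d - ?p\<bar>"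
      unfolding eq by (rule order_trans[OF abs_triangle_ineq]) (simp add: abs_mult)
    also have "\<dots> \<le> \<omega> x * D + B * zm * (zm * exp V * S * c * (2 * h * W))"
    proof (intro add_mono mult_mono)
      have "\<bar>?d - ?p\<bar> \<le> zm * exp V * S * c * (\<integral>x. \<omega> x \<partial>lebesgue_on {0..L})"
        by (rule disp_near_field[OF d2 d3 bs(2) \<omega>(1-3) near_a _ _ c]) (use False x in auto)
      also have "\<dots> \<le> zm * exp V * S * c * (2 * h * W)"
        using \<omega>(4) zm_pos S c by (intro mult_left_mono) auto
      finally show "\<bar>?d - ?p\<bar> \<le> zm * exp V * S * c * (2 * h * W)" .
      show "\<bar>b ?k * z ?k\<bar> \<le> B * zm"
        using b_nonneg[of ?k] z_pos[of ?k] b_le[of ?k] z_le[of ?k] B_nonneg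
        by (simp add: abs_mult mult_mono)
    qed (use nr dispD[OF x] \<omega>(2)[of x] B_nonneg zm_pos in auto)
    also have "\<dots> = D * \<omega> x + M * h" by (simp add: M)
    finally have le: "\<bar>?R x\<bar> \<le> D * \<omega> x + M * h" .
    have "0 \<le> \<rho>1 * D * indicator {0..h} x" using r D0 by simp
    with le show ?thesis by linarith
  qed
  have ae: "AE x in ?N. (?R x)\<^sup>2 \<le> ?g x"
  proof -
    have "AE x in ?N. x \<in> {0..L}" by (intro AE_I2) (simp add: space_restrict_space)
    with \<rho>(2) near_\<rho> show ?thesis
    proof eventually_elim
      case (elim x)
      let ?u = "\<rho>1 * D * indicator {0..h} x" and ?v = "D * \<omega> x" and ?w = "M * h"
      have "(?R x)\<^sup>2 \<le> (?u + ?v + ?w)\<^sup>2"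
        using power_mono[OF bound[OF elim(3,1,2)], of 2] by simp
      also have "\<dots> \<le> 3 * (?u\<^sup>2 + ?v\<^sup>2 + ?w\<^sup>2)"
        using zero_le_power2[of "?u - ?v"] zero_le_power2[of "?u - ?w"] zero_le_power2[of "?v - ?w"]
        by (simp add: power2_sum power2_diff algebra_simps)
      also have "\<dots> \<le> ?g x"
      proof -
        have "?u\<^sup>2 = (\<rho>1 * D)\<^sup>2 * indicator {0..h} x" by (simp add: indicator_def)
        moreover have "(\<omega> x)\<^sup>2 \<le> W * \<omega> x"
          unfolding power2_eq_square using \<omega>(2,3)[of x] by (intro mult_right_mono) auto
        then have "?v\<^sup>2 \<le> D\<^sup>2 * W * \<omega> x"
          by (simp add: power_mult_distrib mult.assoc mult_left_mono)
        ultimately show ?thesis by simp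
      qed
      finally show ?case .
    qed
  qed
  interpret finite_measure ?N by (rule finite_measure_lebesgue_on) auto
  have ind: "integrable ?N (indicator {0..h} :: real \<Rightarrow> real)" "(\<integral>x. indicator {0..h} x \<partial>?N) = h"
  proof -
    have "{0..h} \<inter> {0..L} = {0..h}" using h_le_L by auto
    then show "integrable ?N (indicator {0..h} :: real \<Rightarrow> real)" "(\<integral>x. indicator {0..h} x \<partial>?N) = h"
      using h_pos by (simp_all add: integrable_indicator_iff sets_restrict_space_iff
          emeasure_restrict_space measure_restrict_space space_restrict_space less_top[symmetric])
  qed
  have gint: "integrable ?N ?g" using ind(1) \<omega>(1) by simp
  have meas: "?R \<in> borel_measurable ?N"
  proof -
    have 1: "disp (e 2) (e 3) t \<in> borel_measurable ?N"
      by (rule continuous_imp_borel_measurable_lebesgue_on[OF disp_continuous_space[OF d3 bs(2)]])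
    have 2: "flux_deriv (e 1) (e 2) t \<in> borel_measurable ?N" by (rule flux_deriv_measurable[OF d1])
    have 3: "(\<lambda>x. indicator {..<h} x :: real) \<in> borel_measurable ?N"
      by (auto intro!: measurable_restrict_space1 measurable_completion)
    have "?R = (\<lambda>x. \<rho> x * disp (e 2) (e 3) t x - (1 - indicator {..<h} x) * flux_deriv (e 1) (e 2) t x)"
      by (auto simp: residual_def fun_eq_iff)
    then show ?thesis using 1 2 3 \<rho>(1) by simp
  qed
  have Rint: "integrable ?N (\<lambda>x. (?R x)\<^sup>2)"
    by (rule Bochner_Integration.integrable_bound[OF gint]) (use meas ae in \<open>auto elim: eventually_mono\<close>)
  have "(\<integral>x. (?R x)\<^sup>2 \<partial>?N) \<le> (\<integral>x. ?g x \<partial>?N)"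
    by (rule integral_mono_AE[OF Rint gint ae])
  also have "\<dots> = 3 * ((\<rho>1 * D)\<^sup>2 * h + D\<^sup>2 * W * (\<integral>x. \<omega> x \<partial>?N) + (M * h)\<^sup>2 * L)"
    using ind \<omega>(1) L_pos by (simp add: measure_restrict_space)
  also have "\<dots> \<le> 3 * ((\<rho>1 * D)\<^sup>2 * h + D\<^sup>2 * W * (2 * h * W) + (M * L)\<^sup>2 * h)"
  proof (intro mult_left_mono add_mono order_refl)
    have "h\<^sup>2 * L \<le> L\<^sup>2 * h" using h_le_L h_pos L_pos by (simp add: power2_eq_square)
    then show "(M * h)\<^sup>2 * L \<le> (M * L)\<^sup>2 * h"
      by (simp add: power_mult_distrib mult.assoc mult_left_mono)
  qed (use \<omega>(4) W in auto)
  also have "\<dots> = 3 * ((\<rho>1 * D)\<^sup>2 + D\<^sup>2 * (2 * W\<^sup>2) + (M * L)\<^sup>2) * h"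
    by (simp add: algebra_simps power2_eq_square)
  finally have le: "(\<integral>x. (?R x)\<^sup>2 \<partial>?N) \<le> 3 * ((\<rho>1 * D)\<^sup>2 + D\<^sup>2 * (2 * W\<^sup>2) + (M * L)\<^sup>2) * h" .
  have "?R \<in> borel_measurable (lebesgue_on {0<..<L})"
    by (rule measurable_restrict_mono[OF meas]) auto
  then show "L2_on {0<..<L} ?R"
    unfolding L2_on_def using Rint by (simp add: integrable_Ioo_iff_Icc)
  have "L2_norm {0<..<L} ?R = sqrt (\<integral>x. (?R x)\<^sup>2 \<partial>?N)"
    unfolding L2_norm_def by (simp add: integral_Ioo_eq_Icc)
  also have "\<dots> \<le> sqrt (3 * ((\<rho>1 * D)\<^sup>2 + D\<^sup>2 * (2 * W\<^sup>2) + (M * L)\<^sup>2) * h)"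
    using le by (rule real_sqrt_le_mono)
  finally show "L2_norm {0<..<L} ?R \<le> sqrt (3 * ((\<rho>1 * D)\<^sup>2 + D\<^sup>2 * (2 * W\<^sup>2) + (M * L)\<^sup>2)) * sqrt h"
    by (simp only: real_sqrt_mult)
qed

end

subsection \<open>Sampling a medium of bounded variation\<close>

text \<open>Translating the two terms makes their integrals cancel on the common part of the shifted
  intervals. What remains on the right is an interval of length \<open>2 h\<close>, where
  \<open>v\<close> is at most \<open>W\<close>; the remainder on the left has a favourable sign
  because \<open>v \<ge> 0\<close>.\<close>

lemma oscillation_integral:
  fixes v :: "real \<Rightarrow> real"
  assumes mono: "mono v" and v: "\<And>x. 0 \<le> v x" "\<And>x. v x \<le> W" and h: "0 \<le> h"
  shows "integrable (lebesgue_on {0..L}) (\<lambda>x. v (x + h) - v (x - h))"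
    and "(\<integral>x. v (x + h) - v (x - h) \<partial>lebesgue_on {0..L}) \<le> 2 * h * W"
proof -
  have W: "0 \<le> W" using v[of 0] by linarith
  have vm [measurable]: "v \<in> borel_measurable borel" by (rule borel_measurable_mono[OF mono])
  have sets: "{0..L} \<inter> space lebesgue \<in> sets lebesgue" by simp
  have Iint: "integrable lborel (\<lambda>x. indicator {c..d} x * v x)" for c d :: real
  proof (rule Bochner_Integration.integrable_bound)
    show "integrable lborel (\<lambda>x. W * indicator {c..d} x)"
      by (intro integrable_mult_right integrable_real_indicator) (auto simp: emeasure_lborel_Icc_eq)
    show "AE x in lborel. norm (indicator {c..d} x * v x) \<le> norm (W * indicator {c..d} x)"
      using v W by (intro AE_I2) (auto simp: indicator_def)
  qed measurable
  let ?u = "\<lambda>x. indicator {h..L + h} x * v x" and ?w = "\<lambda>x. indicator {- h..L - h} x * v x"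
  have eq: "indicator {0..L} x *\<^sub>R (v (x + h) - v (x - h)) = ?u (x + h) - ?w (x + (- h))" for x :: real
    by (auto simp: indicator_def)
  have int: "integrable lborel (\<lambda>x. indicator {0..L} x *\<^sub>R (v (x + h) - v (x - h)))"
    unfolding eq
    by (rule Bochner_Integration.integrable_diff) (rule integral_shift_lborel(1)[OF Iint])+
  show "integrable (lebesgue_on {0..L}) (\<lambda>x. v (x + h) - v (x - h))"
    using integrable_completion int by (auto simp: integrable_restrict_space[OF sets])
  have "(\<integral>x. v (x + h) - v (x - h) \<partial>lebesgue_on {0..L})
      = (\<integral>x. indicator {0..L} x *\<^sub>R (v (x + h) - v (x - h)) \<partial>lborel)"
    unfolding integral_restrict_space[OF sets] using int by (intro integral_completion) auto
  also have "\<dots> = (\<integral>x. ?u (x + h) \<partial>lborel) - (\<integral>x. ?w (x + (- h)) \<partial>lborel)"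
    unfolding eq
    by (rule Bochner_Integration.integral_diff) (rule integral_shift_lborel(1)[OF Iint])+
  also have "\<dots> = (\<integral>x. ?u x \<partial>lborel) - (\<integral>x. ?w x \<partial>lborel)"
    unfolding integral_shift_lborel(2)[OF Iint] ..
  also have "\<dots> = (\<integral>x. ?u x - ?w x \<partial>lborel)"
    by (rule Bochner_Integration.integral_diff[symmetric]) (rule Iint)+
  also have "\<dots> \<le> (\<integral>x. W * indicator {L - h..L + h} x \<partial>lborel)"
  proof (rule integral_mono)
    show "integrable lborel (\<lambda>x. ?u x - ?w x)"
      by (rule Bochner_Integration.integrable_diff) (rule Iint)+
    show "integrable lborel (\<lambda>x. W * indicator {L - h..L + h} x)"
      by (intro integrable_mult_right integrable_real_indicator) (auto simp: emeasure_lborel_Icc_eq)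
    show "?u x - ?w x \<le> W * indicator {L - h..L + h} x" for x
      using v[of x] W h by (auto simp: indicator_def)
  qed
  also have "\<dots> = 2 * h * W" using h by simp
  finally show "(\<integral>x. v (x + h) - v (x - h) \<partial>lebesgue_on {0..L}) \<le> 2 * h * W" .
qed

lemma abs_ln_diff_le:
  fixes p q c :: real
  assumes "0 < c" "c \<le> p" "c \<le> q"
  shows "\<bar>ln p - ln q\<bar> \<le> \<bar>p - q\<bar> / c"
proof -
  have *: "ln x - ln y \<le> \<bar>x - y\<bar> / c" if "c \<le> x" "c \<le> y" for x y
  proof -
    have "ln x - ln y \<le> (x - y) / y" using that assms(1) by (intro ln_diff_le) auto
    also have "\<dots> \<le> \<bar>x - y\<bar> / y" using that assms(1) by (intro divide_right_mono) auto
    also have "\<dots> \<le> \<bar>x - y\<bar> / c" using that assms(1) by (intro divide_left_mono) auto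
    finally show ?thesis .
  qed
  show ?thesis using *[OF assms(2,3)] *[OF assms(3,2)] by (simp add: abs_le_iff abs_minus_commute)
qed

text \<open>The set \<open>G\<close> has full measure, and on it the almost everywhere hypotheses
  hold pointwise, so coefficients may be sampled there. A single \<open>v\<close> dominates the
  variation of both coefficients; it is monotone and bounded on the whole line so that
  \<open>v (x + h)\<close> and \<open>v (x - h)\<close> make sense near the end points.\<close>

locale bv_medium =
  fixes L \<rho>0 \<rho>1 a0 a1 \<beta> W :: real and \<rho> a v :: "real \<Rightarrow> real" and G :: "real set"
  assumes L_pos: "0 < L" and pos: "0 < \<rho>0" "0 < a0"
    and G_sub: "G \<subseteq> {0<..<L}" and G_full: "AE x in lebesgue_on {0..L}. x \<in> G"
    and \<rho>_meas: "\<rho> \<in> borel_measurable (lebesgue_on {0..L})"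
    and a_meas: "a \<in> borel_measurable (lebesgue_on {0..L})"
    and \<rho>_bounds: "\<And>x. x \<in> G \<Longrightarrow> \<rho>0 \<le> \<rho> x \<and> \<rho> x \<le> \<rho>1"
    and a_bounds: "\<And>x. x \<in> G \<Longrightarrow> a0 \<le> a x \<and> a x \<le> a1"
    and slowness: "\<And>x. x \<in> G \<Longrightarrow> sqrt (\<rho> x / a x) \<le> \<beta>"
    and v_mono: "mono v" and v_bounds: "\<And>x. 0 \<le> v x" "\<And>x. v x \<le> W"
    and \<rho>_var: "\<And>x y. x \<in> G \<Longrightarrow> y \<in> G \<Longrightarrow> x \<le> y \<Longrightarrow> \<bar>\<rho> y - \<rho> x\<bar> \<le> v y - v x"
    and a_var: "\<And>x y. x \<in> G \<Longrightarrow> y \<in> G \<Longrightarrow> x \<le> y \<Longrightarrow> \<bar>a y - a x\<bar> \<le> v y - v x"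
begin

text \<open>Bounds the total variation of \<open>ln (sqrt (\<rho> a))\<close>: each logarithm is
  Lipschitz with constant \<open>1 / \<rho>0\<close> or \<open>1 / a0\<close>, the square root
  halves the sum, and \<open>v\<close> varies by at most \<open>W\<close>.\<close>

definition "Vlog = (1 / (2 * \<rho>0) + 1 / (2 * a0)) * W"
definition "Zmax = sqrt (\<rho>1 * a1)"

lemma G_dense:
  assumes "0 \<le> c" "c < d" "d \<le> L"
  shows "\<exists>x\<in>G. c < x \<and> x < d"
proof (rule ccontr)
  assume no: "\<not> (\<exists>x\<in>G. c < x \<and> x < d)"
  have "AE x in lebesgue_on {c<..<d}. x \<in> G"
    by (rule AE_lebesgue_on_subset[OF G_full]) (use assms in auto)
  moreover have "AE x in lebesgue_on {c<..<d}. x \<in> {c<..<d}"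
    by (intro AE_I2) (simp add: space_restrict_space)
  ultimately have "AE x in lebesgue_on {c<..<d}. False"
    by eventually_elim (use no in auto)
  then have "emeasure (lebesgue_on {c<..<d}) (space (lebesgue_on {c<..<d})) = 0"
    by (simp only: ae_filter_eq_bot_iff[symmetric] eventually_False)
  then show False using assms by (simp add: emeasure_restrict_space space_restrict_space)
qed

lemma variation_near:
  assumes "x \<in> G" "y \<in> G" "\<bar>x - y\<bar> \<le> h"
  shows "\<bar>\<rho> y - \<rho> x\<bar> \<le> v (x + h) - v (x - h)" "\<bar>a y - a x\<bar> \<le> v (x + h) - v (x - h)"
proof -
  have le: "\<bar>v y - v x\<bar> \<le> v (x + h) - v (x - h)"
    using monoD[OF v_mono, of "x - h" x] monoD[OF v_mono, of "x - h" y]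
      monoD[OF v_mono, of x "x + h"] monoD[OF v_mono, of y "x + h"] assms(3)
    by (auto simp: abs_le_iff)
  have "\<bar>\<rho> y - \<rho> x\<bar> \<le> \<bar>v y - v x\<bar> \<and> \<bar>a y - a x\<bar> \<le> \<bar>v y - v x\<bar>"
    using \<rho>_var[OF assms(1,2)] \<rho>_var[OF assms(2,1)] a_var[OF assms(1,2)] a_var[OF assms(2,1)]
    by (cases "x \<le> y") (auto simp: abs_minus_commute)
  then show "\<bar>\<rho> y - \<rho> x\<bar> \<le> v (x + h) - v (x - h)" "\<bar>a y - a x\<bar> \<le> v (x + h) - v (x - h)"
    using le by linarith+
qed

lemma ln_impedance_diff:
  assumes "x \<in> G" "y \<in> G" "x \<le> y"
  shows "\<bar>ln (sqrt (\<rho> x * a x)) - ln (sqrt (\<rho> y * a y))\<bar> \<le> (1 / (2 * \<rho>0) + 1 / (2 * a0)) * (v y - v x)"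
proof -
  have p: "0 < \<rho> x" "0 < a x" "0 < \<rho> y" "0 < a y"
    using \<rho>_bounds a_bounds assms pos by (meson less_le_trans)+
  have eq: "ln (sqrt (\<rho> x * a x)) - ln (sqrt (\<rho> y * a y)) = - (((ln (\<rho> y) - ln (\<rho> x)) + (ln (a y) - ln (a x))) / 2)"
    using p by (simp add: ln_sqrt ln_mult diff_divide_distrib add_divide_distrib)
  have "\<bar>ln (sqrt (\<rho> x * a x)) - ln (sqrt (\<rho> y * a y))\<bar> = \<bar>(ln (\<rho> y) - ln (\<rho> x)) + (ln (a y) - ln (a x))\<bar> / 2"
    unfolding eq by simp
  also have "\<dots> \<le> (\<bar>\<rho> y - \<rho> x\<bar> / \<rho>0 + \<bar>a y - a x\<bar> / a0) / 2"
    using abs_ln_diff_le[of \<rho>0 "\<rho> y" "\<rho> x"] abs_ln_diff_le[of a0 "a y" "a x"] pos \<rho>_bounds a_bounds assms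
    by (intro divide_right_mono order_trans[OF abs_triangle_ineq add_mono]) auto
  also have "\<dots> \<le> ((v y - v x) / \<rho>0 + (v y - v x) / a0) / 2"
    using \<rho>_var[OF assms] a_var[OF assms] pos by (intro divide_right_mono add_mono) auto
  also have "\<dots> = (1 / (2 * \<rho>0) + 1 / (2 * a0)) * (v y - v x)"
    by (simp add: algebra_simps add_divide_distrib)
  finally show ?thesis .
qed

text \<open>\<open>q\<close> is the flux at \<open>x = h\<close>. Its bound involves the datum only
  through the norm of \<open>e 1\<close>, whereas \<open>K\<close> may depend on higher derivatives;
  what matters is that \<open>K\<close> is chosen before \<open>h\<close>.\<close>

lemma layered_approximation:
  fixes e :: "nat \<Rightarrow> real \<Rightarrow> real"
  assumes e: "\<And>n t. (e n has_real_derivative e (Suc n) t) (at t)"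
    and bd: "\<And>n t. n \<le> 5 \<Longrightarrow> \<bar>e n t\<bar> \<le> S"
    and supp: "\<And>n t. t < t0 \<Longrightarrow> e n t = 0" and t0: "\<beta> * L < t0"
    and sq: "integrable lborel (\<lambda>t. (e 1 t)\<^sup>2)"
  obtains K where "0 \<le> K"
    and "\<And>h N. h = L / (real N + 1) \<Longrightarrow> \<exists>\<phi> \<phi>tt r q R. wave_test L T a \<phi> \<phi>tt r \<and> (\<forall>t. \<phi> t L = e 0 t) \<and>
      q \<in> borel_measurable borel \<and> integrable lborel (\<lambda>t. (q t)\<^sup>2) \<and>
      (\<integral>t. (q t)\<^sup>2 \<partial>lborel) \<le> Zmax\<^sup>2 * exp Vlog * (\<integral>t. (e 1 t)\<^sup>2 \<partial>lborel) \<and>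
      (\<forall>t. L2_on {0<..<L} (R t) \<and> L2_norm {0<..<L} (R t) \<le> K * sqrt h) \<and>
      (\<forall>t x. \<rho> x * \<phi>tt t x - r t x = R t x - (if x < h then q t / h else 0))"
proof -
  \<comment> \<open>These are the constants of \<open>residual_L2\<close> for the parameters
    \<open>Zmax\<close>, \<open>Vlog\<close>, \<beta> and \<open>1 / a0\<^sup>2\<close>. None of
    them involves \<open>h\<close>.\<close>
  define D where "D = (1 + Zmax * exp Vlog / a0 * L) * S"
  define M where "M = \<beta> * Zmax * (Zmax * exp Vlog * S * (1 / a0\<^sup>2) * (2 * W))"
  define K where "K = sqrt (3 * ((\<rho>1 * D)\<^sup>2 + D\<^sup>2 * (2 * W\<^sup>2) + (M * L)\<^sup>2))"
  have "\<exists>\<phi> \<phi>tt r q R. wave_test L T a \<phi> \<phi>tt r \<and> (\<forall>t. \<phi> t L = e 0 t) \<and>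
      q \<in> borel_measurable borel \<and> integrable lborel (\<lambda>t. (q t)\<^sup>2) \<and>
      (\<integral>t. (q t)\<^sup>2 \<partial>lborel) \<le> Zmax\<^sup>2 * exp Vlog * (\<integral>t. (e 1 t)\<^sup>2 \<partial>lborel) \<and>
      (\<forall>t. L2_on {0<..<L} (R t) \<and> L2_norm {0<..<L} (R t) \<le> K * sqrt h) \<and>
      (\<forall>t x. \<rho> x * \<phi>tt t x - r t x = R t x - (if x < h then q t / h else 0))"
    if h: "h = L / (real N + 1)" for h N
  proof -
    have h_pos: "0 < h" unfolding h using L_pos by (intro divide_pos_pos) auto
    have L_eq: "L = (real N + 1) * h" unfolding h by (simp add: field_simps)
    have "\<exists>x\<in>G. L - (real k + 1) * h < x \<and> x < L - real k * h" if "k \<le> N" for k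
    proof (rule G_dense)
      show "0 \<le> L - (real k + 1) * h" using that h_pos unfolding L_eq by (simp add: mult_right_mono)
      show "L - (real k + 1) * h < L - real k * h" "L - real k * h \<le> L" using h_pos by (simp_all add: algebra_simps)
    qed
    then obtain \<xi>' where \<xi>': "\<And>k. k \<le> N \<Longrightarrow> \<xi>' k \<in> G \<and> L - (real k + 1) * h < \<xi>' k \<and> \<xi>' k < L - real k * h"
      by metis
    \<comment> \<open>The medium is indexed by all natural numbers. Beyond index \<open>N\<close>,
      to the left of \<open>x = 0\<close>, the last sample is repeated, which adds no
      variation.\<close>
    define \<xi> where "\<xi> k = \<xi>' (min k N)" for k
    have \<xi>G: "\<xi> k \<in> G" for k using \<xi>'[of "min k N"] by (simp add: \<xi>_def)
    have \<xi>_dec: "\<xi> (Suc k) \<le> \<xi> k" for k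
    proof (cases "Suc k \<le> N")
      case True
      then show ?thesis using \<xi>'[of "Suc k"] \<xi>'[of k] by (simp add: \<xi>_def add.commute)
    qed (simp add: \<xi>_def)
    define z where "z k = sqrt (\<rho> (\<xi> k) * a (\<xi> k))" for k
    define b where "b k = sqrt (\<rho> (\<xi> k) / a (\<xi> k))" for k
    define c where "c = 1 / (2 * \<rho>0) + 1 / (2 * a0)"
    \<comment> \<open>The sample points move left as \<open>k\<close> grows, so \<open>v\<close>
      decreases along them and its complement in \<open>W\<close> increases.\<close>
    define m where "m k = c * (W - v (\<xi> k))" for k
    have p: "0 < \<rho> (\<xi> k)" "0 < a (\<xi> k)" "\<rho> (\<xi> k) \<le> \<rho>1" "a (\<xi> k) \<le> a1" "a0 \<le> a (\<xi> k)" for k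
      using \<rho>_bounds[OF \<xi>G[of k]] a_bounds[OF \<xi>G[of k]] pos by auto
    have c0: "0 \<le> c" using pos by (simp add: c_def)
    interpret layered_test z b m h N L a0 Zmax Vlog \<beta> a
    proof
      show "0 < h" "L = (real N + 1) * h" "0 < a0" using h_pos L_eq pos by auto
      show "a \<in> borel_measurable (lebesgue_on {0..L})" by (rule a_meas)
      show "AE x in lebesgue_on {0..L}. a0 \<le> a x" using G_full by eventually_elim (use a_bounds in blast)
      fix k
      show "0 < z k" "0 \<le> b k" using p[of k] by (simp_all add: z_def b_def)
      show "\<bar>ln (z (Suc k)) - ln (z k)\<bar> \<le> m (Suc k) - m k"
      proof -
        have "m (Suc k) - m k = c * (v (\<xi> k) - v (\<xi> (Suc k)))" by (simp add: m_def algebra_simps)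
        then show ?thesis using ln_impedance_diff[OF \<xi>G \<xi>G \<xi>_dec[of k]] by (simp only: z_def c_def)
      qed
      have "\<rho> (\<xi> k) * a (\<xi> k) \<le> \<rho>1 * a1" using p[of k] by (intro mult_mono) auto
      then show "z k \<le> Zmax" by (simp add: z_def Zmax_def)
      have "m k - m 0 = c * (v (\<xi> 0) - v (\<xi> k))" by (simp add: m_def algebra_simps)
      also have "\<dots> \<le> c * W" using v_bounds[of "\<xi> 0"] v_bounds[of "\<xi> k"] c0 by (intro mult_left_mono) auto
      finally show "m k - m 0 \<le> Vlog" by (simp add: Vlog_def c_def)
      show "b k \<le> \<beta>" unfolding b_def by (rule slowness[OF \<xi>G])
    qed
    let ?\<omega> = "\<lambda>x. v (x + h) - v (x - h)"
    have bz: "b k * z k = \<rho> (\<xi> k)" "b k / z k = 1 / a (\<xi> k)" for k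
      using p[of k] by (simp_all add: b_def z_def flip: real_sqrt_mult real_sqrt_divide)
        (simp add: real_sqrt_mult real_sqrt_divide field_simps)
    \<comment> \<open>A point of \<open>G\<close> and the sample of its layer lie in the same
      interval of length \<open>h\<close>.\<close>
    have close: "\<bar>x - \<xi> (layer (L - x))\<bar> \<le> h" if "x \<in> G" for x
    proof -
      let ?k = "layer (L - x)"
      have x: "0 < x" "x < L" using that G_sub by auto
      note lb = layer_bounds[of "L - x"]
      have "real ?k * h < (real N + 1) * h" using lb x L_eq by simp
      then have "?k \<le> N" using h_pos by simp
      then show ?thesis using lb x \<xi>'[of ?k] by (simp add: \<xi>_def algebra_simps abs_le_iff)
    qed
    have near_\<rho>: "AE x in lebesgue_on {0..L}. \<bar>b (layer (L - x)) * z (layer (L - x)) - \<rho> x\<bar> \<le> ?\<omega> x"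
      using G_full by eventually_elim (unfold bz, rule variation_near(1)[OF _ \<xi>G close])
    have near_a: "AE x in lebesgue_on {0..L}. \<bar>b (layer (L - x)) / z (layer (L - x)) - 1 / a x\<bar> \<le> 1 / a0\<^sup>2 * ?\<omega> x"
      using G_full
    proof eventually_elim
      case (elim x)
      let ?y = "\<xi> (layer (L - x))"
      have ax: "a0 \<le> a x" "a0 \<le> a ?y" using a_bounds elim \<xi>G by auto
      have "\<bar>1 / a ?y - 1 / a x\<bar> = \<bar>a ?y - a x\<bar> / (a x * a ?y)"
      proof -
        have "1 / a ?y - 1 / a x = (a x - a ?y) / (a x * a ?y)" using ax pos by (simp add: field_simps)
        then show ?thesis using ax pos by (simp add: abs_minus_commute abs_mult)
      qed
      also have "\<dots> \<le> ?\<omega> x / a0\<^sup>2"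
      proof (rule frac_le)
        show "a0\<^sup>2 \<le> a x * a ?y" unfolding power2_eq_square using ax pos by (intro mult_mono) auto
        show le: "\<bar>a ?y - a x\<bar> \<le> ?\<omega> x" by (rule variation_near(2)[OF elim \<xi>G close[OF elim]])
        show "0 \<le> ?\<omega> x" by (rule order_trans[OF abs_ge_zero le])
      qed (use pos in simp)
      finally show ?case unfolding bz by simp
    qed
    have \<omega>: "integrable (lebesgue_on {0..L}) ?\<omega>" "\<And>x. 0 \<le> ?\<omega> x" "\<And>x. ?\<omega> x \<le> W"
      "(\<integral>x. ?\<omega> x \<partial>lebesgue_on {0..L}) \<le> 2 * h * W"
    proof -
      show "integrable (lebesgue_on {0..L}) ?\<omega>" "(\<integral>x. ?\<omega> x \<partial>lebesgue_on {0..L}) \<le> 2 * h * W"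
        using oscillation_integral[OF v_mono v_bounds] h_pos by auto
      show "0 \<le> ?\<omega> x" for x using monoD[OF v_mono, of "x - h" "x + h"] h_pos by simp
      show "?\<omega> x \<le> W" for x using v_bounds(2)[of "x + h"] v_bounds(1)[of "x - h"] by simp
    qed
    have \<rho>_ae: "AE x in lebesgue_on {0..L}. \<bar>\<rho> x\<bar> \<le> \<rho>1"
      using G_full
    proof eventually_elim
      case (elim x)
      then show ?case using \<rho>_bounds[of x] pos by simp
    qed
    note R = residual_L2[where e = e and S = S and \<rho> = \<rho> and \<omega> = "?\<omega>" and W = W and c = "1 / a0\<^sup>2",
        OF e bd \<rho>_meas \<rho>_ae \<omega> near_a near_\<rho> _ D_def M_def, folded K_def]
    have e1: "e 1 \<in> borel_measurable borel"
      by (intro borel_measurable_continuous_onI continuous_at_imp_continuous_on ballI DERIV_isCont[OF e])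
    show ?thesis
    proof (intro exI conjI allI)
      show "wave_test L T a (disp (e 0) (e 1)) (disp (e 2) (e 3)) (flux_deriv (e 1) (e 2))"
        by (rule wave_test_disp[where e = e and S = S, OF e bd supp t0])
      show "disp (e 0) (e 1) t L = e 0 t" for t by (rule disp_at_L)
      show "fw (N * h) (e 1) \<in> borel_measurable borel" "integrable lborel (\<lambda>t. (fw (N * h) (e 1) t)\<^sup>2)"
        "(\<integral>t. (fw (N * h) (e 1) t)\<^sup>2 \<partial>lborel) \<le> Zmax\<^sup>2 * exp Vlog * (\<integral>t. (e 1 t)\<^sup>2 \<partial>lborel)"
        by (rule flux_energy[OF e1 sq])+
      show "L2_on {0<..<L} (residual \<rho> e t)" for t by (rule R(1)) simp_all
      show "L2_norm {0<..<L} (residual \<rho> e t) \<le> K * sqrt h" for t by (rule R(2)) simp_all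
      show "\<rho> x * disp (e 2) (e 3) t x - flux_deriv (e 1) (e 2) t x
          = residual \<rho> e t x - (if x < h then fw (N * h) (e 1) t / h else 0)" for t x
        by (simp add: residual_def flux_deriv_def)
    qed
  qed
  then show thesis using that[of K] by (simp add: K_def)
qed

end

subsection \<open>The duality argument\<close>

lemma test_fun_derivative:
  assumes "test_fun I \<eta>"
  shows "((deriv ^^ n) \<eta> has_real_derivative (deriv ^^ Suc n) \<eta> t) (at t)"
proof -
  have "(deriv ^^ n) \<eta> differentiable (at t)" using assms unfolding test_fun_def by blast
  then show ?thesis by (simp add: DERIV_deriv_iff_real_differentiable)
qed

lemma test_fun_vanishes:
  fixes \<eta> :: "real \<Rightarrow> real"
  assumes "t \<notin> closure {t. \<eta> t \<noteq> 0}"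
  shows "(deriv ^^ n) \<eta> t = 0"
  using assms
proof (induction n arbitrary: t)
  case 0
  then show ?case using closure_subset[of "{t. \<eta> t \<noteq> 0}"] by auto
next
  case (Suc n)
  have "((deriv ^^ n) \<eta> has_real_derivative 0) (at t)"
  proof (rule has_field_derivative_transform_within_open)
    show "((\<lambda>_. 0 :: real) has_real_derivative 0) (at t)" by simp
    show "open (- closure {t. \<eta> t \<noteq> 0})" by (rule open_Compl[OF closed_closure])
    show "t \<in> - closure {t. \<eta> t \<noteq> 0}" using Suc.prems by simp
    show "0 = (deriv ^^ n) \<eta> x" if "x \<in> - closure {t. \<eta> t \<noteq> 0}" for x
      using Suc.IH[of x] that by simp
  qed
  then show ?case by (simp add: DERIV_imp_deriv)
qed

lemma test_fun_bounded:
  assumes "test_fun I \<eta>"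
  shows "\<exists>S. \<forall>n\<le>m. \<forall>t. \<bar>(deriv ^^ n) \<eta> t\<bar> \<le> S"
proof -
  have ex: "\<exists>S. \<forall>t. \<bar>(deriv ^^ n) \<eta> t\<bar> \<le> S" for n
  proof -
    let ?K = "closure {t. \<eta> t \<noteq> 0}"
    have "continuous_on ?K ((deriv ^^ n) \<eta>)"
      by (intro continuous_at_imp_continuous_on ballI DERIV_isCont[OF test_fun_derivative[OF assms]])
    moreover have "compact ?K" using assms unfolding test_fun_def by blast
    ultimately have "bounded ((deriv ^^ n) \<eta> ` ?K)" by (intro compact_imp_bounded compact_continuous_image)
    then obtain S where S: "0 < S" "\<And>t. t \<in> ?K \<Longrightarrow> \<bar>(deriv ^^ n) \<eta> t\<bar> \<le> S"
      unfolding bounded_pos by auto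
    have "\<bar>(deriv ^^ n) \<eta> t\<bar> \<le> S" for t
      using S test_fun_vanishes[of t \<eta> n] by (cases "t \<in> ?K") auto
    then show ?thesis by blast
  qed
  then obtain S where S: "\<And>n t. \<bar>(deriv ^^ n) \<eta> t\<bar> \<le> S n" by metis
  have "\<bar>(deriv ^^ n) \<eta> t\<bar> \<le> (\<Sum>k\<le>m. S k)" if "n \<le> m" for n t
  proof -
    have "S n \<le> (\<Sum>k\<le>m. S k)"
      using that order_trans[OF abs_ge_zero S] by (intro member_le_sum) auto
    then show ?thesis using S[of n t] by linarith
  qed
  then show ?thesis by blast
qed

lemma test_fun_square_integral:
  assumes "test_fun {c<..<d} \<eta>"
  shows "integrable lborel (\<lambda>t. ((deriv ^^ n) \<eta> t)\<^sup>2)"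
    and "(\<integral>t. ((deriv ^^ n) \<eta> t)\<^sup>2 \<partial>lborel) = (L2_norm {c<..<d} ((deriv ^^ n) \<eta>))\<^sup>2"
proof -
  let ?K = "closure {t. \<eta> t \<noteq> 0}" and ?f = "(deriv ^^ n) \<eta>"
  have K: "compact ?K" "?K \<subseteq> {c<..<d}" using assms unfolding test_fun_def by auto
  have cont: "continuous_on A (\<lambda>t. (?f t)\<^sup>2)" for A
    by (intro continuous_intros continuous_at_imp_continuous_on ballI
        DERIV_isCont[OF test_fun_derivative[OF assms]])
  have ind: "indicator A t *\<^sub>R (?f t)\<^sup>2 = (?f t)\<^sup>2" if "?K \<subseteq> A" for A t
    using that test_fun_vanishes[of t \<eta> n] by (auto simp: indicator_def)
  show int: "integrable lborel (\<lambda>t. (?f t)\<^sup>2)"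
    using borel_integrable_compact[OF K(1) cont] by (simp only: ind[OF order_refl])
  have sets: "{c<..<d} \<inter> space lebesgue \<in> sets lebesgue" by simp
  have "(L2_norm {c<..<d} ?f)\<^sup>2 = (\<integral>t. (?f t)\<^sup>2 \<partial>lebesgue)"
    unfolding L2_norm_squared integral_restrict_space[OF sets] ind[OF K(2)] ..
  also have "\<dots> = (\<integral>t. (?f t)\<^sup>2 \<partial>lborel)"
    using int by (intro integral_completion) auto
  finally show "(\<integral>t. (?f t)\<^sup>2 \<partial>lborel) = (L2_norm {c<..<d} ?f)\<^sup>2" by simp
qed

text \<open>Compactness inside the open interval gives a strict gap after \<open>c\<close>:
  \<open>t0\<close> is the minimum of the support, or any larger number than \<open>c\<close> if the
  support is empty.\<close>

lemma test_fun_vanishes_before: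
  assumes "test_fun {c<..<d} \<eta>"
  obtains t0 where "c < t0" "\<And>n t. t < t0 \<Longrightarrow> (deriv ^^ n) \<eta> t = 0"
proof -
  let ?K = "closure {t. \<eta> t \<noteq> 0}"
  have K: "compact ?K" "?K \<subseteq> {c<..<d}" using assms unfolding test_fun_def by auto
  have "\<exists>t0>c. \<forall>t\<in>?K. t0 \<le> t"
  proof (cases "?K = {}")
    case False
    then obtain t0 where "t0 \<in> ?K" "\<forall>t\<in>?K. t0 \<le> t" using compact_attains_inf[OF K(1)] by blast
    then show ?thesis using K(2) by (intro exI[of _ t0]) auto
  qed (auto intro: exI[of _ "c + 1"])
  then show thesis using that test_fun_vanishes by (metis not_le)
qed

lemma L2_norm_le_lborel:
  fixes f :: "real \<Rightarrow> real"
  assumes [measurable]: "f \<in> borel_measurable borel" and int: "integrable lborel (\<lambda>t. (f t)\<^sup>2)"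
  shows "L2_on {c<..<d} f" "L2_norm {c<..<d} f \<le> sqrt (\<integral>t. (f t)\<^sup>2 \<partial>lborel)"
proof -
  have sets: "{c<..<d} \<inter> space lebesgue \<in> sets lebesgue" by simp
  have int2: "integrable lborel (\<lambda>t. indicator {c<..<d} t *\<^sub>R (f t)\<^sup>2)"
    by (rule integrable_mult_indicator[OF _ int]) simp
  show "L2_on {c<..<d} f"
    unfolding L2_on_def integrable_restrict_space[OF sets]
    using int2 by (auto intro!: measurable_restrict_space1 measurable_completion simp: integrable_completion)
  have "(\<integral>t. (f t)\<^sup>2 \<partial>lebesgue_on {c<..<d}) = (\<integral>t. indicator {c<..<d} t *\<^sub>R (f t)\<^sup>2 \<partial>lborel)"
    unfolding integral_restrict_space[OF sets] using int2 by (intro integral_completion) auto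
  also have "\<dots> \<le> (\<integral>t. (f t)\<^sup>2 \<partial>lborel)"
    by (rule integral_mono[OF int2 int]) (auto simp: indicator_def)
  finally show "L2_norm {c<..<d} f \<le> sqrt (\<integral>t. (f t)\<^sup>2 \<partial>lborel)"
    unfolding L2_norm_def by (rule real_sqrt_le_mono)
qed

context bv_medium
begin

lemma \<beta>_nonneg: "0 \<le> \<beta>"
proof -
  obtain x where "x \<in> G" using G_dense[of 0 L] L_pos by auto
  then have "sqrt (\<rho> x / a x) \<le> \<beta>" "0 \<le> sqrt (\<rho> x / a x)"
    using slowness \<rho>_bounds[of x] a_bounds[of x] pos by auto
  then show ?thesis by linarith
qed

text \<open>For fixed \<eta> the weak identity is tested with the layered approximation. Its
  integral is the pairing of \<psi> with the residual, of order \<open>sqrt h\<close>, minus that of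
  the layer average \<open>avg h\<close> with the flux \<open>q\<close>. The flux changes with
  \<open>h\<close>, but its norm stays below \<open>?D\<close>, while \<open>avg h\<close> tends to
  \<open>g\<close>.\<close>

lemma duality_bound:
  assumes fes: "finite_energy_solution L T \<rho> a s \<psi> g" and T: "\<beta> * L < T"
    and \<eta>: "test_fun {\<beta> * L<..<T} \<eta>" "L2_norm {\<beta> * L<..<T} (deriv \<eta>) \<le> 1"
  shows "\<bar>left_limit_trace a L * s \<eta>\<bar> \<le> Zmax * exp (Vlog / 2) * L2_norm {0<..<T} g"
proof -
  define e where "e n = (deriv ^^ n) \<eta>" for n
  have \<beta>L: "0 \<le> \<beta> * L" using \<beta>_nonneg L_pos by simp
  have T0: "0 < T" using \<beta>L T by linarith
  obtain t0 where t0: "\<beta> * L < t0" "\<And>n t. t < t0 \<Longrightarrow> e n t = 0"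
    using test_fun_vanishes_before[OF \<eta>(1)] unfolding e_def by metis
  obtain S where S: "\<And>n t. n \<le> 5 \<Longrightarrow> \<bar>e n t\<bar> \<le> S"
    using test_fun_bounded[OF \<eta>(1), of 5] unfolding e_def by blast
  have e: "(e n has_real_derivative e (Suc n) t) (at t)" for n t
    unfolding e_def by (rule test_fun_derivative[OF \<eta>(1)])
  have sq: "integrable lborel (\<lambda>t. (e 1 t)\<^sup>2)"
    unfolding e_def by (rule test_fun_square_integral(1)[OF \<eta>(1)])
  have sq_le: "(\<integral>t. (e 1 t)\<^sup>2 \<partial>lborel) \<le> 1"
    using \<eta>(2) unfolding e_def test_fun_square_integral(2)[OF \<eta>(1)] by (simp add: power_le_one)
  obtain K where K: "0 \<le> K" and approx: "\<And>h N. h = L / (real N + 1) \<Longrightarrow>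
      \<exists>\<phi> \<phi>tt r q R. wave_test L T a \<phi> \<phi>tt r \<and> (\<forall>t. \<phi> t L = e 0 t) \<and>
      q \<in> borel_measurable borel \<and> integrable lborel (\<lambda>t. (q t)\<^sup>2) \<and>
      (\<integral>t. (q t)\<^sup>2 \<partial>lborel) \<le> Zmax\<^sup>2 * exp Vlog * (\<integral>t. (e 1 t)\<^sup>2 \<partial>lborel) \<and>
      (\<forall>t. L2_on {0<..<L} (R t) \<and> L2_norm {0<..<L} (R t) \<le> K * sqrt h) \<and>
      (\<forall>t x. \<rho> x * \<phi>tt t x - r t x = R t x - (if x < h then q t / h else 0))"
    using layered_approximation[where e = e and S = S and T = T, OF e S t0(2,1) sq] by blast
  have \<psi>: "continuous_L2 T {0<..<L} \<psi>" and weak: "weak_wave_identity L T \<rho> a s \<psi>"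
    and g: "L2_on {0<..<T} g"
    and trace: "((\<lambda>h. L2_norm {0<..<T} (\<lambda>t. (\<integral>x. \<psi> t x \<partial>lebesgue_on {0<..<h}) / h - g t)) \<longlongrightarrow> 0) (at_right 0)"
    using fes unfolding finite_energy_solution_def trace_at_0_def by auto
  obtain M where M: "0 \<le> M" "\<And>t. t \<in> {0..T} \<Longrightarrow> L2_norm {0<..<L} (\<psi> t) \<le> M"
    using continuous_L2_bounded[OF \<psi>] by blast
  have \<psi>L2: "L2_on {0<..<L} (\<psi> t)" if "t \<in> {0..T}" for t using \<psi> that unfolding continuous_L2_def by blast
  let ?A = "left_limit_trace a L" and ?D = "Zmax * exp (Vlog / 2)"
  define avg where "avg h t = (\<integral>x. \<psi> t x \<partial>lebesgue_on {0<..<h}) / h" for h t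
  define \<delta> where "\<delta> h = L2_norm {0<..<T} (\<lambda>t. avg h t - g t)" for h
  have D0: "0 \<le> ?D"
  proof -
    obtain x where "x \<in> G" using G_dense[of 0 L] L_pos by auto
    then have "0 \<le> \<rho>1" "0 \<le> a1" using \<rho>_bounds[of x] a_bounds[of x] pos by auto
    then show ?thesis by (simp add: Zmax_def)
  qed
  have main: "\<bar>?A * s \<eta>\<bar> \<le> T * (M * (K * sqrt h)) + (\<delta> h + L2_norm {0<..<T} g) * ?D"
    if h: "h = L / (real N + 1)" for h N
  proof -
    have h_pos: "0 < h" unfolding h using L_pos by (intro divide_pos_pos) auto
    have h_le: "h \<le> L" unfolding h using L_pos by (simp add: field_simps)
    obtain \<phi> \<phi>tt r q R where wt: "wave_test L T a \<phi> \<phi>tt r" and \<phi>L: "\<And>t. \<phi> t L = e 0 t"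
      and q: "q \<in> borel_measurable borel" "integrable lborel (\<lambda>t. (q t)\<^sup>2)"
        "(\<integral>t. (q t)\<^sup>2 \<partial>lborel) \<le> Zmax\<^sup>2 * exp Vlog * (\<integral>t. (e 1 t)\<^sup>2 \<partial>lborel)"
      and R: "\<And>t. L2_on {0<..<L} (R t)" "\<And>t. L2_norm {0<..<L} (R t) \<le> K * sqrt h"
      and eq: "\<And>t x. \<rho> x * \<phi>tt t x - r t x = R t x - (if x < h then q t / h else 0)"
      using approx[OF h] by blast
    have sub: "{\<beta> * L<..<T} \<subseteq> {0<..<T}" using \<beta>L by auto
    have "test_fun {0<..<T} \<eta>" using \<eta>(1) sub unfolding test_fun_def by blast
    \<comment> \<open>The boundary values of the layered test function equal \<eta> at every time,
      so the whole line serves as the neighbourhood \<open>U\<close> of the support of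
      \<open>s\<close>.\<close>
    then have identity: "(\<integral>t. (\<integral>x. \<psi> t x * (\<rho> x * \<phi>tt t x - r t x) \<partial>lebesgue_on {0<..<L}) \<partial>lebesgue_on {0<..<T})
        = ?A * s \<eta>"
      using weak wt \<phi>L unfolding weak_wave_identity_def e_def
      by (metis (no_types, lifting) funpow_0 open_UNIV subset_UNIV)
    let ?I = "\<lambda>t. \<integral>x. \<psi> t x * (\<rho> x * \<phi>tt t x - r t x) \<partial>lebesgue_on {0<..<L}"
    have ind_L2: "L2_on {0<..<L} (indicator {..<h})"
      by (rule L2_on_bounded[where K = 1])
        (auto intro!: measurable_restrict_space1 measurable_completion simp: indicator_def)
    have avg_eq: "avg h t = (\<integral>x. \<psi> t x * indicator {..<h} x \<partial>lebesgue_on {0<..<L}) / h" for t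
    proof -
      have sets: "{0<..<L} \<inter> space lebesgue \<in> sets lebesgue" "{0<..<h} \<inter> space lebesgue \<in> sets lebesgue"
        by simp_all
      have ind: "indicator {0<..<L} x *\<^sub>R (\<psi> t x * indicator {..<h} x) = indicator {0<..<h} x *\<^sub>R \<psi> t x" for x
        using h_le by (auto simp: indicator_def)
      show ?thesis
        unfolding avg_def integral_restrict_space[OF sets(1)] integral_restrict_space[OF sets(2)] ind ..
    qed
    have avg_cont: "continuous_on {0..T} (avg h)"
      unfolding avg_eq[abs_def] using continuous_L2_pairing[OF \<psi> ind_L2] h_pos
      by (intro continuous_intros) auto
    have avg_L2: "L2_on {0<..<T} (avg h)"
    proof -
      have "avg h \<in> borel_measurable (lebesgue_on {0<..<T})"
        by (rule measurable_restrict_mono[OF continuous_imp_borel_measurable_lebesgue_on[OF avg_cont]]) auto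
      moreover have "continuous_on {0..T} (\<lambda>t. (avg h t)\<^sup>2)" using avg_cont by (intro continuous_intros)
      then have "integrable (lebesgue_on {0<..<T}) (\<lambda>t. (avg h t)\<^sup>2)"
        unfolding integrable_Ioo_iff_Icc by (rule continuous_imp_integrable_real)
      ultimately show ?thesis unfolding L2_on_def by blast
    qed
    have q_L2: "L2_on {0<..<T} q" by (rule L2_norm_le_lborel(1)[OF q(1,2)])
    have q_norm: "L2_norm {0<..<T} q \<le> ?D"
    proof -
      have "(\<integral>t. (q t)\<^sup>2 \<partial>lborel) \<le> ?D\<^sup>2"
      proof -
        have "(\<integral>t. (q t)\<^sup>2 \<partial>lborel) \<le> Zmax\<^sup>2 * exp Vlog * 1"
          by (rule order_trans[OF q(3) mult_left_mono[OF sq_le]]) simp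
        also have "\<dots> = ?D\<^sup>2" by (simp add: power_mult_distrib flip: exp_double)
        finally show ?thesis .
      qed
      then have "sqrt (\<integral>t. (q t)\<^sup>2 \<partial>lborel) \<le> ?D" using D0 by (rule real_le_lsqrt[rotated])
      then show ?thesis using L2_norm_le_lborel(2)[OF q(1,2), of 0 T] by linarith
    qed
    have I_le: "\<bar>?I t\<bar> \<le> M * (K * sqrt h) + \<bar>avg h t * q t\<bar>" if t: "t \<in> {0<..<T}" for t
    proof -
      have t': "t \<in> {0..T}" using t by simp
      have int: "integrable (lebesgue_on {0<..<L}) (\<lambda>x. \<psi> t x * R t x)"
        "integrable (lebesgue_on {0<..<L}) (\<lambda>x. \<psi> t x * indicator {..<h} x)"
        by (rule L2_on_mult_integrable[OF \<psi>L2[OF t']]; rule R ind_L2)+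
      have "?I t = (\<integral>x. \<psi> t x * R t x - (q t / h) * (\<psi> t x * indicator {..<h} x) \<partial>lebesgue_on {0<..<L})"
        unfolding eq by (intro Bochner_Integration.integral_cong refl) (simp add: algebra_simps)
      also have "\<dots> = (\<integral>x. \<psi> t x * R t x \<partial>lebesgue_on {0<..<L})
          - (q t / h) * (\<integral>x. \<psi> t x * indicator {..<h} x \<partial>lebesgue_on {0<..<L})"
        using int by simp
      also have "\<dots> = (\<integral>x. \<psi> t x * R t x \<partial>lebesgue_on {0<..<L}) - avg h t * q t"
        unfolding avg_eq by simp
      finally have "\<bar>?I t\<bar> \<le> \<bar>\<integral>x. \<psi> t x * R t x \<partial>lebesgue_on {0<..<L}\<bar> + \<bar>avg h t * q t\<bar>"
        by (simp only: abs_triangle_ineq4)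
      moreover have "\<bar>\<integral>x. \<psi> t x * R t x \<partial>lebesgue_on {0<..<L}\<bar> \<le> M * (K * sqrt h)"
        by (rule order_trans[OF L2_pairing_le[OF \<psi>L2[OF t'] R(1)]]) (intro mult_mono M R t' L2_norm_nonneg)
      ultimately show ?thesis by linarith
    qed
    interpret finite_measure "lebesgue_on {0<..<T}" by (rule finite_measure_lebesgue_on) auto
    have aq: "integrable (lebesgue_on {0<..<T}) (\<lambda>t. \<bar>avg h t * q t\<bar>)"
      by (rule integrable_abs[OF L2_on_mult_integrable[OF avg_L2 q_L2]])
    have "\<bar>?A * s \<eta>\<bar> = \<bar>\<integral>t. ?I t \<partial>lebesgue_on {0<..<T}\<bar>" unfolding identity ..
    also have "\<dots> \<le> (\<integral>t. \<bar>?I t\<bar> \<partial>lebesgue_on {0<..<T})" by (rule integral_abs_bound)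
    \<comment> \<open>The rule asks for integrability of the larger side only. Measurability of
      \<open>?I\<close> in time is not established; were \<open>?I\<close> not integrable, its
      integral would be 0 by default.\<close>
    also have "\<dots> \<le> (\<integral>t. M * (K * sqrt h) + \<bar>avg h t * q t\<bar> \<partial>lebesgue_on {0<..<T})"
    proof (rule integral_mono_AE')
      show "AE t in lebesgue_on {0<..<T}. \<bar>?I t\<bar> \<le> M * (K * sqrt h) + \<bar>avg h t * q t\<bar>"
        using I_le by (intro AE_I2) (simp add: space_restrict_space)
    qed (use aq M K h_pos in auto)
    also have "\<dots> = T * (M * (K * sqrt h)) + (\<integral>t. \<bar>avg h t * q t\<bar> \<partial>lebesgue_on {0<..<T})"
      using aq T0 by (simp add: measure_restrict_space)
    also have "\<dots> \<le> T * (M * (K * sqrt h)) + (\<delta> h + L2_norm {0<..<T} g) * ?D"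
    proof (rule add_left_mono)
      have "(\<integral>t. \<bar>avg h t * q t\<bar> \<partial>lebesgue_on {0<..<T}) \<le> L2_norm {0<..<T} (avg h) * L2_norm {0<..<T} q"
        by (rule L2_Cauchy_Schwarz[OF avg_L2 q_L2])
      also have "\<dots> \<le> (\<delta> h + L2_norm {0<..<T} g) * ?D"
        unfolding \<delta>_def using L2_norm_le_diff[OF avg_L2 g] q_norm D0 by (intro mult_mono) auto
      finally show "(\<integral>t. \<bar>avg h t * q t\<bar> \<partial>lebesgue_on {0<..<T}) \<le> (\<delta> h + L2_norm {0<..<T} g) * ?D" .
    qed
    finally show ?thesis .
  qed
  have h_lim: "(\<lambda>N. L / (real N + 1)) \<longlonglongrightarrow> 0"
    using LIMSEQ_Suc[OF lim_const_over_n[of L]] by (simp add: add.commute)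
  have h_right: "filterlim (\<lambda>N. L / (real N + 1)) (at_right 0) sequentially"
    by (rule tendsto_imp_filterlim_at_right[OF h_lim])
      (use L_pos in \<open>auto intro!: always_eventually divide_pos_pos\<close>)
  have "(\<lambda>N. \<delta> (L / (real N + 1))) \<longlonglongrightarrow> 0"
    using filterlim_compose[OF trace h_right] unfolding \<delta>_def avg_def .
  moreover have "(\<lambda>N. sqrt (L / (real N + 1))) \<longlonglongrightarrow> 0"
    using tendsto_real_sqrt[OF h_lim] by simp
  ultimately have "(\<lambda>N. T * (M * (K * sqrt (L / (real N + 1)))) + (\<delta> (L / (real N + 1)) + L2_norm {0<..<T} g) * ?D)
      \<longlonglongrightarrow> T * (M * (K * 0)) + (0 + L2_norm {0<..<T} g) * ?D"
    by (intro tendsto_intros)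
  then have "\<bar>?A * s \<eta>\<bar> \<le> T * (M * (K * 0)) + (0 + L2_norm {0<..<T} g) * ?D"
    by (rule LIMSEQ_le_const) (use main in blast)
  then show ?thesis by (simp add: mult.commute)
qed

end

text \<open>The function \<open>v\<close> is the sum of the variation functions of representatives
  of the two coefficients, continued by its lower bound 0 to the left and its upper bound to the
  right. \<open>G\<close> collects the points where the representatives agree with the coefficients
  and all bounds hold.\<close>

lemma bv_medium_exists:
  assumes L: "L > 0"
    and bv: "BV_on {0<..<L} \<rho>" "BV_on {0<..<L} a"
    and pos: "0 < \<rho>0" "0 < a0"
    and bounds: "AE x in lebesgue_on {0<..<L}. \<rho>0 \<le> \<rho> x \<and> \<rho> x \<le> \<rho>1"
      "AE x in lebesgue_on {0<..<L}. a0 \<le> a x \<and> a x \<le> a1"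
    and \<beta>: "AE x in lebesgue_on {0..L}. sqrt (\<rho> x / a x) \<le> \<beta>"
  obtains W v G where "bv_medium L \<rho>0 \<rho>1 a0 a1 \<beta> W \<rho> a v G"
proof -
  let ?I = "{0<..<L}"
  obtain \<rho>' a' where rep: "AE x in lebesgue_on ?I. \<rho> x = \<rho>' x" "AE x in lebesgue_on ?I. a x = a' x"
    and fv: "finite_variation_on ?I \<rho>'" "finite_variation_on ?I a'"
    using bv unfolding BV_on_def by blast
  obtain v1 M1 where v1: "\<And>x. x \<in> ?I \<Longrightarrow> 0 \<le> v1 x \<and> v1 x \<le> M1"
      "\<And>x y. x \<in> ?I \<Longrightarrow> y \<in> ?I \<Longrightarrow> x \<le> y \<Longrightarrow> \<bar>\<rho>' y - \<rho>' x\<bar> \<le> v1 y - v1 x"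
    using finite_variation_on_dominated[OF fv(1)] by blast
  obtain v2 M2 where v2: "\<And>x. x \<in> ?I \<Longrightarrow> 0 \<le> v2 x \<and> v2 x \<le> M2"
      "\<And>x y. x \<in> ?I \<Longrightarrow> y \<in> ?I \<Longrightarrow> x \<le> y \<Longrightarrow> \<bar>a' y - a' x\<bar> \<le> v2 y - v2 x"
    using finite_variation_on_dominated[OF fv(2)] by blast
  define v where "v x = (if x \<le> 0 then 0 else if L \<le> x then M1 + M2 else v1 x + v2 x)" for x
  have M: "0 \<le> M1" "0 \<le> M2" using v1(1)[of "L/2"] v2(1)[of "L/2"] L by auto
  have vb: "0 \<le> v x" "v x \<le> M1 + M2" for x
    using v1(1)[of x] v2(1)[of x] M by (auto simp: v_def)
  have vI: "v y - v x = (v1 y - v1 x) + (v2 y - v2 x)" "0 \<le> v1 y - v1 x" "0 \<le> v2 y - v2 x"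
    if "x \<in> ?I" "y \<in> ?I" "x \<le> y" for x y
    using that order_trans[OF abs_ge_zero v1(2)[OF that]] order_trans[OF abs_ge_zero v2(2)[OF that]]
    by (auto simp: v_def)
  have mono: "mono v"
  proof (rule monoI)
    fix x y :: real assume xy: "x \<le> y"
    show "v x \<le> v y"
    proof (cases "x \<in> ?I \<and> y \<in> ?I")
      case True
      then show ?thesis using vI[of x y] xy by linarith
    next
      case False
      then have "x \<le> 0 \<or> L \<le> y" using xy by auto
      then show ?thesis using vb[of x] vb[of y] xy L by (auto simp: v_def split: if_splits)
    qed
  qed
  define G where "G = {x \<in> ?I. \<rho> x = \<rho>' x \<and> a x = a' x \<and> \<rho>0 \<le> \<rho> x \<and> \<rho> x \<le> \<rho>1 \<and> a0 \<le> a x \<and> a x \<le> a1 \<and>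
      sqrt (\<rho> x / a x) \<le> \<beta>}"
  have "AE x in lebesgue_on ?I. x \<in> ?I" by (intro AE_I2) (simp add: space_restrict_space)
  moreover have "AE x in lebesgue_on ?I. sqrt (\<rho> x / a x) \<le> \<beta>"
    using \<beta> unfolding AE_lebesgue_on_Ioo_Icc .
  ultimately have "AE x in lebesgue_on ?I. x \<in> G"
    using rep bounds unfolding G_def by eventually_elim auto
  then have full: "AE x in lebesgue_on {0..L}. x \<in> G" unfolding AE_lebesgue_on_Ioo_Icc .
  have "bv_medium L \<rho>0 \<rho>1 a0 a1 \<beta> (M1 + M2) \<rho> a v G"
  proof
    show "\<rho> \<in> borel_measurable (lebesgue_on {0..L})" "a \<in> borel_measurable (lebesgue_on {0..L})"
      using bv unfolding BV_on_def by (auto intro: borel_measurable_lebesgue_on_Icc)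
    fix x y assume "x \<in> G" "y \<in> G" "x \<le> y"
    then show "\<bar>\<rho> y - \<rho> x\<bar> \<le> v y - v x" "\<bar>a y - a x\<bar> \<le> v y - v x"
      using v1(2)[of x y] v2(2)[of x y] vI[of x y] by (auto simp: G_def)
  qed (use L pos mono vb full in \<open>auto simp: G_def\<close>)
  then show thesis by (rule that)
qed

lemma test_fun_zero: "test_fun I (\<lambda>_. 0)"
proof -
  have "(deriv ^^ n) (\<lambda>_. 0) = (\<lambda>_. 0 :: real)" for n by (induction n) auto
  then show ?thesis unfolding test_fun_def by simp
qed

lemma H1_norm_zero: "H1_norm I (\<lambda>_. 0) = 0"
  by (simp add: H1_norm_def L2_norm_def)

theorem proposition3p1:
  fixes L T \<rho>0 \<rho>1 a0 a1 \<beta> :: real and \<rho> a :: "real \<Rightarrow> real"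
  assumes "L > 0"
    and "BV_on {0<..<L} \<rho>" and "BV_on {0<..<L} a"
    and "0 < \<rho>0" and "AE x in lebesgue_on {0<..<L}. \<rho>0 \<le> \<rho> x \<and> \<rho> x \<le> \<rho>1"
    and "0 < a0" and "AE x in lebesgue_on {0<..<L}. a0 \<le> a x \<and> a x \<le> a1"
    and "ereal \<beta> = esssup (lebesgue_on {0..L}) (\<lambda>x. ereal (sqrt (\<rho> x / a x)))"
    and "T > L * \<beta>"
  shows "\<exists>C>0. \<forall>s \<psi> g.
           Hm1 {0<..<T} s \<and> dist_supp {0<..<T} s \<subseteq> {L * \<beta><..<T} \<and>
           finite_energy_solution L T \<rho> a s \<psi> g \<longrightarrow>
           Hm1_norm {L * \<beta><..<T} s \<le> C * L2_norm {0<..<T} g"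
proof -
  have "AE x in lebesgue_on {0..L}. sqrt (\<rho> x / a x) \<le> \<beta>"
    using esssup_AE[of "\<lambda>x. ereal (sqrt (\<rho> x / a x))" "lebesgue_on {0..L}"]
    unfolding assms(8)[symmetric] by simp
  then obtain W v G where "bv_medium L \<rho>0 \<rho>1 a0 a1 \<beta> W \<rho> a v G"
    using bv_medium_exists[OF assms(1,2,3,4,6,5,7)] by blast
  then interpret bv_medium L \<rho>0 \<rho>1 a0 a1 \<beta> W \<rho> a v G .
  let ?A = "left_limit_trace a L" and ?D = "Zmax * exp (Vlog / 2)"
  have A: "0 < ?A"
    using left_limit_trace_ge[OF assms(1,3,7)] assms(6) by linarith
  have "\<exists>x\<in>G. 0 < x \<and> x < L" using G_dense[of 0 L] L_pos by auto
  then have "0 < \<rho>1" "0 < a1" using \<rho>_bounds a_bounds pos by (meson less_le_trans)+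
  then have D: "0 < ?D" by (simp add: Zmax_def)
  show ?thesis
  proof (intro exI conjI allI impI)
    \<comment> \<open>The numerator is the square root of the energy constant
      \<open>Zmax\<^sup>2 * exp Vlog\<close>; the denominator is the factor \<open>a(L-)\<close> of
      the weak identity, positive because it is at least \<open>a0\<close>. Neither refers to
      \<open>s\<close>.\<close>
    show "0 < ?D / ?A" using A D by simp
    fix s \<psi> g
    assume *: "Hm1 {0<..<T} s \<and> dist_supp {0<..<T} s \<subseteq> {L * \<beta><..<T} \<and> finite_energy_solution L T \<rho> a s \<psi> g"
    show "Hm1_norm {L * \<beta><..<T} s \<le> ?D / ?A * L2_norm {0<..<T} g"
      unfolding Hm1_norm_def
    proof (rule cSup_least)
      \<comment> \<open>The zero function is admissible, so the supremum is over a nonempty set and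
        any upper bound passes to it.\<close>
      show "{\<bar>s \<phi>\<bar> |\<phi>. test_fun {L * \<beta><..<T} \<phi> \<and> H1_norm {L * \<beta><..<T} \<phi> \<le> 1} \<noteq> {}"
        using test_fun_zero H1_norm_zero by force
      fix y assume "y \<in> {\<bar>s \<phi>\<bar> |\<phi>. test_fun {L * \<beta><..<T} \<phi> \<and> H1_norm {L * \<beta><..<T} \<phi> \<le> 1}"
      then obtain \<eta> where \<eta>: "y = \<bar>s \<eta>\<bar>" "test_fun {\<beta> * L<..<T} \<eta>" "H1_norm {\<beta> * L<..<T} \<eta> \<le> 1"
        by (auto simp: mult.commute)
      have "L2_norm {\<beta> * L<..<T} (deriv \<eta>) \<le> H1_norm {\<beta> * L<..<T} \<eta>"
        unfolding H1_norm_def by (rule real_le_rsqrt) simp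
      then have "\<bar>?A * s \<eta>\<bar> \<le> ?D * L2_norm {0<..<T} g"
        using duality_bound[of T s \<psi> g \<eta>] * \<eta> assms(9) by (simp add: mult.commute)
      then show "y \<le> ?D / ?A * L2_norm {0<..<T} g"
        using A \<eta>(1) by (simp add: abs_mult field_simps)
    qed
  qed
qed

end
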